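(* Let $\Omega\subset\mathbb{R}^d$ be an open, bounded, convex set. Let $\overline{\nu}\geq\underline{\nu}>0$ and $\varepsilon\in(0,1]$ be constants, and let $\overline{a}\in L^\infty(\Omega;\mathbb{R}^{d\times d}_{\mathrm{sym},+})$ satisfy $\overline{a}(x)\in\mathcal{C}(\underline{\nu},\overline{\nu},\varepsilon)$ for a.e. $x\in\Omega$. Let $g\in L^2(\Omega)$ and let $v_g\in V$ be the unique strong solution of $-\overline{a}:D^2v_g=g$ in $\Omega$, $v_g=0$ on $\partial\Omega$. If $g$ is nonnegative a.e. in $\Omega$, then $v_g$ is nonnegative a.e. in $\Omega$.
   Context: $d\geq1$. $\mathbb{R}^{d\times d}_{\mathrm{sym},+}$ is the set of real symmetric positive semidefinite $d\times d$ matrices; $A:B=\sum_{i,j}A_{ij}B_{ij}$; $|\cdot|$ is the Frobenius norm on matrices. $V:=H^2(\Omega)\cap H^1_0(\Omega)$. A strong solution is a function $v_g\in V$ satisfying the equation pointwise a.e. in $\Omega$ (the boundary condition being encoded in $V$); its existence and uniqueness under the hypotheses of the claim is known. Cordes class: for $\overline{\nu}\geq\underline{\nu}>0$ and $\varepsilon\in(0,1]$, $\mathcal{C}(\underline{\nu},\overline{\nu},\varepsilon)$ is the set of all $\overline{a}\in\mathbb{R}^{d\times d}_{\mathrm{sym},+}$ such that $\underline{\nu}|\xi|^2\leq\xi^T\overline{a}\xi\leq\overline{\nu}|\xi|^2$ for all $\xi\in\mathbb{R}^d$ and $\frac{|\overline{a}|}{\mathrm{Tr}\,\overline{a}}\leq\frac{1}{\sqrt{d-1+\varepsilon}}$.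 *)

theory Defs
  imports "HOL-Analysis.Analysis"
begin

section \<open>Matrices\<close>

text \<open>
  On \<^typ>\<open>real^'n^'n\<close> the library's inner product is \<open>A : B\<close> and its norm is the
  Frobenius norm:
\<close>

lemma inner_matrix_eq: "A \<bullet> B = (\<Sum>i\<in>UNIV. \<Sum>j\<in>UNIV. A $ i $ j * B $ i $ j)"
  for A B :: "real^'n^'m"
  by (simp add: inner_vec_def)

lemma norm_matrix_eq: "norm A = sqrt (\<Sum>i\<in>UNIV. \<Sum>j\<in>UNIV. (A $ i $ j)\<^sup>2)"
  for A :: "real^'n^'m"
  by (simp add: norm_eq_sqrt_inner inner_matrix_eq power2_eq_square)

definition sym_psd_matrices :: "(real^'n^'n) set" where
  "sym_psd_matrices = {A. transpose A = A \<and> (\<forall>\<xi>. 0 \<le> \<xi> \<bullet> (A *v \<xi>))}"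

definition cordes_class :: "real \<Rightarrow> real \<Rightarrow> real \<Rightarrow> (real^'n^'n) set" where
  "cordes_class \<nu>\<^sub>l \<nu>\<^sub>u \<epsilon> =
     {A \<in> sym_psd_matrices.
        (\<forall>\<xi>. \<nu>\<^sub>l * (norm \<xi>)\<^sup>2 \<le> \<xi> \<bullet> (A *v \<xi>) \<and> \<xi> \<bullet> (A *v \<xi>) \<le> \<nu>\<^sub>u * (norm \<xi>)\<^sup>2) \<and>
        norm A / trace A \<le> 1 / sqrt (real CARD('n) - 1 + \<epsilon>)}"


section \<open>Lebesgue and Sobolev spaces\<close>

text \<open>
  The elements of the Lebesgue and Sobolev spaces below are total functions, not equivalence
  classes; only their restriction to \<open>\<Omega>\<close> matters, and membership is invariant under changes on
  null sets.
\<close>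

definition L2_space :: "'a::euclidean_space set \<Rightarrow> ('a \<Rightarrow> real) set" where
  "L2_space \<Omega> = {u \<in> borel_measurable (lebesgue_on \<Omega>). integrable (lebesgue_on \<Omega>) (\<lambda>x. (u x)\<^sup>2)}"

definition Linf_space ::
    "'a::euclidean_space set \<Rightarrow> 'b::real_normed_vector set \<Rightarrow> ('a \<Rightarrow> 'b) set" where
  "Linf_space \<Omega> S =
     {u \<in> borel_measurable (lebesgue_on \<Omega>).
        (\<exists>C. AE x in lebesgue_on \<Omega>. norm (u x) \<le> C) \<and> (AE x in lebesgue_on \<Omega>. u x \<in> S)}"

definition L1_loc :: "'a::euclidean_space set \<Rightarrow> ('a \<Rightarrow> real) set" where
  "L1_loc \<Omega> = {u. \<forall>K. compact K \<and> K \<subseteq> \<Omega> \<longrightarrow> u absolutely_integrable_on K}"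

text \<open>
  \<open>C_diff k\<close> is \<open>C\<^sup>k\<close> on the whole space; \<open>G\<close> below is the gradient.
\<close>

primrec C_diff :: "nat \<Rightarrow> (real^'n \<Rightarrow> real) \<Rightarrow> bool" where
  "C_diff 0 \<phi> \<longleftrightarrow> continuous_on UNIV \<phi>"
| "C_diff (Suc k) \<phi> \<longleftrightarrow>
     (\<exists>G. (\<forall>x. (\<phi> has_derivative (\<lambda>h. G x \<bullet> h)) (at x)) \<and> (\<forall>i. C_diff k (\<lambda>x. G x $ i)))"

text \<open>\<open>C\<^sub>c\<^sup>\<infinity>(\<Omega>)\<close>, its elements being extended by zero to the whole space.\<close>

definition test_functions :: "(real^'n) set \<Rightarrow> (real^'n \<Rightarrow> real) set" where
  "test_functions \<Omega> =
     {\<phi>. (\<forall>k. C_diff k \<phi>) \<and> compact (closure {x. \<phi> x \<noteq> 0}) \<and> closure {x. \<phi> x \<noteq> 0} \<subseteq> \<Omega>}"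

definition partial :: "'n::finite \<Rightarrow> (real^'n \<Rightarrow> real) \<Rightarrow> real^'n \<Rightarrow> real" where
  "partial i \<phi> x = frechet_derivative \<phi> (at x) (axis i 1)"

definition has_weak_partial ::
    "(real^'n) set \<Rightarrow> 'n \<Rightarrow> (real^'n \<Rightarrow> real) \<Rightarrow> (real^'n \<Rightarrow> real) \<Rightarrow> bool" where
  "has_weak_partial \<Omega> i u w \<longleftrightarrow>
     u \<in> L1_loc \<Omega> \<and> w \<in> L1_loc \<Omega> \<and>
     (\<forall>\<phi>\<in>test_functions \<Omega>.
        (LINT x|lebesgue_on \<Omega>. u x * partial i \<phi> x) = - (LINT x|lebesgue_on \<Omega>. w x * \<phi> x))"

text \<open>
  A weak partial derivative on an open set is unique only up to null sets; \<open>weak_partial\<close> selects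
  one representative. It is meaningful only if a weak partial derivative exists.
\<close>

definition weak_partial ::
    "(real^'n) set \<Rightarrow> 'n \<Rightarrow> (real^'n \<Rightarrow> real) \<Rightarrow> real^'n \<Rightarrow> real" where
  "weak_partial \<Omega> i u = (SOME w. has_weak_partial \<Omega> i u w)"

definition weak_hessian ::
    "(real^'n) set \<Rightarrow> (real^'n \<Rightarrow> real) \<Rightarrow> real^'n \<Rightarrow> real^'n^'n" where
  "weak_hessian \<Omega> u x = (\<chi> i j. weak_partial \<Omega> j (weak_partial \<Omega> i u) x)"

definition H1_space :: "(real^'n) set \<Rightarrow> (real^'n \<Rightarrow> real) set" where
  "H1_space \<Omega> = {u \<in> L2_space \<Omega>. \<forall>i. \<exists>w\<in>L2_space \<Omega>. has_weak_partial \<Omega> i u w}"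

definition H2_space :: "(real^'n) set \<Rightarrow> (real^'n \<Rightarrow> real) set" where
  "H2_space \<Omega> = {u \<in> L2_space \<Omega>. \<forall>i. \<exists>w\<in>H1_space \<Omega>. has_weak_partial \<Omega> i u w}"

definition H1_norm :: "(real^'n) set \<Rightarrow> (real^'n \<Rightarrow> real) \<Rightarrow> real" where
  "H1_norm \<Omega> u = sqrt ((LINT x|lebesgue_on \<Omega>. (u x)\<^sup>2) +
                       (\<Sum>i\<in>UNIV. LINT x|lebesgue_on \<Omega>. (weak_partial \<Omega> i u x)\<^sup>2))"

text \<open>\<open>H\<^sup>1\<^sub>0(\<Omega>)\<close> is the closure of the test functions in \<open>H\<^sup>1(\<Omega>)\<close>.\<close>

definition H10_space :: "(real^'n) set \<Rightarrow> (real^'n \<Rightarrow> real) set" where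
  "H10_space \<Omega> =
     {u \<in> H1_space \<Omega>.
        \<exists>\<phi>. (\<forall>k. \<phi> k \<in> test_functions \<Omega>) \<and> (\<lambda>k. H1_norm \<Omega> (\<lambda>x. \<phi> k x - u x)) \<longlonglongrightarrow> 0}"


section \<open>Strong solutions of the Dirichlet problem\<close>

text \<open>\<open>-a : D\<^sup>2v = g\<close> almost everywhere in \<open>\<Omega>\<close>; membership in \<open>H\<^sup>1\<^sub>0(\<Omega>)\<close> is the boundary condition.\<close>

definition strong_solution ::
    "(real^'n) set \<Rightarrow> (real^'n \<Rightarrow> real^'n^'n) \<Rightarrow> (real^'n \<Rightarrow> real) \<Rightarrow> (real^'n \<Rightarrow> real) \<Rightarrow> bool" where
  "strong_solution \<Omega> a g v \<longleftrightarrow>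
     v \<in> H2_space \<Omega> \<inter> H10_space \<Omega> \<and>
     (AE x in lebesgue_on \<Omega>. - (a x \<bullet> weak_hessian \<Omega> v x) = g x)"

end

theory Submission
  imports Defs
begin

text \<open>
  Put \<open>\<kappa> = sqrt (1 - \<epsilon>) < 1\<close>. By the Cordes condition, \<open>a(x) : X \<le> 0\<close> implies \<open>tr X \<le> \<kappa> |X|\<close>; hence the
  coefficient disappears, and \<open>\<Delta>v \<le> \<kappa> |D\<^sup>2v|\<close> holds almost everywhere.

  Let \<open>\<beta>\<close> be smooth, convex, positive on the negative reals and zero elsewhere. Kato's inequality for
  \<open>v \<in> H\<^sup>1\<^sub>0\<close>, which has no boundary terms, shows that \<open>U = \<beta>(v)\<close>, extended by zero, satisfies
  \<open>D\<^sup>2U \<ge> S\<close> in the sense of matrix-valued distributions on the whole space, where \<open>S = \<beta>'(v) D\<^sup>2v\<close>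
  is square integrable and \<open>tr S + \<kappa> |S| \<ge> 0\<close>. Mollification preserves the first inequality, and the
  second one holds for the mollified matrix up to an error \<open>f\<close> that is small in \<open>L\<^sup>2\<close>.

  For \<open>f \<ge> 0\<close> there is a smooth \<open>w \<ge> 0\<close> with \<open>\<Delta>w + \<kappa> |D\<^sup>2w| < -f\<close>, up to a uniformly small error, and
  \<open>\<integral>w \<le> C \<parallel>f\<parallel>\<^sub>2\<close>. It is a Neumann series of truncated Newton potentials, which converges because
  \<open>\<Delta>z\<close> and \<open>D\<^sup>2z\<close> have the same \<open>L\<^sup>2\<close> norm on the whole space and \<open>\<kappa> < 1\<close>. At an interior maximum of the
  mollified \<open>U - w\<close> the matrix inequalities contradict each other, so \<open>\<integral>U \<le> \<integral>w \<le> C \<parallel>f\<parallel>\<^sub>2\<close>. Hence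
  \<open>U = 0\<close>, that is, \<open>v \<ge> 0\<close>.
\<close>

section \<open>Smooth functions\<close>

text \<open>The coefficient is merely measurable and \<open>v\<close> has only square integrable
  second derivatives, so in high dimension \<open>v\<close> need not be continuous: there is no
  maximum point to look at, and mollifying the equation would entangle the coefficient with D^2 v.
  The pair \<open>U\<close>, \<open>S\<close> can be mollified because the coefficient survives only
  in \<kappa>, an upper bound for the Frobenius distance from the identity matrix to the line
  spanned by \<open>a x\<close>. The condition tr X + \<kappa> |X| \<ge> 0 describes the complement
  of a convex cone. Averaging \<open>S\<close> may therefore violate it, and the defect is
  \<open>f\<close>. The reverse inequality required of the barrier is convex in X, so averaging
  preserves it and the barrier can be smoothed without loss. Only L2 is available: there the Hessian
  of a potential is controlled by its Laplacian with constant one, so that every \<kappa> < 1 is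
  admissible. An L2 bound on \<open>f\<close> gives no small pointwise bound on the barrier; this is
  why the barrier is measured by its integral, and why the comparison ends in a statement about the
  integral of \<open>U\<close>.\<close>

definition smooth :: "(real^'n \<Rightarrow> real) \<Rightarrow> bool" where
  "smooth \<phi> \<longleftrightarrow> (\<forall>k. C_diff k \<phi>)"

declare C_diff.simps(2) [simp del]

lemma C_diff_SucI:
  assumes "\<And>x. (\<phi> has_derivative (\<lambda>h. \<Sum>i\<in>UNIV. g i x * h $ i)) (at x)" "\<And>i. C_diff k (g i)"
  shows "C_diff (Suc k) \<phi>"
proof -
  have "(\<lambda>h. (\<chi> i. g i x) \<bullet> h) = (\<lambda>h. \<Sum>i\<in>UNIV. g i x * h $ i)" for x
    by (simp add: inner_vec_def fun_eq_iff)
  then show ?thesis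
    using assms by (auto simp: C_diff.simps(2) intro!: exI[of _ "\<lambda>x. \<chi> i. g i x"])
qed

text \<open>\<open>C_diff\<close> only asserts that some gradient exists. Uniqueness of the Frechet
  derivative identifies its components with the explicit \<open>partial i\<close>.\<close>

lemma C_diff_SucD:
  assumes "C_diff (Suc k) \<phi>"
  shows C_diff_has_derivative: "(\<phi> has_derivative (\<lambda>h. \<Sum>i\<in>UNIV. partial i \<phi> x * h $ i)) (at x)"
    and C_diff_partial: "C_diff k (partial i \<phi>)"
proof -
  obtain G where G: "\<And>x. (\<phi> has_derivative (\<lambda>h. G x \<bullet> h)) (at x)" "\<And>i. C_diff k (\<lambda>x. G x $ i)"
    using assms by (auto simp: C_diff.simps(2))
  have p: "partial i \<phi> x = G x $ i" for i x
    using frechet_derivative_at[OF G(1)[of x]]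
    by (auto simp: partial_def fun_eq_iff inner_axis dest: spec[of _ "axis i 1"])
  then have "partial i \<phi> = (\<lambda>x. G x $ i)" by auto
  then show "C_diff k (partial i \<phi>)" using G(2) by simp
  show "(\<phi> has_derivative (\<lambda>h. \<Sum>i\<in>UNIV. partial i \<phi> x * h $ i)) (at x)"
    using G(1)[of x] by (simp add: p inner_vec_def)
qed

lemma partial_eqI:
  assumes "(\<phi> has_derivative (\<lambda>h. \<Sum>i\<in>UNIV. g i * h $ i)) (at x)"
  shows "partial i \<phi> x = g i"
  using frechet_derivative_at[OF assms]
  by (auto simp: partial_def fun_eq_iff axis_def if_distrib[where f="\<lambda>a. _ * a"] dest!: spec[of _ "axis i 1"] cong: if_cong)

lemma C_diff_continuous: "C_diff k \<phi> \<Longrightarrow> continuous_on UNIV \<phi>"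
  by (cases k) (auto intro!: continuous_at_imp_continuous_on dest: C_diff_has_derivative has_derivative_continuous)

lemma C_diff_Suc_imp: "C_diff (Suc k) \<phi> \<Longrightarrow> C_diff k \<phi>"
proof (induction k arbitrary: \<phi>)
  case 0 then show ?case using C_diff_continuous[OF 0] by simp
next
  case (Suc k)
  show ?case
    by (rule C_diff_SucI[where g="\<lambda>i. partial i \<phi>"])
       (auto intro: Suc.IH C_diff_has_derivative[OF Suc.prems] C_diff_partial[OF Suc.prems])
qed

lemma C_diff_const [simp]: "C_diff k (\<lambda>x. c)"
proof (induction k arbitrary: c)
  case (Suc k)
  show ?case by (rule C_diff_SucI[where g="\<lambda>_ _. 0"]) (auto intro: Suc)
qed auto

lemma C_diff_add: "C_diff k f \<Longrightarrow> C_diff k g \<Longrightarrow> C_diff k (\<lambda>x. f x + g x)"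
proof (induction k arbitrary: f g)
  case (Suc k)
  have "(f has_derivative (\<lambda>h. \<Sum>i\<in>UNIV. partial i f x * h $ i)) (at x)" "C_diff k (partial i f)" for x i
    using C_diff_SucD[OF Suc.prems(1)] .
  moreover have "(g has_derivative (\<lambda>h. \<Sum>i\<in>UNIV. partial i g x * h $ i)) (at x)" "C_diff k (partial i g)" for x i
    using C_diff_SucD[OF Suc.prems(2)] .
  ultimately show ?case
    by (intro C_diff_SucI[where g="\<lambda>i x. partial i f x + partial i g x"])
       (auto intro!: Suc.IH derivative_eq_intros simp: sum.distrib algebra_simps)
qed (auto intro: continuous_intros)

lemma C_diff_mult: "C_diff k f \<Longrightarrow> C_diff k g \<Longrightarrow> C_diff k (\<lambda>x. f x * g x)"
proof (induction k arbitrary: f g)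
  case (Suc k)
  have f: "(f has_derivative (\<lambda>h. \<Sum>i\<in>UNIV. partial i f x * h $ i)) (at x)" "C_diff k (partial i f)" for x i
    using C_diff_SucD[OF Suc.prems(1)] .
  have g: "(g has_derivative (\<lambda>h. \<Sum>i\<in>UNIV. partial i g x * h $ i)) (at x)" "C_diff k (partial i g)" for x i
    using C_diff_SucD[OF Suc.prems(2)] .
  have "C_diff k f" "C_diff k g" using Suc.prems by (auto intro: C_diff_Suc_imp)
  then show ?case using f g
    by (intro C_diff_SucI[where g="\<lambda>i x. f x * partial i g x + partial i f x * g x"] C_diff_add Suc.IH)
       (auto intro!: has_derivative_eq_rhs[OF has_derivative_mult] simp: sum.distrib algebra_simps sum_distrib_left fun_eq_iff)
qed (auto intro: continuous_intros)

lemma C_diff_component: "C_diff k (\<lambda>x. x $ i)"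
proof (cases k)
  case (Suc l)
  show ?thesis unfolding Suc
    by (rule C_diff_SucI[where g="\<lambda>j x. if j = i then 1 else 0"])
       (auto intro!: derivative_eq_intros bounded_linear_imp_has_derivative bounded_linear_vec_nth simp: if_distrib[where f="\<lambda>a. a * _"] cong: if_cong)
qed (auto intro: continuous_intros)

lemma smooth_const [simp]: "smooth (\<lambda>x. c)"
  and smooth_component [simp]: "smooth (\<lambda>x. x $ i)"
  and smooth_add [intro]: "smooth f \<Longrightarrow> smooth g \<Longrightarrow> smooth (\<lambda>x. f x + g x)"
  and smooth_mult [intro]: "smooth f \<Longrightarrow> smooth g \<Longrightarrow> smooth (\<lambda>x. f x * g x)"
  by (auto simp: smooth_def C_diff_component intro: C_diff_add C_diff_mult)

lemma smooth_diff [intro]: "smooth f \<Longrightarrow> smooth g \<Longrightarrow> smooth (\<lambda>x. f x - g x)"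
  using smooth_add[OF _ smooth_mult[OF smooth_const[of "-1"]], of f g] by simp

lemma smooth_sum [intro]: "(\<And>i. i \<in> A \<Longrightarrow> smooth (f i)) \<Longrightarrow> smooth (\<lambda>x. \<Sum>i\<in>A. f i x)"
  by (induction A rule: infinite_finite_induct) auto

lemma smooth_partial [intro]: "smooth \<phi> \<Longrightarrow> smooth (partial i \<phi>)"
  unfolding smooth_def by (metis C_diff_SucD)

lemma smooth_has_derivative:
  "smooth \<phi> \<Longrightarrow> (\<phi> has_derivative (\<lambda>h. \<Sum>i\<in>UNIV. partial i \<phi> x * h $ i)) (at x)"
  unfolding smooth_def by (metis C_diff_SucD)

lemma smooth_continuous: "smooth \<phi> \<Longrightarrow> continuous_on UNIV \<phi>"
  unfolding smooth_def by (metis C_diff_continuous)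

text \<open>Meant for convolutions and reflections: their partial derivatives have the same shape
  with another kernel, so a single differentiation step settles all orders. The induction proves
  \<open>Suc k\<close>, since membership in the class yields a derivative at once.\<close>

lemma smooth_coinduct:
  assumes "X \<phi>"
    and step: "\<And>\<phi>. X \<phi> \<Longrightarrow> \<exists>g. (\<forall>x. (\<phi> has_derivative (\<lambda>h. \<Sum>i\<in>UNIV. g i x * h $ i)) (at x)) \<and> (\<forall>i. X (g i))"
  shows "smooth \<phi>"
proof -
  have "X \<phi> \<Longrightarrow> C_diff (Suc k) \<phi>" for k \<phi>
  proof (induction k arbitrary: \<phi>)
    case 0
    obtain g where g: "\<And>x. (\<phi> has_derivative (\<lambda>h. \<Sum>i\<in>UNIV. g i x * h $ i)) (at x)" "\<And>i. X (g i)"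
      using step[OF 0] by auto
    \<comment> \<open>The base case also needs continuous partial derivatives; they come from
      applying \<open>step\<close> a second time.\<close>
    have "continuous_on UNIV (g i)" for i
      using step[OF g(2)[of i]] by (auto intro!: continuous_at_imp_continuous_on dest: has_derivative_continuous)
    then show ?case using C_diff_SucI[OF g(1)] by simp
  next
    case (Suc k)
    obtain g where g: "\<And>x. (\<phi> has_derivative (\<lambda>h. \<Sum>i\<in>UNIV. g i x * h $ i)) (at x)" "\<And>i. X (g i)"
      using step[OF Suc.prems] by auto
    show ?case using C_diff_SucI[OF g(1)] Suc.IH g(2) by blast
  qed
  then show ?thesis using assms(1) C_diff_Suc_imp unfolding smooth_def by blast
qed

lemma partial_add: "smooth f \<Longrightarrow> smooth g \<Longrightarrow> partial i (\<lambda>x. f x + g x) = (\<lambda>x. partial i f x + partial i g x)"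
  by (rule ext, rule partial_eqI)
     (auto intro!: derivative_eq_intros smooth_has_derivative simp: sum.distrib algebra_simps)

lemma partial_mult:
  "smooth f \<Longrightarrow> smooth g \<Longrightarrow> partial i (\<lambda>x. f x * g x) = (\<lambda>x. f x * partial i g x + partial i f x * g x)"
  by (rule ext, rule partial_eqI)
     (auto intro!: has_derivative_eq_rhs[OF has_derivative_mult] smooth_has_derivative
        simp: sum.distrib algebra_simps sum_distrib_left fun_eq_iff)

lemma partial_const [simp]: "partial i (\<lambda>x. c) = (\<lambda>x. 0)"
  by (rule ext, rule partial_eqI) simp

lemma partial_cmult: "smooth f \<Longrightarrow> partial i (\<lambda>x. c * f x) = (\<lambda>x. c * partial i f x)"
  by (subst partial_mult) auto

lemma partial_diff: "smooth f \<Longrightarrow> smooth g \<Longrightarrow> partial i (\<lambda>x. f x - g x) = (\<lambda>x. partial i f x - partial i g x)"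
  by (rule ext, rule partial_eqI)
     (auto intro!: derivative_eq_intros smooth_has_derivative simp: sum_subtractf algebra_simps)

lemma partial_component: "partial i (\<lambda>x. x $ j) = (\<lambda>x. if i = j then 1 else 0)"
  by (rule ext, rule partial_eqI)
     (auto intro!: derivative_eq_intros bounded_linear_imp_has_derivative bounded_linear_vec_nth simp: if_distrib[where f="\<lambda>a. a * _"] cong: if_cong)

lemma partial_sum:
  "(\<And>j. j \<in> A \<Longrightarrow> smooth (f j)) \<Longrightarrow> partial i (\<lambda>x. \<Sum>j\<in>A. f j x) = (\<lambda>x. \<Sum>j\<in>A. partial i (f j) x)"
  by (induction A rule: infinite_finite_induct) (auto simp: partial_add smooth_sum)

lemma smooth_directional:
  assumes "smooth \<phi>"
  shows "((\<lambda>t. \<phi> (x + t *\<^sub>R \<xi>)) has_real_derivative (\<Sum>i\<in>UNIV. partial i \<phi> (x + t *\<^sub>R \<xi>) * \<xi> $ i)) (at t)"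
proof -
  have "((\<lambda>t. x + t *\<^sub>R \<xi>) has_derivative (\<lambda>h. h *\<^sub>R \<xi>)) (at t)"
    by (auto intro!: derivative_eq_intros)
  from has_derivative_compose[OF this smooth_has_derivative[OF assms]]
  show ?thesis
    unfolding has_field_derivative_def
    by (rule has_derivative_eq_rhs) (simp add: sum_distrib_left mult_ac fun_eq_iff)
qed

text \<open>Both mixed partials are the limit of the second difference quotient, by the mean value theorem applied twice.\<close>

lemma second_difference:
  fixes f :: "real^'n \<Rightarrow> real"
  assumes "smooth f" "h > 0"
  shows "\<exists>a b. 0 < a \<and> a < h \<and> 0 < b \<and> b < h \<and>
    f (x + h *\<^sub>R axis i 1 + h *\<^sub>R axis j 1) - f (x + h *\<^sub>R axis i 1) - f (x + h *\<^sub>R axis j 1) + f x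
      = h\<^sup>2 * partial j (partial i f) (x + a *\<^sub>R axis i 1 + b *\<^sub>R axis j 1)"
proof -
  have ax: "(\<Sum>k\<in>UNIV. c k * axis l 1 $ k) = c l" for c :: "'n \<Rightarrow> real" and l :: 'n
    by (simp add: axis_def if_distrib[where f="\<lambda>a. _ * a"] cong: if_cong)
  have D: "((\<lambda>t. \<phi> (y + t *\<^sub>R axis l 1)) has_real_derivative partial l \<phi> (y + t *\<^sub>R axis l 1)) (at t)"
    if "smooth \<phi>" for \<phi> :: "real^'n \<Rightarrow> real" and y l t
    using smooth_directional[OF that, of y "axis l 1" t] by (simp add: ax)
  let ?g = "\<lambda>t. f (x + h *\<^sub>R axis j 1 + t *\<^sub>R axis i 1) - f (x + t *\<^sub>R axis i 1)"
  have "(?g has_real_derivative (partial i f (x + h *\<^sub>R axis j 1 + t *\<^sub>R axis i 1) - partial i f (x + t *\<^sub>R axis i 1))) (at t)" for t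
    by (intro DERIV_diff D assms)
  from MVT2[OF assms(2), of ?g, OF this] obtain a where a: "0 < a" "a < h"
    "?g h - ?g 0 = h * (partial i f (x + h *\<^sub>R axis j 1 + a *\<^sub>R axis i 1) - partial i f (x + a *\<^sub>R axis i 1))"
    by auto
  let ?k = "\<lambda>t. partial i f (x + a *\<^sub>R axis i 1 + t *\<^sub>R axis j 1)"
  have "(?k has_real_derivative partial j (partial i f) (x + a *\<^sub>R axis i 1 + t *\<^sub>R axis j 1)) (at t)" for t
    using assms by (intro D) auto
  from MVT2[OF assms(2), of ?k, OF this] obtain b where b: "0 < b" "b < h"
    "?k h - ?k 0 = h * partial j (partial i f) (x + a *\<^sub>R axis i 1 + b *\<^sub>R axis j 1)"
    by auto
  show ?thesis using a b
    by (intro exI[of _ a] exI[of _ b]) (simp add: algebra_simps power2_eq_square)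
qed

lemma partial_commute:
  fixes f :: "real^'n \<Rightarrow> real"
  assumes "smooth f"
  shows "partial i (partial j f) = partial j (partial i f)"
proof
  fix x
  define h :: "nat \<Rightarrow> real" where "h = (\<lambda>n. inverse (real (Suc n)))"
  have h: "h n > 0" for n by (simp add: h_def)
  have h0: "h \<longlonglongrightarrow> 0" unfolding h_def by (rule LIMSEQ_inverse_real_of_nat)
  have lim: "(\<lambda>n. partial k (partial l f) (x + a n *\<^sub>R axis l 1 + b n *\<^sub>R axis k 1)) \<longlonglongrightarrow> partial k (partial l f) x"
    if "\<And>n. 0 < a n \<and> a n < h n \<and> 0 < b n \<and> b n < h n" for a b k l
  proof -
    have "a \<longlonglongrightarrow> 0" "b \<longlonglongrightarrow> 0"
      using that by (auto intro!: tendsto_sandwich[OF _ _ tendsto_const h0] always_eventually less_imp_le)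
    then have "(\<lambda>n. x + a n *\<^sub>R axis l 1 + b n *\<^sub>R axis k (1::real)) \<longlonglongrightarrow> x + 0 *\<^sub>R axis l 1 + 0 *\<^sub>R axis k 1"
      by (intro tendsto_intros)
    moreover have "isCont (partial k (partial l f)) x"
      using smooth_continuous[OF smooth_partial[OF smooth_partial[OF assms]]] continuous_on_eq_continuous_at open_UNIV by blast
    ultimately show ?thesis by (simp add: isCont_tendsto_compose[where g="partial k (partial l f)"])
  qed
  have "\<forall>n. \<exists>a b. 0 < a \<and> a < h n \<and> 0 < b \<and> b < h n \<and>
    f (x + h n *\<^sub>R axis l 1 + h n *\<^sub>R axis k 1) - f (x + h n *\<^sub>R axis l 1) - f (x + h n *\<^sub>R axis k 1) + f x
      = (h n)\<^sup>2 * partial k (partial l f) (x + a *\<^sub>R axis l 1 + b *\<^sub>R axis k 1)" for k l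
    using second_difference[OF assms h] by blast
  then obtain a b where ab: "\<And>l k n. 0 < a l k n \<and> a l k n < h n \<and> 0 < b l k n \<and> b l k n < h n \<and>
    f (x + h n *\<^sub>R axis l 1 + h n *\<^sub>R axis k 1) - f (x + h n *\<^sub>R axis l 1) - f (x + h n *\<^sub>R axis k 1) + f x
      = (h n)\<^sup>2 * partial k (partial l f) (x + a l k n *\<^sub>R axis l 1 + b l k n *\<^sub>R axis k 1)"
    by metis
  \<comment> \<open>The second difference is symmetric in \<open>i\<close> and \<open>j\<close>, so
    the two mean value formulas agree; their intermediate points differ, but both converge to
    \<open>x\<close>.\<close>
  have "partial i (partial j f) (x + a j i n *\<^sub>R axis j 1 + b j i n *\<^sub>R axis i 1) =
        partial j (partial i f) (x + a i j n *\<^sub>R axis i 1 + b i j n *\<^sub>R axis j 1)" for n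
  proof -
    have "(h n)\<^sup>2 * partial i (partial j f) (x + a j i n *\<^sub>R axis j 1 + b j i n *\<^sub>R axis i 1) =
        (h n)\<^sup>2 * partial j (partial i f) (x + a i j n *\<^sub>R axis i 1 + b i j n *\<^sub>R axis j 1)"
      using ab[of i j n] ab[of j i n] by (simp add: algebra_simps)
    then show ?thesis using h[of n] by simp
  qed
  then show "partial i (partial j f) x = partial j (partial i f) x"
    using lim[of "a j i" "b j i" i j] lim[of "a i j" "b i j" j i] ab LIMSEQ_unique by auto
qed

section \<open>Smooth functions of one variable\<close>

text \<open>All derivatives are exhibited at once as a sequence, which suits \<open>flat\<close> and
  \<open>scale_integral\<close>, where the n-th derivative has an explicit formula.\<close>

definition smooth1 :: "(real \<Rightarrow> real) \<Rightarrow> bool" where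
  "smooth1 f \<longleftrightarrow> (\<exists>D. D 0 = f \<and> (\<forall>n x. (D n has_real_derivative D (Suc n) x) (at x)))"

lemma smooth1_has_derivative:
  assumes "smooth1 f"
  shows "(f has_real_derivative deriv f x) (at x)" "smooth1 (deriv f)"
proof -
  obtain D where D: "D 0 = f" "\<And>n x. (D n has_real_derivative D (Suc n) x) (at x)"
    using assms by (auto simp: smooth1_def)
  have "deriv f = D 1"
    using DERIV_imp_deriv[OF D(2)[of 0]] D(1) by auto
  moreover have "smooth1 (D 1)"
    unfolding smooth1_def using D(2) by (intro exI[of _ "\<lambda>n. D (Suc n)"]) auto
  ultimately show "(f has_real_derivative deriv f x) (at x)" "smooth1 (deriv f)"
    using D(2)[of 0] D(1) by auto
qed

lemma smooth1I:
  assumes "\<And>x. (f has_real_derivative g x) (at x)" "smooth1 g"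
  shows "smooth1 f"
proof -
  obtain D where D: "D 0 = g" "\<And>n x. (D n has_real_derivative D (Suc n) x) (at x)"
    using assms by (auto simp: smooth1_def)
  have "((case n of 0 \<Rightarrow> f | Suc m \<Rightarrow> D m) has_real_derivative D n x) (at x)" for n x
    using assms(1) D by (cases n) auto
  then show ?thesis
    unfolding smooth1_def by (intro exI[of _ "case_nat f D"]) auto
qed

lemma smooth1_continuous: "smooth1 f \<Longrightarrow> continuous_on UNIV f"
  by (meson smooth1_has_derivative(1) DERIV_isCont continuous_at_imp_continuous_on)

lemma has_derivative_compose1:
  fixes \<phi> :: "real^'n \<Rightarrow> real"
  assumes "(f has_real_derivative f') (at (\<phi> x))"
    "(\<phi> has_derivative (\<lambda>h. \<Sum>i\<in>UNIV. g i * h $ i)) (at x)"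
  shows "((\<lambda>x. f (\<phi> x)) has_derivative (\<lambda>h. \<Sum>i\<in>UNIV. (f' * g i) * h $ i)) (at x)"
  using has_derivative_compose[OF assms(2) assms(1)[unfolded has_field_derivative_def]]
  by (simp add: sum_distrib_left mult_ac)

lemma C_diff_compose1: "C_diff k \<phi> \<Longrightarrow> smooth1 f \<Longrightarrow> C_diff k (\<lambda>x. f (\<phi> x))"
\<comment> \<open>\<open>f\<close> is generalized because the chain rule replaces it by
  \<open>deriv f\<close>.\<close>
proof (induction k arbitrary: f)
  case 0
  show ?case using continuous_on_compose2[OF smooth1_continuous[OF 0(2)], of UNIV \<phi>] 0 by simp
next
  case (Suc k)
  show ?case
  proof (rule C_diff_SucI[where g="\<lambda>i x. deriv f (\<phi> x) * partial i \<phi> x"])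
    show "((\<lambda>x. f (\<phi> x)) has_derivative (\<lambda>h. \<Sum>i\<in>UNIV. deriv f (\<phi> x) * partial i \<phi> x * h $ i)) (at x)" for x
      by (rule has_derivative_compose1[OF smooth1_has_derivative(1)[OF Suc.prems(2)] C_diff_has_derivative[OF Suc.prems(1)]])
  qed (use Suc smooth1_has_derivative(2) C_diff_Suc_imp in \<open>auto intro!: C_diff_mult C_diff_partial\<close>)
qed

lemma smooth_compose1: "smooth1 f \<Longrightarrow> smooth \<phi> \<Longrightarrow> smooth (\<lambda>x. f (\<phi> x))"
  unfolding smooth_def using C_diff_compose1 by blast

lemma partial_compose1:
  "(\<And>t. (f has_real_derivative f' t) (at t)) \<Longrightarrow> smooth \<phi> \<Longrightarrow>
    partial i (\<lambda>x. f (\<phi> x)) = (\<lambda>x. f' (\<phi> x) * partial i \<phi> x)"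
  by (rule ext, rule partial_eqI, rule has_derivative_compose1) (auto intro: smooth_has_derivative)

section \<open>Flat functions of one variable and the convex profile\<close>

text \<open>For \<open>p = 1\<close> this is the classical function exp(-1/t), smooth across 0.
  Admitting polynomials in 1/t makes the family closed under differentiation.\<close>

definition flat :: "real poly \<Rightarrow> real \<Rightarrow> real" where
  "flat p t = (if 0 < t then poly p (inverse t) * exp (- inverse t) else 0)"

text \<open>Supplies the Lipschitz constants of the convex profile and, applied to
  \<open>[:0,0,1:] * p\<close>, the quadratic decay of \<open>flat p\<close> at the origin.\<close>

lemma flat_bounded: "\<exists>C. \<forall>t. \<bar>flat p t\<bar> \<le> C"
proof -
  \<comment> \<open>A single term of the exponential series gives s^n / n! \<le> exp s.\<close>
  have *: "s ^ n * exp (- s) \<le> fact n" if "s \<ge> 0" for s :: real and n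
  proof -
    have "s ^ n / fact n \<le> exp s"
      using sum_le_suminf[of "\<lambda>n. s ^ n / fact n" "{n}"] summable_exp[of s] that
      by (auto simp: exp_def divide_inverse mult.commute)
    then have "s ^ n \<le> fact n * exp s" by (simp add: field_simps)
    then have "s ^ n * exp (- s) \<le> fact n * exp s * exp (- s)" by (intro mult_right_mono) auto
    then show ?thesis by (simp add: mult.assoc exp_minus_inverse)
  qed
  have "\<bar>flat p t\<bar> \<le> (\<Sum>i\<le>degree p. \<bar>coeff p i\<bar> * fact i)" for t
  proof (cases "t > 0")
    case True
    let ?s = "inverse t"
    have "\<bar>flat p t\<bar> = \<bar>\<Sum>i\<le>degree p. coeff p i * (?s ^ i * exp (- ?s))\<bar>"
      using True by (simp add: flat_def poly_altdef sum_distrib_right mult.assoc)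
    also have "\<dots> \<le> (\<Sum>i\<le>degree p. \<bar>coeff p i\<bar> * (?s ^ i * exp (- ?s)))"
      by (rule order_trans[OF sum_abs]) (use True in \<open>auto simp: abs_mult intro!: sum_mono\<close>)
    also have "\<dots> \<le> (\<Sum>i\<le>degree p. \<bar>coeff p i\<bar> * fact i)"
      using True by (intro sum_mono mult_left_mono *) auto
    finally show ?thesis .
  qed (auto simp: flat_def intro!: sum_nonneg)
  then show ?thesis by blast
qed

lemma DERIV_zero_if_quadratic:
  fixes f :: "real \<Rightarrow> real"
  assumes "\<And>h. \<bar>f h\<bar> \<le> C * h\<^sup>2"
  shows "(f has_real_derivative 0) (at 0)"
proof -
  have "f 0 = 0" using assms[of 0] by simp
  have "\<bar>f h / h\<bar> \<le> C * \<bar>h\<bar>" for h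
  proof -
    have "\<bar>f h / h\<bar> = \<bar>f h\<bar> / \<bar>h\<bar>" by (rule abs_divide)
    also have "\<dots> \<le> C * h\<^sup>2 / \<bar>h\<bar>" by (rule divide_right_mono[OF assms]) simp
    also have "\<dots> = C * \<bar>h\<bar>"
      by (cases h "0::real" rule: linorder_cases) (simp_all add: power2_eq_square)
    finally show ?thesis .
  qed
  then have ev: "\<forall>\<^sub>F h in at 0. norm (f h / h) \<le> C * \<bar>h\<bar>"
    unfolding real_norm_def by (rule always_eventually[OF allI])
  have "((\<lambda>h. C * \<bar>h\<bar>) \<longlongrightarrow> 0) (at 0)"
    by (rule tendsto_eq_rhs[OF tendsto_mult[OF tendsto_const tendsto_rabs[OF tendsto_ident_at]]]) simp
  from Lim_null_comparison[OF ev this] have "((\<lambda>h. f h / h) \<longlongrightarrow> 0) (at 0)" .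
  then show ?thesis using \<open>f 0 = 0\<close> by (simp add: DERIV_def)
qed

text \<open>With s = 1/t one has d/dt = - s^2 d/ds, which sends p(s) exp(-s) to s^2 (p - p')(s)
  exp(-s).\<close>

lemma flat_has_derivative:
  "(flat p has_real_derivative flat ([:0,0,1:] * (p - pderiv p)) t) (at t)"
proof -
  consider "t > 0" | "t < 0" | "t = 0" by linarith
  then show ?thesis
  proof cases
    case 1
    have "((\<lambda>t. poly p (inverse t) * exp (- inverse t)) has_real_derivative
       flat ([:0,0,1:] * (p - pderiv p)) t) (at t)"
      using 1
      by (auto intro!: derivative_eq_intros DERIV_chain2[OF poly_DERIV] simp: flat_def algebra_simps power2_eq_square)
    then show ?thesis
      by (rule has_field_derivative_transform_within_open[of _ _ _ "{0<..}"]) (use 1 in \<open>auto simp: flat_def\<close>)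
  next
    case 2
    have "((\<lambda>t. 0) has_real_derivative flat ([:0,0,1:] * (p - pderiv p)) t) (at t)"
      using 2 by (simp add: flat_def)
    then show ?thesis
      by (rule has_field_derivative_transform_within_open[of _ _ _ "{..<0}"]) (use 2 in \<open>auto simp: flat_def\<close>)
  next
    case 3
    \<comment> \<open>Boundedness of s^2 p(s) exp(-s) says that \<open>flat p t\<close> is O(t^2),
      so the derivative at the junction is 0.\<close>
    obtain C where C: "\<And>t. \<bar>flat ([:0,0,1:] * p) t\<bar> \<le> C" using flat_bounded by metis
    have "\<bar>flat p t\<bar> \<le> C * t\<^sup>2" for t
      using C[of t] by (cases "t > 0") (auto simp: flat_def abs_mult field_simps power2_eq_square)
    then have "(flat p has_real_derivative 0) (at 0)"
      by (rule DERIV_zero_if_quadratic)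
    then show ?thesis using 3 by (simp add: flat_def)
  qed
qed

lemma smooth1_flat: "smooth1 (flat p)"
  unfolding smooth1_def
proof (intro exI conjI allI)
  let ?D = "\<lambda>n. flat (((\<lambda>p. [:0,0,1:] * (p - pderiv p)) ^^ n) p)"
  show "?D 0 = flat p" by simp
  show "(?D n has_real_derivative ?D (Suc n) x) (at x)" for n x
    unfolding funpow.simps comp_apply by (rule flat_has_derivative)
qed

lemma flat_eq_0 [simp]: "t \<le> 0 \<Longrightarrow> flat p t = 0"
  by (simp add: flat_def)

lemma flat_nonneg: "(\<And>s. s > 0 \<Longrightarrow> poly p s \<ge> 0) \<Longrightarrow> flat p t \<ge> 0"
  by (simp add: flat_def)

text \<open>A smooth convex substitute for the positive part. The factor \<open>t\<close> is
  essential: exp(-1/t) alone is concave for t > 1/2, whereas t exp(-1/t) has second derivative t^-3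
  exp(-1/t), and its first two derivatives are bounded.\<close>

definition ramp :: "real \<Rightarrow> real" where
  "ramp t = t * flat 1 t"

lemma ramp_has_derivative: "(ramp has_real_derivative flat [:1,1:] t) (at t)"
  unfolding ramp_def [abs_def]
  by (rule DERIV_cong[OF DERIV_mult[OF DERIV_ident flat_has_derivative]]) (auto simp: flat_def algebra_simps)

lemma flat_has_derivative_ramp: "(flat [:1,1:] has_real_derivative flat [:0,0,0,1:] t) (at t)"
  using flat_has_derivative[of "[:1,1:]" t] by (simp add: pderiv_pCons)

lemma smooth1_ramp: "smooth1 ramp"
  by (rule smooth1I[OF ramp_has_derivative smooth1_flat])

lemma ramp_nonneg: "ramp t \<ge> 0"
  and ramp_eq_0_iff: "ramp t = 0 \<longleftrightarrow> t \<le> 0"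
  by (auto simp: ramp_def flat_def)

section \<open>Radial kernels as integrals over scales\<close>

definition flat_deriv :: "nat \<Rightarrow> real \<Rightarrow> real" where
  "flat_deriv n = flat (((\<lambda>p. [:0,0,1:] * (p - pderiv p)) ^^ n) 1)"

lemma flat_deriv_has_derivative: "(flat_deriv n has_real_derivative flat_deriv (Suc n) t) (at t)"
  using flat_has_derivative[of "((\<lambda>p. [:0,0,1:] * (p - pderiv p)) ^^ n) 1" t]
  by (simp add: flat_deriv_def del: mult_pCons_left)

lemma flat_deriv_1: "flat_deriv (Suc 0) = flat [:0,0,1:]"
  by (simp add: flat_deriv_def one_pCons pderiv_pCons)

lemma continuous_flat_deriv: "continuous_on A (flat_deriv n)"
  by (meson flat_deriv_has_derivative DERIV_isCont continuous_at_imp_continuous_on)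

text \<open>
  In dimension \<open>d\<close>, with \<open>e = flat 1\<close>, the function \<open>N(x) = \<integral>\<^sub>s\<^sup>T t\<^sup>1\<^sup>-\<^sup>d e(1 - |x|\<^sup>2/t\<^sup>2) dt\<close> is a Newton kernel
  cut off at the scales \<open>s\<close> and \<open>T\<close>: one has \<open>-\<Delta>N = \<rho>\<^sub>s - \<rho>\<^sub>T\<close> for \<open>\<rho>\<^sub>t(x) = 2 t\<^sup>-\<^sup>d e'(1 - |x|\<^sup>2/t\<^sup>2)\<close>.
  \<open>scale_integral (d - 1) s T n\<close> is the \<open>n\<close>-th derivative of \<open>N\<close> as a function of \<open>|x|\<^sup>2\<close>.
\<close>

definition scale_integral :: "nat \<Rightarrow> real \<Rightarrow> real \<Rightarrow> nat \<Rightarrow> real \<Rightarrow> real" where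
  "scale_integral m s T n u = integral {s..T}
     (\<lambda>t. inverse t ^ m * (- (inverse t)\<^sup>2) ^ n * flat_deriv n (1 - u * (inverse t)\<^sup>2))"

lemma continuous_scale_integrand:
  assumes "0 < s"
  shows "continuous_on (A \<times> {s..T}) (\<lambda>(u, t). inverse t ^ m * (- (inverse t)\<^sup>2) ^ n * flat_deriv n (1 - u * (inverse t)\<^sup>2))"
  unfolding split_beta using assms
  by (intro continuous_intros continuous_on_compose2[OF continuous_flat_deriv[of UNIV]]) auto

lemma continuous_scale_integrand':
  assumes "0 < s"
  shows "continuous_on {s..T} (\<lambda>t. inverse t ^ m * (- (inverse t)\<^sup>2) ^ n * flat_deriv n (1 - u * (inverse t)\<^sup>2))"
  using assms
  by (intro continuous_intros continuous_on_compose2[OF continuous_flat_deriv[of UNIV]]) auto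

text \<open>The lower cutoff \<open>s > 0\<close> keeps the integrand and its derivatives jointly
  continuous, so differentiation under the integral is allowed; each derivative in \<open>u\<close>
  produces the inner factor - t^-2.\<close>

lemma scale_integral_has_derivative:
  assumes "0 < s"
  shows "(scale_integral m s T n has_real_derivative scale_integral m s T (Suc n) u) (at u)"
proof -
  let ?f = "\<lambda>n u t. inverse t ^ m * (- (inverse t)\<^sup>2) ^ n * flat_deriv n (1 - u * (inverse t)\<^sup>2)"
  have "((\<lambda>u. integral (cbox s T) (?f n u)) has_real_derivative integral (cbox s T) (?f (Suc n) u)) (at u within UNIV)"
  proof (rule leibniz_rule_field_derivative)
    fix u t
    show "((\<lambda>u. ?f n u t) has_real_derivative ?f (Suc n) u t) (at u within UNIV)"
      by (auto intro!: derivative_eq_intros DERIV_chain2[OF flat_deriv_has_derivative])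
    show "?f n u integrable_on cbox s T"
      using continuous_scale_integrand'[OF assms] by (intro integrable_continuous) simp
    show "continuous_on (UNIV \<times> cbox s T) (\<lambda>(u, t). ?f (Suc n) u t)"
      using continuous_scale_integrand[OF assms, of UNIV T m "Suc n"] by (simp only: cbox_interval)
  qed auto
  then show ?thesis unfolding scale_integral_def[abs_def] by simp
qed

lemma smooth1_scale_integral: "0 < s \<Longrightarrow> smooth1 (scale_integral m s T n)"
  unfolding smooth1_def
  by (intro exI[of _ "\<lambda>k. scale_integral m s T (n + k)"]) (auto intro: scale_integral_has_derivative)

lemma scale_integral_nonneg: "0 < s \<Longrightarrow> scale_integral m s T 0 u \<ge> 0"
  unfolding scale_integral_def
  by (intro integral_nonneg integrable_continuous_interval continuous_scale_integrand')
     (auto simp: flat_deriv_def intro!: mult_nonneg_nonneg flat_nonneg)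

lemma scale_integral_eq_0:
  assumes "0 < s" "T\<^sup>2 \<le> u" shows "scale_integral m s T n u = 0"
proof -
  have "flat_deriv n (1 - u * (inverse t)\<^sup>2) = 0" if "t \<in> {s..T}" for t
  proof -
    have "t\<^sup>2 \<le> u" using that assms by (intro order_trans[OF power_mono[of t T 2]]) auto
    then have "1 \<le> u * (inverse t)\<^sup>2" using that assms by (auto simp: field_simps)
    then show ?thesis by (simp add: flat_deriv_def)
  qed
  then have "scale_integral m s T n u = integral {s..T} (\<lambda>t. 0)"
    unfolding scale_integral_def by (intro integral_cong) simp
  then show ?thesis by simp
qed

text \<open>The integrand of the left-hand side is the \<open>t\<close>-derivative of \<open>2 t\<^sup>-\<^sup>m\<^sup>-\<^sup>1 e'(1 - u/t\<^sup>2)\<close>.\<close>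

lemma scale_integral_laplace:
  assumes "0 < s" "s \<le> T"
  shows "4 * u * scale_integral m s T (Suc (Suc 0)) u + 2 * real (Suc m) * scale_integral m s T (Suc 0) u =
    2 * inverse T ^ Suc m * flat [:0,0,1:] (1 - u * (inverse T)\<^sup>2) -
    2 * inverse s ^ Suc m * flat [:0,0,1:] (1 - u * (inverse s)\<^sup>2)"
proof -
  let ?f = "\<lambda>n t. inverse t ^ m * (- (inverse t)\<^sup>2) ^ n * flat_deriv n (1 - u * (inverse t)\<^sup>2)"
  let ?P = "\<lambda>t. 2 * inverse t ^ Suc m * flat_deriv 1 (1 - u * (inverse t)\<^sup>2)"
  have i: "?f n integrable_on {s..T}" for n
    by (intro integrable_continuous_interval continuous_scale_integrand' assms)
  have "((\<lambda>t. 4 * u * ?f 2 t + 2 * real (Suc m) * ?f 1 t) has_integral ?P T - ?P s) {s..T}"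
  proof (rule fundamental_theorem_of_calculus[OF assms(2)])
    fix t assume t: "t \<in> {s..T}"
    then have t0: "t \<noteq> 0" using assms by auto
    have i: "(inverse has_real_derivative - (inverse t)\<^sup>2) (at t within {s..T})"
      using DERIV_inverse[OF t0] by (simp add: numeral_2_eq_2 has_field_derivative_at_within)
    have j: "((\<lambda>t. 1 - u * (inverse t)\<^sup>2) has_real_derivative 2 * u * inverse t ^ 3) (at t within {s..T})"
      by (rule DERIV_cong[OF DERIV_diff[OF DERIV_const DERIV_cmult[OF DERIV_power[OF i]]]])
         (simp add: power2_eq_square power3_eq_cube)
    have f1: "(flat_deriv 1 has_real_derivative flat_deriv 2 x) (at x)" for x
      using flat_deriv_has_derivative[of 1 x] by (simp add: numeral_2_eq_2)
    have h1: "((\<lambda>t. flat_deriv 1 (1 - u * (inverse t)\<^sup>2)) has_real_derivative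
        flat_deriv 2 (1 - u * (inverse t)\<^sup>2) * (2 * u * inverse t ^ 3)) (at t within {s..T})"
      by (rule DERIV_cong[OF DERIV_chain2[OF f1 j]]) simp
    have h2: "((\<lambda>t. 2 * inverse t ^ Suc m) has_real_derivative
        2 * (- (inverse t)\<^sup>2 * (real (Suc m) * inverse t ^ m))) (at t within {s..T})"
      using DERIV_cmult[OF DERIV_power_Suc[OF i, of m], of 2] by (simp add: algebra_simps)
    \<comment> \<open>Abstracting 1/t as \<open>I\<close> and t^-m as \<open>J\<close> turns the
      verification into a polynomial identity without divisions.\<close>
    have alg: "2 * (- I\<^sup>2 * (k * J)) * F1 + F2 * (2 * u * I ^ 3) * (2 * (I * J)) =
        4 * u * (J * (- I\<^sup>2)\<^sup>2 * F2) + 2 * k * (J * (- I\<^sup>2) ^ 1 * F1)" for k I J F1 F2 :: real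
      by (simp add: power2_eq_square power3_eq_cube algebra_simps)
    have "(?P has_real_derivative 4 * u * ?f 2 t + 2 * real (Suc m) * ?f 1 t) (at t within {s..T})"
      by (rule DERIV_cong[OF DERIV_mult[OF h2 h1]])
         (subst power_Suc, rule alg)
    then show "(?P has_vector_derivative 4 * u * ?f 2 t + 2 * real (Suc m) * ?f 1 t) (at t within {s..T})"
      by (simp add: has_real_derivative_iff_has_vector_derivative)
  qed
  then have "?P T - ?P s = integral {s..T} (\<lambda>t. 4 * u * ?f 2 t + 2 * real (Suc m) * ?f 1 t)"
    by (rule integral_unique[symmetric])
  also have "\<dots> = 4 * u * integral {s..T} (?f 2) + 2 * real (Suc m) * integral {s..T} (?f 1)"
    by (subst integral_add[OF integrable_on_mult_right[OF i] integrable_on_mult_right[OF i]])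
       (simp only: integral_mult_right)
  finally show ?thesis
    unfolding scale_integral_def flat_deriv_1[symmetric] One_nat_def[symmetric] numeral_2_eq_2[symmetric, unfolded One_nat_def[symmetric]]
    by (simp only: Suc_1)
qed

section \<open>Integration by parts\<close>

text \<open>Compactly supported smooth functions on the whole space, with no domain attached. The
  support is recorded by a radius, which sums, products and convolutions pass on directly.\<close>

definition csmooth :: "(real^'n \<Rightarrow> real) \<Rightarrow> bool" where
  "csmooth \<phi> \<longleftrightarrow> smooth \<phi> \<and> (\<exists>r. \<forall>x. r < norm x \<longrightarrow> \<phi> x = 0)"

lemma csmooth_imp_smooth: "csmooth \<phi> \<Longrightarrow> smooth \<phi>"
  by (simp add: csmooth_def)

lemma csmooth_mult1: "smooth f \<Longrightarrow> csmooth g \<Longrightarrow> csmooth (\<lambda>x. f x * g x)"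
  and csmooth_mult2: "csmooth f \<Longrightarrow> smooth g \<Longrightarrow> csmooth (\<lambda>x. f x * g x)"
  by (auto simp: csmooth_def)

lemma csmooth_0 [simp]: "csmooth (\<lambda>x. 0)"
  by (auto simp: csmooth_def)

lemma csmooth_add:
  assumes "csmooth f" "csmooth g" shows "csmooth (\<lambda>x. f x + g x)"
proof -
  obtain r r' where "\<And>x. r < norm x \<Longrightarrow> f x = 0" "\<And>x. r' < norm x \<Longrightarrow> g x = 0"
    using assms by (auto simp: csmooth_def)
  then have "\<forall>x. max r r' < norm x \<longrightarrow> f x + g x = 0" by simp
  then have "\<exists>r. \<forall>x. r < norm x \<longrightarrow> f x + g x = 0" ..
  then show ?thesis using assms by (simp add: csmooth_def smooth_add)
qed

lemma csmooth_sum: "(\<And>i. i \<in> A \<Longrightarrow> csmooth (f i)) \<Longrightarrow> csmooth (\<lambda>x. \<Sum>i\<in>A. f i x)"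
  by (induction A rule: infinite_finite_induct) (auto intro: csmooth_add)

lemma partial_eq_0_open:
  assumes "open S" "x \<in> S" "\<And>y. y \<in> S \<Longrightarrow> \<phi> y = 0"
  shows "partial i \<phi> x = 0"
proof -
  have "(\<phi> has_derivative (\<lambda>h. \<Sum>i\<in>UNIV. 0 * h $ i)) (at x)"
    by (rule has_derivative_transform_within_open[of "\<lambda>x. 0" _ _ _ S]) (use assms in auto)
  from partial_eqI[OF this] show ?thesis by simp
qed

lemma csmooth_partial: "csmooth \<phi> \<Longrightarrow> csmooth (partial i \<phi>)"
proof -
  assume "csmooth \<phi>"
  then obtain r where r: "smooth \<phi>" "\<And>x. r < norm x \<Longrightarrow> \<phi> x = 0" by (auto simp: csmooth_def)
  have "open {x::real^'a. r < norm x}" by (intro open_Collect_less continuous_intros)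
  then have "partial i \<phi> x = 0" if "r < norm x" for x
    using that r by (intro partial_eq_0_open[of "{x. r < norm x}"]) auto
  then show ?thesis using r by (auto simp: csmooth_def)
qed

lemma csmooth_bounded:
  assumes "csmooth \<phi>" shows "\<exists>B>0. \<forall>x. \<bar>\<phi> x\<bar> \<le> B"
proof -
  obtain r where r: "smooth \<phi>" "\<And>x. r < norm x \<Longrightarrow> \<phi> x = 0"
    using assms by (auto simp: csmooth_def)
  have "bounded (\<phi> ` cball 0 r)"
    using smooth_continuous[OF r(1)]
    by (intro compact_imp_bounded compact_continuous_image) (auto intro: continuous_on_subset)
  then obtain B where B: "\<forall>x\<in>cball 0 r. \<bar>\<phi> x\<bar> \<le> B" unfolding bounded_iff by auto
  have "\<bar>\<phi> x\<bar> \<le> max B 1" for x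
    using B r(2)[of x] by (cases "norm x \<le> r") force+
  then show ?thesis by (intro exI[of _ "max B 1"]) auto
qed

lemma borel_measurable_smooth: "smooth \<phi> \<Longrightarrow> \<phi> \<in> borel_measurable borel"
  by (intro borel_measurable_continuous_onI smooth_continuous)

lemma integrable_bounded_support:
  fixes f :: "'a::euclidean_space \<Rightarrow> real"
  assumes "f \<in> borel_measurable borel" "\<And>x. \<bar>f x\<bar> \<le> B" "\<And>x. r < norm x \<Longrightarrow> f x = 0"
  shows "integrable lborel f"
proof (rule Bochner_Integration.integrable_bound)
  show "integrable lborel (\<lambda>x. indicator (cball 0 r) x * B)"
    by (intro integrable_mult_left integrable_real_indicator emeasure_lborel_cball_finite) simp
  show "AE x in lborel. norm (f x) \<le> norm (indicator (cball 0 r) x * B)"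
  proof (rule AE_I2)
    fix x
    show "norm (f x) \<le> norm (indicator (cball 0 r) x * B)"
      using assms(2)[of x] assms(3)[of x] by (cases "r < norm x") (auto simp: indicator_def)
  qed
qed (use assms in simp)

lemma csmooth_integrable: "csmooth \<phi> \<Longrightarrow> integrable lborel \<phi>"
proof -
  assume a: "csmooth \<phi>"
  obtain B where "B > 0" "\<And>x. \<bar>\<phi> x\<bar> \<le> B" using csmooth_bounded[OF a] by auto
  then show ?thesis
    using a integrable_bounded_support[of \<phi> B] by (auto simp: csmooth_def borel_measurable_smooth)
qed

section \<open>Invariance of Lebesgue measure and its consequences for derivatives\<close>

lemma distr_lborel_reflect: "distr lborel borel (\<lambda>x. c - x) = (lborel :: 'a::euclidean_space measure)"
  using lborel_affine[of "-1" c]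
  by (simp add: density_1 algebra_simps)

lemma integral_reflect_translate:
  fixes f :: "'a::euclidean_space \<Rightarrow> real"
  assumes "f \<in> borel_measurable borel"
  shows "(\<integral>x. f (c - x) \<partial>lborel) = (\<integral>x. f x \<partial>lborel)"
  using integral_distr[of "\<lambda>x. c - x" lborel borel f] assms by (simp add: distr_lborel_reflect)

lemma integrable_reflect_translate:
  fixes f :: "'a::euclidean_space \<Rightarrow> real"
  assumes "integrable lborel f"
  shows "integrable lborel (\<lambda>x. f (c - x))"
  using integrable_distr[of "\<lambda>x. c - x" lborel borel f] assms by (simp add: distr_lborel_reflect)

lemma integral_translate:
  fixes f :: "'a::euclidean_space \<Rightarrow> real"
  assumes "f \<in> borel_measurable borel"
  shows "(\<integral>x. f (c + x) \<partial>lborel) = (\<integral>x. f x \<partial>lborel)"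
  using integral_distr[of "(+) c" lborel borel f] assms by (simp add: lborel_distr_plus)

lemma integrable_translate:
  fixes f :: "'a::euclidean_space \<Rightarrow> real"
  assumes "integrable lborel f"
  shows "integrable lborel (\<lambda>x. f (c + x))"
  using integrable_distr[of "(+) c" lborel borel f] assms by (simp add: lborel_distr_plus)

lemma smooth_axis_derivative:
  fixes \<phi> :: "real^'n \<Rightarrow> real"
  assumes "smooth \<phi>"
  shows "((\<lambda>t. \<phi> (x + t *\<^sub>R axis i 1)) has_real_derivative partial i \<phi> (x + t *\<^sub>R axis i 1)) (at t)"
proof -
  have "(\<Sum>k\<in>UNIV. c k * axis i 1 $ k) = c i" for c :: "'n \<Rightarrow> real"
    by (simp add: axis_def if_distrib[where f="\<lambda>a. _ * a"] cong: if_cong)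
  then show ?thesis using smooth_directional[OF assms, of x "axis i 1" t] by simp
qed

text \<open>By translation invariance every difference quotient has integral zero, and dominated
  convergence passes this on to the derivative; no iterated integrals are involved.\<close>

lemma integral_partial_eq_0:
  fixes \<phi> :: "real^'n \<Rightarrow> real"
  assumes "csmooth \<phi>"
  shows "(\<integral>x. partial i \<phi> x \<partial>lborel) = 0"
proof -
  let ?h = "\<lambda>n. inverse (real (Suc n))"
  let ?q = "\<lambda>n x. (\<phi> (?h n *\<^sub>R axis i 1 + x) - \<phi> x) / ?h n"
  obtain r where r: "smooth \<phi>" "\<And>x. r < norm x \<Longrightarrow> \<phi> x = 0"
    using assms by (auto simp: csmooth_def)
  obtain B where B: "B > 0" "\<And>x. \<bar>partial i \<phi> x\<bar> \<le> B"
    using csmooth_bounded[OF csmooth_partial[OF assms]] by metis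
  have bq: "\<bar>?q n x\<bar> \<le> B" for n x
  proof -
    have "0 < ?h n" by simp
    from MVT2[OF this, of "\<lambda>t. \<phi> (x + t *\<^sub>R axis i 1)", OF smooth_axis_derivative[OF r(1)]]
    obtain z where "\<phi> (x + ?h n *\<^sub>R axis i 1) - \<phi> x = ?h n * partial i \<phi> (x + z *\<^sub>R axis i 1)"
      by auto
    then have "?q n x = partial i \<phi> (x + z *\<^sub>R axis i 1)"
      by (simp add: add.commute field_simps)
    then show ?thesis using B by simp
  qed
  \<comment> \<open>The step \<open>?h n\<close> is at most 1, so all quotients vanish outside the
    same ball and one dominating function serves for every \<open>n\<close>.\<close>
  have q0: "?q n x = 0" if "r + 1 < norm x" for n x
  proof -
    have "norm x \<le> norm (?h n *\<^sub>R axis i 1 + x) + norm (?h n *\<^sub>R axis i (1::real))"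
      by (metis add_diff_cancel_left' norm_triangle_ineq4 add.commute)
    moreover have "norm (?h n *\<^sub>R axis i (1::real)) \<le> 1"
      by (simp add: field_simps)
    ultimately show ?thesis using that r(2) by auto
  qed
  have "(\<lambda>n. \<integral>x. ?q n x \<partial>lborel) \<longlonglongrightarrow> (\<integral>x. partial i \<phi> x \<partial>lborel)"
  proof (rule integral_dominated_convergence)
    show "integrable lborel (\<lambda>x. indicator (cball 0 (r + 1)) x * B)"
      by (intro integrable_mult_left integrable_real_indicator emeasure_lborel_cball_finite) simp
    show "AE x in lborel. (\<lambda>n. ?q n x) \<longlonglongrightarrow> partial i \<phi> x"
    proof (rule AE_I2)
      fix x
      have "((\<lambda>t. \<phi> (x + t *\<^sub>R axis i 1)) has_real_derivative partial i \<phi> x) (at 0)"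
        using smooth_axis_derivative[OF r(1), of x i 0] by simp
      then have "((\<lambda>h. (\<phi> (x + h *\<^sub>R axis i 1) - \<phi> x) / h) \<longlongrightarrow> partial i \<phi> x) (at 0)"
        by (simp add: DERIV_def)
      moreover have "filterlim ?h (at 0) sequentially"
        using LIMSEQ_inverse_real_of_nat by (intro filterlim_atI) auto
      ultimately show "(\<lambda>n. ?q n x) \<longlonglongrightarrow> partial i \<phi> x"
        by (auto dest: filterlim_compose simp: add.commute)
    qed
    show "AE x in lborel. norm (?q n x) \<le> indicator (cball 0 (r + 1)) x * B" for n
      using bq q0 B(1) by (intro AE_I2) (auto simp: indicator_def not_le)
    show "?q n \<in> borel_measurable lborel" for n
      using r(1) by (auto intro!: borel_measurable_continuous_onI continuous_intros continuous_on_compose2[OF smooth_continuous[OF r(1)]])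
    show "partial i \<phi> \<in> borel_measurable lborel"
      using r(1) borel_measurable_smooth by auto
  qed
  moreover have "(\<integral>x. ?q n x \<partial>lborel) = 0" for n
    using csmooth_integrable[OF assms] integral_translate[of \<phi> "?h n *\<^sub>R axis i 1"]
      borel_measurable_smooth[OF r(1)] integrable_translate[of \<phi> "?h n *\<^sub>R axis i 1"]
    by simp
  ultimately show ?thesis by (simp add: LIMSEQ_const_iff)
qed

lemma integral_by_parts:
  assumes "csmooth f" "smooth g"
  shows "(\<integral>x. f x * partial i g x \<partial>lborel) = - (\<integral>x. partial i f x * g x \<partial>lborel)"
proof -
  have "0 = (\<integral>x. f x * partial i g x + partial i f x * g x \<partial>lborel)"
    using integral_partial_eq_0[OF csmooth_mult2[OF assms], of i] assms
    by (simp add: partial_mult csmooth_imp_smooth)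
  also have "\<dots> = (\<integral>x. f x * partial i g x \<partial>lborel) + (\<integral>x. partial i f x * g x \<partial>lborel)"
    using assms by (intro Bochner_Integration.integral_add csmooth_integrable csmooth_mult2 csmooth_partial smooth_partial)
  finally show ?thesis by simp
qed

text \<open>Summed over \<open>i\<close> and \<open>j\<close>, this says that \<open>\<Delta>z\<close> and \<open>D\<^sup>2z\<close> have the same \<open>L\<^sup>2\<close> norm.\<close>

lemma integral_hessian_sq:
  assumes "csmooth z"
  shows "(\<integral>x. partial i (partial i z) x * partial j (partial j z) x \<partial>lborel) =
    (\<integral>x. (partial i (partial j z) x)\<^sup>2 \<partial>lborel)"
proof -
  note s = csmooth_imp_smooth[OF assms]
  have "(\<integral>x. partial i (partial i z) x * partial j (partial j z) x \<partial>lborel) =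
      - (\<integral>x. partial i z x * partial i (partial j (partial j z)) x \<partial>lborel)"
    using integral_by_parts[of "partial i z" "partial j (partial j z)" i] assms s
    by (simp add: csmooth_partial smooth_partial)
  also have "\<dots> = - (\<integral>x. partial i z x * partial j (partial i (partial j z)) x \<partial>lborel)"
    using partial_commute[OF smooth_partial[OF s], of i j j] by simp
  also have "\<dots> = (\<integral>x. partial j (partial i z) x * partial i (partial j z) x \<partial>lborel)"
    using integral_by_parts[of "partial i z" "partial i (partial j z)" j] assms s
    by (simp add: csmooth_partial smooth_partial)
  also have "\<dots> = (\<integral>x. (partial i (partial j z) x)\<^sup>2 \<partial>lborel)"
    using partial_commute[OF s, of j i] by (simp add: power2_eq_square)
  finally show ?thesis .
qed

section \<open>The mollifier and the truncated Newton kernel\<close>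

lemma smooth_inner_self: "smooth (\<lambda>x::real^'n. x \<bullet> x)"
  unfolding inner_vec_def inner_real_def by (intro smooth_sum smooth_mult smooth_component)

lemma partial_inner_self: "partial i (\<lambda>x. x \<bullet> x) = (\<lambda>x::real^'n. 2 * x $ i)"
proof -
  have "partial i (\<lambda>x. x \<bullet> x) = (\<lambda>x::real^'n. \<Sum>j\<in>UNIV. partial i (\<lambda>x. x $ j * x $ j) x)"
    unfolding inner_vec_def inner_real_def by (intro partial_sum smooth_mult smooth_component)
  also have "\<dots> = (\<lambda>x. 2 * x $ i)"
    by (simp add: partial_mult partial_component sum.distrib if_distrib[where f="\<lambda>a. a * _"] if_distrib[where f="\<lambda>a. _ * a"] cong: if_cong)
  finally show ?thesis .
qed

text \<open>The density on the right of \<open>scale_integral_laplace\<close> for m + 1 = d and u =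
  |x|^2; \<open>flat [:0,0,1:]\<close> is the derivative of exp(-1/t).\<close>

definition bump :: "real \<Rightarrow> real^'n \<Rightarrow> real" where
  "bump s x = 2 * inverse s ^ CARD('n) * flat [:0,0,1:] (1 - (x \<bullet> x) * (inverse s)\<^sup>2)"

text \<open>The normalizing constant is that of scale 1 for every \<open>s\<close>, which is correct
  by \<open>integral_bump\<close>. Sharing it with \<open>kern\<close> keeps the Laplace identity
  exact.\<close>

definition moll :: "real \<Rightarrow> real^'n \<Rightarrow> real" where
  "moll s x = bump s x / (LBINT y::real^'n. bump 1 y)"

definition kern :: "real \<Rightarrow> real \<Rightarrow> real^'n \<Rightarrow> real" where
  "kern s T x = scale_integral (CARD('n) - Suc 0) s T 0 (x \<bullet> x) / (LBINT y::real^'n. bump 1 y)"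

lemma bump_nonneg: "0 < s \<Longrightarrow> bump s x \<ge> 0"
  unfolding bump_def by (intro mult_nonneg_nonneg flat_nonneg) auto

lemma bump_eq_0: "0 < s \<Longrightarrow> s \<le> norm x \<Longrightarrow> bump s x = 0"
proof -
  assume s: "0 < s" "s \<le> norm x"
  then have "s\<^sup>2 \<le> (norm x)\<^sup>2" by (intro power_mono) auto
  then have "1 \<le> (x \<bullet> x) * (inverse s)\<^sup>2"
    using s by (simp add: field_simps power2_norm_eq_inner)
  then show ?thesis by (simp add: bump_def)
qed

lemma csmooth_bump: "0 < s \<Longrightarrow> csmooth (bump s)"
  unfolding csmooth_def
proof
  show "smooth (bump s)"
    unfolding bump_def
    by (intro smooth_mult smooth_const smooth_compose1[OF smooth1_flat] smooth_diff smooth_inner_self)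
qed (auto intro!: exI[of _ s] bump_eq_0)

lemma smooth_scale_integral: "0 < s \<Longrightarrow> smooth (\<lambda>x. scale_integral m s T n (x \<bullet> x))"
  by (rule smooth_compose1[OF smooth1_scale_integral smooth_inner_self])

lemma csmooth_scale_integral: "0 < s \<Longrightarrow> 0 < T \<Longrightarrow> csmooth (\<lambda>x. scale_integral m s T n (x \<bullet> x))"
  unfolding csmooth_def
proof (intro conjI smooth_scale_integral exI[of _ T] allI impI)
  fix x :: "real^'n" assume "0 < s" "0 < T" "T < norm x"
  then show "scale_integral m s T n (x \<bullet> x) = 0"
    by (intro scale_integral_eq_0) (auto simp flip: power2_norm_eq_inner intro!: power_mono)
qed

text \<open>A radial function F(|x|^2) has Laplacian 4 |x|^2 F'' + 2 d F', and this combination is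
  what \<open>scale_integral_laplace\<close> evaluates.\<close>

lemma laplace_scale_integral:
  fixes x :: "real^'n"
  assumes "0 < s" "s \<le> T"
  shows "(\<Sum>i\<in>UNIV. partial i (partial i (\<lambda>x. scale_integral (CARD('n) - Suc 0) s T 0 (x \<bullet> x))) x) = bump T x - bump s x"
proof -
  let ?G = "\<lambda>n x. scale_integral (CARD('n) - Suc 0) s T n (x \<bullet> x)"
  have 1: "partial i (?G n) = (\<lambda>x. ?G (Suc n) x * (2 * x $ i))" for i :: 'n and n
    using partial_compose1[OF scale_integral_has_derivative[OF assms(1)] smooth_inner_self]
    by (simp add: partial_inner_self)
  have 2: "partial i (partial i (?G 0)) x = ?G (Suc 0) x * 2 + ?G (Suc (Suc 0)) x * (2 * x $ i) * (2 * x $ i)" for i :: 'n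
    by (simp add: 1 partial_mult smooth_scale_integral assms smooth_mult partial_component)
  have q: "(\<Sum>i\<in>UNIV. c * (2 * x $ i) * (2 * x $ i)) = 4 * (x \<bullet> x) * c" for c
    by (simp add: inner_vec_def sum_distrib_left mult_ac)
  have "(\<Sum>i\<in>UNIV. partial i (partial i (?G 0)) x) = 2 * CARD('n) * ?G (Suc 0) x + 4 * (x \<bullet> x) * ?G (Suc (Suc 0)) x"
    unfolding 2 sum.distrib q by simp
  also have "\<dots> = bump T x - bump s x"
    using scale_integral_laplace[OF assms, of "x \<bullet> x" "CARD('n) - Suc 0"]
    by (simp add: bump_def mult_ac)
  finally show ?thesis .
qed

text \<open>The difference of two bumps is the Laplacian of a compactly supported function, hence
  has integral zero; this replaces a change of variables.\<close>

lemma integral_bump: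
  assumes "0 < s"
  shows "(LBINT x::real^'n. bump s x) = (LBINT x::real^'n. bump 1 x)"
proof -
  have eq: "(LBINT x::real^'n. bump T x) = (LBINT x::real^'n. bump s x)" if "0 < s" "s \<le> T" for s T
  proof -
    let ?N = "\<lambda>x::real^'n. scale_integral (CARD('n) - Suc 0) s T 0 (x \<bullet> x)"
    have N: "csmooth ?N" using that by (intro csmooth_scale_integral) auto
    have "0 = (\<Sum>i\<in>UNIV. LBINT x. partial i (partial i ?N) x)"
      using integral_partial_eq_0[OF csmooth_partial[OF N]] by simp
    also have "\<dots> = (LBINT x. (\<Sum>i\<in>UNIV. partial i (partial i ?N) x))"
      by (intro Bochner_Integration.integral_sum[symmetric] csmooth_integrable csmooth_partial N)
    also have "\<dots> = (LBINT x::real^'n. bump T x) - (LBINT x::real^'n. bump s x)"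
      unfolding laplace_scale_integral[OF that]
      by (intro Bochner_Integration.integral_diff csmooth_integrable csmooth_bump) (use that in auto)
    finally show ?thesis by simp
  qed
  show ?thesis
  proof (cases "s \<le> 1")
    case True then show ?thesis using eq[of s 1] assms by metis
  next
    case False then show ?thesis using eq[of 1 s] by (metis linear zero_less_one)
  qed
qed

lemma integral_bump_pos: "(LBINT x::real^'n. bump 1 x) > 0"
proof -
  have "continuous_on UNIV (bump 1 :: real^'n \<Rightarrow> real)"
    by (intro smooth_continuous csmooth_imp_smooth csmooth_bump) simp
  moreover have "bump 1 (0::real^'n) > 0" by (simp add: bump_def flat_def)
  ultimately have "open {x::real^'n. bump 1 x > 0}" "{x::real^'n. bump 1 x > 0} \<noteq> {}"
    by (auto intro!: open_Collect_less continuous_intros)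
  then have "\<not> negligible {x::real^'n. bump 1 x > 0}" using open_not_negligible by blast
  moreover have "(LBINT x::real^'n. bump 1 x) \<noteq> 0"
  proof
    assume "(LBINT x::real^'n. bump 1 x) = 0"
    then have "AE x in lborel. bump 1 (x::real^'n) = 0"
      by (subst (asm) integral_nonneg_eq_0_iff_AE)
         (auto intro!: csmooth_integrable[OF csmooth_bump] bump_nonneg)
    then have "AE x in lebesgue. bump 1 (x::real^'n) = 0" by (rule AE_completion)
    then have "negligible {x::real^'n. bump 1 x \<noteq> 0}"
      by (simp add: eventually_ae_filter_negligible) (metis (no_types, lifting) mem_Collect_eq negligible_subset subsetI)
    then have "negligible {x::real^'n. bump 1 x > 0}"
      by (rule negligible_subset) auto
    then show False using calculation by simp
  qed
  moreover have "(LBINT x::real^'n. bump 1 x) \<ge> 0"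
    by (intro Bochner_Integration.integral_nonneg bump_nonneg) simp
  ultimately show ?thesis by linarith
qed

lemma csmooth_moll: "0 < s \<Longrightarrow> csmooth (moll s)"
  unfolding moll_def divide_inverse by (rule csmooth_mult2[OF csmooth_bump smooth_const])

lemma csmooth_kern: "0 < s \<Longrightarrow> 0 < T \<Longrightarrow> csmooth (kern s T)"
  unfolding kern_def divide_inverse by (rule csmooth_mult2[OF csmooth_scale_integral smooth_const])

lemma moll_nonneg: "0 < s \<Longrightarrow> moll s x \<ge> 0"
  unfolding moll_def using integral_bump_pos by (intro divide_nonneg_pos bump_nonneg)

lemma kern_nonneg: "0 < s \<Longrightarrow> kern s T x \<ge> 0"
  unfolding kern_def using integral_bump_pos by (intro divide_nonneg_pos scale_integral_nonneg)

lemma moll_eq_0: "0 < s \<Longrightarrow> s \<le> norm x \<Longrightarrow> moll s x = 0"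
  by (simp add: moll_def bump_eq_0)

lemma integral_moll: "0 < s \<Longrightarrow> (LBINT x::real^'n. moll s x) = 1"
  using integral_bump_pos[where 'n='n] integral_bump[of s, where 'n='n] by (simp add: moll_def)

text \<open>Of interest for large \<open>s\<close>: the bound then tends to zero, so the far part
  \<open>moll T\<close> of the Laplacian of the truncated kernel is uniformly small.\<close>

lemma moll_bounded: "\<exists>M>0. \<forall>s>0. \<forall>x::real^'n. moll s x \<le> M * inverse s ^ CARD('n)"
proof -
  obtain C where C: "\<And>t. \<bar>flat [:0,0,1:] t\<bar> \<le> C" using flat_bounded by metis
  let ?m = "LBINT y::real^'n. bump 1 y"
  have "moll s x \<le> (2 * (C + 1) / ?m) * inverse s ^ CARD('n)" if "s > 0" for s and x :: "real^'n"
  proof -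
    have "flat [:0,0,1:] (1 - (x \<bullet> x) * (inverse s)\<^sup>2) \<le> C + 1"
      using C[of "1 - (x \<bullet> x) * (inverse s)\<^sup>2"] by linarith
    then have "bump s x \<le> 2 * inverse s ^ CARD('n) * (C + 1)"
      unfolding bump_def using that by (intro mult_left_mono) auto
    then have "moll s x \<le> 2 * inverse s ^ CARD('n) * (C + 1) / ?m"
      unfolding moll_def using integral_bump_pos[where 'n='n] by (intro divide_right_mono) auto
    also have "\<dots> = (2 * (C + 1) / ?m) * inverse s ^ CARD('n)" by (simp only: times_divide_eq_left times_divide_eq_right mult_ac)
    finally show ?thesis .
  qed
  moreover have "C \<ge> 0" using C[of 0] by simp
  ultimately show ?thesis
    using integral_bump_pos[where 'n='n] by (intro exI[of _ "2 * (C + 1) / ?m"]) auto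
qed

lemma laplace_kern:
  fixes x :: "real^'n"
  assumes "0 < s" "s \<le> T"
  shows "(\<Sum>i\<in>UNIV. partial i (partial i (kern s T)) x) = moll T x - moll s x"
proof -
  let ?N = "\<lambda>x::real^'n. scale_integral (CARD('n) - Suc 0) s T 0 (x \<bullet> x)"
  let ?c = "inverse (LBINT y::real^'n. bump 1 y)"
  have N: "smooth ?N" using assms by (intro smooth_scale_integral)
  have "kern s T = (\<lambda>x. ?c * ?N x)" by (simp add: kern_def fun_eq_iff field_simps)
  then have "(\<Sum>i\<in>UNIV. partial i (partial i (kern s T)) x) = (\<Sum>i\<in>UNIV. ?c * partial i (partial i ?N) x)"
    using N by (simp add: partial_cmult smooth_partial)
  also have "\<dots> = ?c * (bump T x - bump s x)"
    by (simp add: laplace_scale_integral[OF assms] flip: sum_distrib_left)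
  finally show ?thesis by (simp add: moll_def divide_inverse_commute right_diff_distrib)
qed

text \<open>Testing \<open>-\<Delta> kern = moll s - moll T\<close> against \<open>|x|\<^sup>2\<close>.\<close>

lemma integral_kern_le:
  assumes "0 < s" "s \<le> T"
  shows "(LBINT x::real^'n. kern s T x) \<le> T\<^sup>2"
proof -
  let ?K = "kern s T :: real^'n \<Rightarrow> real" and ?q = "\<lambda>x::real^'n. x \<bullet> x"
  have K: "csmooth ?K" using assms by (intro csmooth_kern) auto
  have M: "csmooth (moll t :: real^'n \<Rightarrow> real)" if "t > 0" for t using that by (rule csmooth_moll)
  have T: "T > 0" using assms by simp
  have "(LBINT x. ?K x * 2) = (LBINT x. partial i (partial i ?K) x * ?q x)" for i
  proof -
    have "(LBINT x. ?K x * partial i (partial i ?q) x) = - (LBINT x. partial i ?K x * partial i ?q x)"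
      by (intro integral_by_parts K smooth_partial smooth_inner_self)
    also have "\<dots> = (LBINT x. partial i (partial i ?K) x * ?q x)"
      using integral_by_parts[OF csmooth_partial[OF K] smooth_inner_self] by simp
    finally show ?thesis by (simp add: partial_inner_self partial_cmult partial_component)
  qed
  then have "(\<Sum>i\<in>(UNIV::'n set). LBINT x. ?K x * 2) = (\<Sum>i\<in>UNIV. LBINT x. partial i (partial i ?K) x * ?q x)"
    by simp
  also have "\<dots> = (LBINT x. (\<Sum>i\<in>UNIV. partial i (partial i ?K) x * ?q x))"
    by (intro Bochner_Integration.integral_sum[symmetric] csmooth_integrable csmooth_partial csmooth_mult2 K smooth_inner_self)
  also have "\<dots> = (LBINT x. (moll T x - moll s x) * ?q x)"
    by (simp add: laplace_kern[OF assms] flip: sum_distrib_right)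
  \<comment> \<open>\<open>moll s\<close> enters with a favourable sign and \<open>moll T\<close>
    lives where |x| \<le> T, so the bound is independent of the inner cutoff
    \<open>s\<close>.\<close>
  also have "\<dots> \<le> (LBINT x::real^'n. moll T x * T\<^sup>2)"
  proof (rule integral_mono)
    show "integrable lborel (\<lambda>x::real^'n. (moll T x - moll s x) * ?q x)"
      using csmooth_integrable[OF csmooth_mult2[OF M smooth_inner_self]] assms T
      by (auto simp: left_diff_distrib)
    show "integrable lborel (\<lambda>x::real^'n. moll T x * T\<^sup>2)"
      using csmooth_integrable[OF M[OF T]] by simp
    show "(moll T x - moll s x) * ?q x \<le> moll T x * T\<^sup>2" for x :: "real^'n"
    proof -
      have "moll T x * ?q x \<le> moll T x * T\<^sup>2"
      proof (cases "norm x \<le> T")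
        case True
        then have "?q x \<le> T\<^sup>2" by (simp add: power_mono flip: power2_norm_eq_inner)
        then show ?thesis using moll_nonneg[OF T] by (intro mult_left_mono)
      qed (use moll_eq_0[OF T, of x] in auto)
      moreover have "moll s x * ?q x \<ge> 0" using moll_nonneg[OF assms(1)] by (rule mult_nonneg_nonneg) simp
      ultimately show ?thesis by (simp add: left_diff_distrib)
    qed
  qed
  also have "\<dots> = T\<^sup>2" using integral_moll[OF T, where 'n='n] by simp
  finally have le: "2 * real CARD('n) * (LBINT x. ?K x) \<le> T\<^sup>2" by simp
  have "(LBINT x. ?K x) \<ge> 0"
    by (intro Bochner_Integration.integral_nonneg kern_nonneg assms)
  moreover have "real CARD('n) \<ge> 1" by (simp add: Suc_leI)
  ultimately have "1 * (LBINT x. ?K x) \<le> 2 * real CARD('n) * (LBINT x. ?K x)"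
    by (intro mult_right_mono) linarith+
  then show ?thesis using le by linarith
qed

section \<open>Convolution\<close>

text \<open>The left argument is the smooth kernel on which derivatives fall; the right one is
  usually just integrable.\<close>

definition conv :: "('a::euclidean_space \<Rightarrow> real) \<Rightarrow> ('a \<Rightarrow> real) \<Rightarrow> 'a \<Rightarrow> real" where
  "conv \<phi> F x = (LBINT y. \<phi> (x - y) * F y)"

lemma borel_measurable_csmooth: "csmooth \<phi> \<Longrightarrow> \<phi> \<in> borel_measurable borel"
  by (simp add: borel_measurable_smooth csmooth_imp_smooth)

lemma integrable_bounded_mult:
  fixes f g :: "'a \<Rightarrow> real"
  assumes "f \<in> borel_measurable M" "\<And>x. \<bar>f x\<bar> \<le> B" "integrable M g"
  shows "integrable M (\<lambda>x. f x * g x)"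
proof (rule Bochner_Integration.integrable_bound)
  show "integrable M (\<lambda>x. B * g x)" using assms by simp
  have "B \<ge> 0" using assms(2)[of undefined] by linarith
  then show "AE x in M. norm (f x * g x) \<le> norm (B * g x)"
    using assms(2) by (auto simp: abs_mult intro!: mult_right_mono AE_I2)
qed (use assms in auto)

lemma integrable_conv:
  assumes "csmooth \<phi>" "integrable lborel F"
  shows "integrable lborel (\<lambda>y. \<phi> (x - y) * F y)"
proof -
  obtain B where "\<And>x. \<bar>\<phi> x\<bar> \<le> B" using csmooth_bounded[OF assms(1)] by auto
  moreover have [measurable]: "\<phi> \<in> borel_measurable borel" by (rule borel_measurable_csmooth[OF assms(1)])
  have "(\<lambda>y. \<phi> (x - y)) \<in> borel_measurable lborel" by measurable
  ultimately show ?thesis using assms(2) by (intro integrable_bounded_mult[of _ _ B]) auto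
qed

text \<open>The point is uniformity in the base point: the mean value theorem for the function is
  followed by globally Lipschitz first partial derivatives, whose constants come from bounded second
  ones.\<close>

lemma csmooth_taylor:
  fixes \<phi> :: "real^'n \<Rightarrow> real"
  assumes "csmooth \<phi>"
  shows "\<exists>C\<ge>0. \<forall>z h. \<bar>\<phi> (z + h) - \<phi> z - (\<Sum>i\<in>UNIV. partial i \<phi> z * h $ i)\<bar> \<le> C * (norm h)\<^sup>2"
proof -
  have mvt: "\<exists>t. \<psi> (z + h) - \<psi> z = (\<Sum>i\<in>UNIV. partial i \<psi> (z + t *\<^sub>R h) * h $ i) \<and> 0 < t \<and> t < 1"
    if "smooth \<psi>" for \<psi> :: "real^'n \<Rightarrow> real" and z h
    using MVT2[of 0 1 "\<lambda>t. \<psi> (z + t *\<^sub>R h)", OF _ smooth_directional[OF that]] by auto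
  have "\<exists>L\<ge>0. \<forall>z h. \<bar>\<psi> (z + h) - \<psi> z\<bar> \<le> L * norm h" if \<psi>: "csmooth \<psi>" for \<psi> :: "real^'n \<Rightarrow> real"
  proof -
    have "\<forall>i. \<exists>B. B > 0 \<and> (\<forall>x. \<bar>partial i \<psi> x\<bar> \<le> B)"
      using csmooth_bounded[OF csmooth_partial[OF that]] by blast
    then obtain B where B: "\<And>i. B i > 0" "\<And>i x. \<bar>partial i \<psi> x\<bar> \<le> B i" by metis
    have "\<bar>\<psi> (z + h) - \<psi> z\<bar> \<le> (\<Sum>i\<in>UNIV. B i) * norm h" for z h
    proof -
      obtain t where "\<psi> (z + h) - \<psi> z = (\<Sum>i\<in>UNIV. partial i \<psi> (z + t *\<^sub>R h) * h $ i)"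
        using mvt[OF csmooth_imp_smooth[OF \<psi>]] by blast
      then have "\<bar>\<psi> (z + h) - \<psi> z\<bar> \<le> (\<Sum>i\<in>UNIV. \<bar>partial i \<psi> (z + t *\<^sub>R h) * h $ i\<bar>)" by simp
      also have "\<dots> \<le> (\<Sum>i\<in>UNIV. B i * norm h)"
        unfolding abs_mult by (intro sum_mono mult_mono B component_le_norm_cart) (auto intro: less_imp_le[OF B(1)])
      finally show ?thesis by (simp add: sum_distrib_right)
    qed
    then show ?thesis using B(1) by (intro exI[of _ "\<Sum>i\<in>UNIV. B i"]) (auto intro!: sum_nonneg simp: less_imp_le)
  qed
  then have "\<forall>i. \<exists>L\<ge>0. \<forall>z h. \<bar>partial i \<phi> (z + h) - partial i \<phi> z\<bar> \<le> L * norm h"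
    using csmooth_partial[OF assms] by blast
  then obtain L where L: "\<And>i. L i \<ge> 0" "\<And>i z h. \<bar>partial i \<phi> (z + h) - partial i \<phi> z\<bar> \<le> L i * norm h"
    by metis
  have "\<bar>\<phi> (z + h) - \<phi> z - (\<Sum>i\<in>UNIV. partial i \<phi> z * h $ i)\<bar> \<le> (\<Sum>i\<in>UNIV. L i) * (norm h)\<^sup>2" for z h
  proof -
    obtain t where t: "\<phi> (z + h) - \<phi> z = (\<Sum>i\<in>UNIV. partial i \<phi> (z + t *\<^sub>R h) * h $ i)" "0 < t" "t < 1"
      using mvt[OF csmooth_imp_smooth[OF assms]] by blast
    have "\<bar>\<phi> (z + h) - \<phi> z - (\<Sum>i\<in>UNIV. partial i \<phi> z * h $ i)\<bar> =
        \<bar>\<Sum>i\<in>UNIV. (partial i \<phi> (z + t *\<^sub>R h) - partial i \<phi> z) * h $ i\<bar>"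
      unfolding t(1) by (simp add: sum_subtractf left_diff_distrib)
    also have "\<dots> \<le> (\<Sum>i\<in>UNIV. \<bar>partial i \<phi> (z + t *\<^sub>R h) - partial i \<phi> z\<bar> * \<bar>h $ i\<bar>)"
      unfolding abs_mult[symmetric] by (rule sum_abs)
    also have "\<dots> \<le> (\<Sum>i\<in>UNIV. (L i * norm h) * norm h)"
    proof (intro sum_mono mult_mono component_le_norm_cart)
      fix i
      have "\<bar>partial i \<phi> (z + t *\<^sub>R h) - partial i \<phi> z\<bar> \<le> L i * norm (t *\<^sub>R h)" by (rule L)
      also have "\<dots> \<le> L i * norm h"
        using t L(1) by (intro mult_left_mono) (auto simp: mult_left_le_one_le)
      finally show "\<bar>partial i \<phi> (z + t *\<^sub>R h) - partial i \<phi> z\<bar> \<le> L i * norm h" .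
    qed (use L(1) in auto)
    finally show ?thesis by (simp add: sum_distrib_right power2_eq_square mult.assoc)
  qed
  then show ?thesis using L(1) by (intro exI[of _ "\<Sum>i\<in>UNIV. L i"]) (auto intro!: sum_nonneg)
qed

text \<open>Integrating the uniform Taylor remainder against |F| leaves an error of at most a
  constant times |h|^2, so no limit has to be exchanged with the integral.\<close>

lemma conv_has_derivative:
  fixes \<phi> :: "real^'n \<Rightarrow> real"
  assumes "csmooth \<phi>" "integrable lborel F"
  shows "(conv \<phi> F has_derivative (\<lambda>h. \<Sum>i\<in>UNIV. conv (partial i \<phi>) F x * h $ i)) (at x)"
proof -
  obtain C where C: "C \<ge> 0" "\<And>z h. \<bar>\<phi> (z + h) - \<phi> z - (\<Sum>i\<in>UNIV. partial i \<phi> z * h $ i)\<bar> \<le> C * (norm h)\<^sup>2"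
    using csmooth_taylor[OF assms(1)] by metis
  note int [simp, intro] = integrable_conv[OF assms] integrable_conv[OF csmooth_partial[OF assms(1)] assms(2)]
  define K where "K = C * (LBINT y. \<bar>F y\<bar>)"
  have bound: "\<bar>conv \<phi> F (x + h) - conv \<phi> F x - (\<Sum>i\<in>UNIV. conv (partial i \<phi>) F x * h $ i)\<bar> \<le> K * (norm h)\<^sup>2" for h
  proof -
    let ?r = "\<lambda>y. \<phi> (x - y + h) - \<phi> (x - y) - (\<Sum>i\<in>UNIV. partial i \<phi> (x - y) * h $ i)"
    have e: "x - y + h = (x + h) - y" for y by simp
    have "?r y * F y = \<phi> (x + h - y) * F y - \<phi> (x - y) * F y - (\<Sum>i\<in>UNIV. (partial i \<phi> (x - y) * F y) * h $ i)" for y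
      unfolding e left_diff_distrib sum_distrib_right by (simp add: mult_ac)
    then have "(LBINT y. ?r y * F y) =
       conv \<phi> F (x + h) - conv \<phi> F x - (\<Sum>i\<in>UNIV. conv (partial i \<phi>) F x * h $ i)"
      by (simp add: conv_def)
    moreover have "\<bar>LBINT y. ?r y * F y\<bar> \<le> (LBINT y. (C * (norm h)\<^sup>2) * \<bar>F y\<bar>)"
    proof (rule order_trans[OF integral_abs_bound], rule integral_mono')
      show "integrable lborel (\<lambda>y. C * (norm h)\<^sup>2 * \<bar>F y\<bar>)" using assms(2) by simp
      show "\<bar>?r y * F y\<bar> \<le> C * (norm h)\<^sup>2 * \<bar>F y\<bar>" for y
        unfolding abs_mult by (intro mult_right_mono C) simp
    qed (use C(1) in auto)
    ultimately show ?thesis by (simp add: K_def algebra_simps)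
  qed
  show ?thesis
    unfolding has_derivative_at
  proof
    show "bounded_linear (\<lambda>h. \<Sum>i\<in>UNIV. conv (partial i \<phi>) F x * h $ i)"
      by (intro bounded_linear_sum bounded_linear_const_mult bounded_linear_vec_nth)
    have "((\<lambda>h::real^'n. K * norm h) \<longlongrightarrow> K * norm (0::real^'n)) (at 0)"
      by (intro tendsto_intros)
    then have lim: "((\<lambda>h::real^'n. K * norm h) \<longlongrightarrow> 0) (at 0)" by simp
    show "(\<lambda>h. norm (conv \<phi> F (x + h) - conv \<phi> F x - (\<Sum>i\<in>UNIV. conv (partial i \<phi>) F x * h $ i)) / norm h) \<midarrow>0\<rightarrow> 0"
    proof (rule Lim_null_comparison[OF always_eventually lim], rule allI)
      fix h :: "real^'n"
      show "norm (norm (conv \<phi> F (x + h) - conv \<phi> F x - (\<Sum>i\<in>UNIV. conv (partial i \<phi>) F x * h $ i)) / norm h) \<le> K * norm h"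
      proof (cases "h = 0")
        case False
        then show ?thesis using bound[of h] by (simp add: divide_le_eq power2_eq_square mult.assoc)
      qed simp
    qed
  qed
qed

lemma smooth_conv: "csmooth \<phi> \<Longrightarrow> integrable lborel F \<Longrightarrow> smooth (conv \<phi> F)"
  by (rule smooth_coinduct[where X="\<lambda>\<psi>. \<exists>\<phi>. csmooth \<phi> \<and> \<psi> = conv \<phi> F"])
     (auto 0 3 intro: csmooth_partial intro!: conv_has_derivative)

lemma partial_conv: "csmooth \<phi> \<Longrightarrow> integrable lborel F \<Longrightarrow> partial i (conv \<phi> F) = conv (partial i \<phi>) F"
  by (rule ext, rule partial_eqI, rule conv_has_derivative)

lemma conv_eq_0:
  assumes "\<And>x. r \<le> norm x \<Longrightarrow> \<phi> x = 0" "\<And>y. R < norm y \<Longrightarrow> F y = 0" "R + r \<le> norm x"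
  shows "conv \<phi> F x = 0"
proof -
  have "\<phi> (x - y) * F y = 0" for y
    using assms(1)[of "x - y"] assms(2)[of y] assms(3) norm_triangle_ineq2[of x y] by (cases "R < norm y") auto
  then show ?thesis unfolding conv_def by (simp only: integral_zero)
qed

lemma csmooth_conv:
  assumes "csmooth \<phi>" "integrable lborel F" "\<And>y. R < norm y \<Longrightarrow> F y = 0"
  shows "csmooth (conv \<phi> F)"
proof -
  obtain r where "\<And>x. r < norm x \<Longrightarrow> \<phi> x = 0" using assms(1) by (auto simp: csmooth_def)
  then have "conv \<phi> F x = 0" if "R + (r + 1) < norm x" for x
    using that assms(3) by (intro conv_eq_0[of "r + 1" _ R]) auto
  then show ?thesis using smooth_conv[OF assms(1,2)] by (auto simp: csmooth_def)
qed

lemma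
  fixes \<phi> F :: "'a::euclidean_space \<Rightarrow> real"
  assumes "integrable lborel \<phi>" "integrable lborel F"
  shows integrable_conv_fun: "integrable lborel (conv \<phi> F)"
    and integral_conv: "(LBINT x. conv \<phi> F x) = (LBINT x. \<phi> x) * (LBINT x. F x)"
proof -
  let ?f = "\<lambda>y x. \<phi> (x - y) * F y"
  have [measurable]: "\<phi> \<in> borel_measurable borel" "F \<in> borel_measurable borel" using assms by auto
  have e: "x - y = - y + x" for x y :: 'a by simp
  have i: "integrable lborel (\<lambda>x. \<phi> (x - y))" for y
    unfolding e by (rule integrable_translate[OF assms(1)])
  have m: "(LBINT x. norm (\<phi> (x - y) * F y)) = (LBINT x. \<bar>\<phi> x\<bar>) * \<bar>F y\<bar>" for y
    unfolding e using integral_translate[of "\<lambda>x. \<bar>\<phi> x\<bar>" "- y"] by (simp add: abs_mult)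
  have int: "integrable (lborel \<Otimes>\<^sub>M lborel) (case_prod ?f)"
  proof (rule lborel_pair.Fubini_integrable)
    show "case_prod ?f \<in> borel_measurable (lborel \<Otimes>\<^sub>M lborel)" by measurable
    show "integrable lborel (\<lambda>y. LBINT x. norm (case (y, x) of (y, x) \<Rightarrow> ?f y x))"
      using assms(2) unfolding prod.case m by simp
    show "AE y in lborel. integrable lborel (\<lambda>x. case (y, x) of (y, x) \<Rightarrow> ?f y x)"
      using i by auto
  qed
  show "integrable lborel (conv \<phi> F)"
    unfolding conv_def[abs_def] by (rule lborel_pair.integrable_snd[OF int])
  have "(LBINT x. conv \<phi> F x) = (LBINT y. LBINT x. ?f y x)"
    unfolding conv_def by (rule lborel_pair.Fubini_integral[OF int])
  also have "\<dots> = (LBINT y. (LBINT x. \<phi> x) * F y)"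
    unfolding e using integral_translate[of \<phi> "- _"] by simp
  finally show "(LBINT x. conv \<phi> F x) = (LBINT x. \<phi> x) * (LBINT x. F x)" by simp
qed

lemma conv_add: "csmooth \<phi> \<Longrightarrow> integrable lborel F \<Longrightarrow> integrable lborel G \<Longrightarrow>
    conv \<phi> (\<lambda>x. F x + G x) x = conv \<phi> F x + conv \<phi> G x"
  by (simp add: conv_def distrib_left integrable_conv)

lemma conv_diff: "csmooth \<phi> \<Longrightarrow> integrable lborel F \<Longrightarrow> integrable lborel G \<Longrightarrow>
    conv \<phi> (\<lambda>x. F x - G x) x = conv \<phi> F x - conv \<phi> G x"
  by (simp add: conv_def right_diff_distrib integrable_conv)

lemma conv_cmult: "conv \<phi> (\<lambda>x. c * F x) x = c * conv \<phi> F x"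
  by (simp add: conv_def mult.left_commute)

lemma conv_sum: "csmooth \<phi> \<Longrightarrow> (\<And>i. i \<in> A \<Longrightarrow> integrable lborel (F i)) \<Longrightarrow>
    conv \<phi> (\<lambda>x. \<Sum>i\<in>A. F i x) x = (\<Sum>i\<in>A. conv \<phi> (F i) x)"
  by (simp add: conv_def sum_distrib_left integrable_conv)

text \<open>The inequality is required only where the kernel centred at \<open>x\<close> is nonzero,
  so inequalities known just inside a ball can still be averaged at interior points.\<close>

lemma conv_mono:
  assumes "csmooth \<phi>" "\<And>x. \<phi> x \<ge> 0" "integrable lborel F" "integrable lborel G"
    "\<And>y. \<phi> (x - y) \<noteq> 0 \<Longrightarrow> F y \<le> G y"
  shows "conv \<phi> F x \<le> conv \<phi> G x"
  unfolding conv_def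
proof (rule integral_mono)
  show "\<phi> (x - y) * F y \<le> \<phi> (x - y) * G y" for y
    using assms(2)[of "x - y"] assms(5)[of y] by (cases "\<phi> (x - y) = 0") (auto intro: mult_left_mono)
qed (use assms integrable_conv[of \<phi>] in auto)

lemma conv_nonneg: "(\<And>x. \<phi> x \<ge> 0) \<Longrightarrow> (\<And>x. F x \<ge> 0) \<Longrightarrow> conv \<phi> F x \<ge> 0"
  unfolding conv_def by (intro Bochner_Integration.integral_nonneg) auto

section \<open>Square-integrable functions\<close>

text \<open>L1 and L2 together: integrability makes convolutions well defined and smooth, square
  integrability carries the estimates.\<close>

definition L12 :: "('a::euclidean_space \<Rightarrow> real) \<Rightarrow> bool" where
  "L12 F \<longleftrightarrow> integrable lborel F \<and> integrable lborel (\<lambda>x. (F x)\<^sup>2)"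

definition l2 :: "('a::euclidean_space \<Rightarrow> real) \<Rightarrow> real" where
  "l2 F = sqrt (LBINT x. (F x)\<^sup>2)"

lemma L12_integrable: "L12 F \<Longrightarrow> integrable lborel F"
  and L12_sq: "L12 F \<Longrightarrow> integrable lborel (\<lambda>x. (F x)\<^sup>2)"
  by (auto simp: L12_def)

lemma L12_measurable: "L12 F \<Longrightarrow> F \<in> borel_measurable borel"
  using L12_integrable[of F] by auto

lemma integrable_L12_mult:
  assumes "F \<in> borel_measurable M" "G \<in> borel_measurable M"
    "integrable M (\<lambda>x. (F x)\<^sup>2)" "integrable M (\<lambda>x. (G x)\<^sup>2)"
  shows "integrable M (\<lambda>x. F x * G x :: real)"
proof (rule Bochner_Integration.integrable_bound)
  show "integrable M (\<lambda>x. (F x)\<^sup>2 + (G x)\<^sup>2)" using assms by simp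
  have "\<bar>F x * G x\<bar> \<le> (F x)\<^sup>2 + (G x)\<^sup>2" for x
  proof -
    have "2 * (\<bar>F x\<bar> * \<bar>G x\<bar>) \<le> (F x)\<^sup>2 + (G x)\<^sup>2"
      using sum_squares_bound[of "\<bar>F x\<bar>" "\<bar>G x\<bar>"] by (simp add: mult.assoc)
    moreover have "0 \<le> \<bar>F x\<bar> * \<bar>G x\<bar>" by simp
    ultimately show ?thesis unfolding abs_mult by linarith
  qed
  then show "AE x in M. norm (F x * G x) \<le> norm ((F x)\<^sup>2 + (G x)\<^sup>2)" by simp
qed (use assms in measurable)

lemma L12_mult: "L12 F \<Longrightarrow> L12 G \<Longrightarrow> integrable lborel (\<lambda>x. F x * G x)"
  by (rule integrable_L12_mult) (auto dest: L12_measurable L12_sq)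

lemma L12_cmult: "L12 F \<Longrightarrow> L12 (\<lambda>x. c * F x)"
  by (simp add: L12_def power_mult_distrib)

lemma L12_add: "L12 F \<Longrightarrow> L12 G \<Longrightarrow> L12 (\<lambda>x. F x + G x)"
  using L12_mult[of F G] by (simp add: L12_def power2_sum mult.assoc)

lemma L12_diff: "L12 F \<Longrightarrow> L12 G \<Longrightarrow> L12 (\<lambda>x. F x - G x)"
  using L12_add[OF _ L12_cmult[of G "-1"], of F] by simp

lemma L12_0: "L12 (\<lambda>x. 0)"
  by (simp add: L12_def)

lemma L12_sum: "(\<And>i. i \<in> A \<Longrightarrow> L12 (F i)) \<Longrightarrow> L12 (\<lambda>x. \<Sum>i\<in>A. F i x)"
proof (induction A rule: infinite_finite_induct)
  case (insert a A)
  then show ?case using L12_add[of "F a" "\<lambda>x. \<Sum>i\<in>A. F i x"] by simp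
qed (simp_all add: L12_0)

lemma L12_bound:
  assumes "L12 G" "F \<in> borel_measurable borel" "\<And>x. \<bar>F x\<bar> \<le> \<bar>G x\<bar>"
  shows "L12 F"
  unfolding L12_def
proof
  show "integrable lborel F"
    using assms(2,3) by (intro Bochner_Integration.integrable_bound[OF L12_integrable[OF assms(1)]]) auto
  show "integrable lborel (\<lambda>x. (F x)\<^sup>2)"
    using assms(2,3) by (intro Bochner_Integration.integrable_bound[OF L12_sq[OF assms(1)]]) (auto simp: abs_le_square_iff)
qed

lemma L12_abs: "L12 F \<Longrightarrow> L12 (\<lambda>x. \<bar>F x\<bar>)"
  by (simp add: L12_def)

lemma L12_indicator: "L12 F \<Longrightarrow> A \<in> sets borel \<Longrightarrow> L12 (\<lambda>x. indicator A x * F x)"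
  by (rule L12_bound[of F]) (auto dest: L12_measurable simp: indicator_def)

lemma csmooth_L12: "csmooth \<phi> \<Longrightarrow> L12 \<phi>"
  unfolding L12_def power2_eq_square by (intro conjI csmooth_integrable csmooth_mult2 csmooth_imp_smooth)

lemma l2_nonneg: "l2 F \<ge> 0"
  by (simp add: l2_def)

lemma l2_sq: "(l2 F)\<^sup>2 = (LBINT x. (F x)\<^sup>2)"
  by (simp add: l2_def)

lemma l2_mono:
  assumes "L12 G" "\<And>x. \<bar>F x\<bar> \<le> \<bar>G x\<bar>" shows "l2 F \<le> l2 G"
  unfolding l2_def
  by (intro real_sqrt_le_mono integral_mono' L12_sq assms(1)) (simp_all only: abs_le_square_iff[symmetric] assms(2) zero_le_power2)

lemma l2_cmult: "l2 (\<lambda>x. c * F x) = \<bar>c\<bar> * l2 F"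
  by (simp add: l2_def power_mult_distrib real_sqrt_mult)

lemma l2_abs: "l2 (\<lambda>x. \<bar>F x\<bar>) = l2 F"
  by (simp add: l2_def)

lemma cauchy_schwarz_integral:
  assumes "F \<in> borel_measurable M" "G \<in> borel_measurable M"
    "integrable M (\<lambda>x. (F x)\<^sup>2)" "integrable M (\<lambda>x. (G x)\<^sup>2)"
  shows "\<bar>LINT x|M. F x * G x :: real\<bar> \<le> sqrt (LINT x|M. (F x)\<^sup>2) * sqrt (LINT x|M. (G x)\<^sup>2)"
proof -
  let ?a = "LINT x|M. (F x)\<^sup>2" and ?b = "LINT x|M. F x * G x" and ?c = "LINT x|M. (G x)\<^sup>2"
  note i = integrable_L12_mult[OF assms]
  \<comment> \<open>Discriminant argument for a nonnegative quadratic form, evaluated at s = -b, t =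
    a. If a = 0 the form with t = 1 is affine in s, so it stays nonnegative only if b = 0.\<close>
  have q: "0 \<le> ?a * s\<^sup>2 + 2 * ?b * s * t + ?c * t\<^sup>2" for s t
  proof -
    have "(LINT x|M. (s * F x + t * G x)\<^sup>2) = (LINT x|M. s\<^sup>2 * (F x)\<^sup>2 + 2 * s * t * (F x * G x) + t\<^sup>2 * (G x)\<^sup>2)"
      by (rule Bochner_Integration.integral_cong) (auto simp: power2_eq_square algebra_simps)
    also have "\<dots> = s\<^sup>2 * ?a + 2 * s * t * ?b + t\<^sup>2 * ?c"
      using assms i by simp
    finally have "s\<^sup>2 * ?a + 2 * s * t * ?b + t\<^sup>2 * ?c \<ge> 0"
      using Bochner_Integration.integral_nonneg[of M "\<lambda>x. (s * F x + t * G x)\<^sup>2"] by simp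
    then show ?thesis by (simp add: mult_ac)
  qed
  have "?b\<^sup>2 \<le> ?a * ?c"
  proof (cases "?a = 0")
    case True
    show ?thesis
    proof (rule ccontr)
      assume "\<not> ?thesis"
      then have b: "?b \<noteq> 0" using True by auto
      have "0 \<le> 2 * ?b * (- (?c + 1) / (2 * ?b)) * 1 + ?c * 1\<^sup>2"
        using q[of "- (?c + 1) / (2 * ?b)" 1] True by simp
      then show False using b by simp
    qed
  next
    case False
    moreover have "?a \<ge> 0" by (intro Bochner_Integration.integral_nonneg) simp
    ultimately have a: "?a > 0" by linarith
    have "0 \<le> ?a * (- ?b)\<^sup>2 + 2 * ?b * (- ?b) * ?a + ?c * ?a\<^sup>2" by (rule q)
    also have "\<dots> = ?a * (?a * ?c - ?b\<^sup>2)" by (simp add: power2_eq_square algebra_simps)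
    finally show ?thesis using a by (simp add: zero_le_mult_iff)
  qed
  then have "sqrt (?b\<^sup>2) \<le> sqrt (?a * ?c)" by (rule real_sqrt_le_mono)
  then show ?thesis by (simp add: real_sqrt_mult)
qed

lemma cauchy_schwarz_l2: "L12 F \<Longrightarrow> L12 G \<Longrightarrow> \<bar>LBINT x. F x * G x\<bar> \<le> l2 F * l2 G"
  unfolding l2_def by (rule cauchy_schwarz_integral) (auto dest: L12_measurable L12_sq)

lemma l2_triangle:
  assumes "L12 F" "L12 G" shows "l2 (\<lambda>x. F x + G x) \<le> l2 F + l2 G"
proof -
  have "(l2 (\<lambda>x. F x + G x))\<^sup>2 = (l2 F)\<^sup>2 + (l2 G)\<^sup>2 + 2 * (LBINT x. F x * G x)"
    using L12_mult[OF assms] L12_sq[OF assms(1)] L12_sq[OF assms(2)]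
    by (simp add: l2_sq power2_sum mult.assoc)
  also have "\<dots> \<le> (l2 F)\<^sup>2 + (l2 G)\<^sup>2 + 2 * (l2 F * l2 G)"
    using cauchy_schwarz_l2[OF assms] by linarith
  finally have "(l2 (\<lambda>x. F x + G x))\<^sup>2 \<le> (l2 F + l2 G)\<^sup>2" by (simp add: power2_sum)
  then show ?thesis using l2_nonneg by (meson add_nonneg_nonneg power2_le_imp_le)
qed

lemma l2_sum_le:
  "(\<And>i. i \<in> A \<Longrightarrow> L12 (F i)) \<Longrightarrow> l2 (\<lambda>x. \<Sum>i\<in>A. F i x) \<le> (\<Sum>i\<in>A. l2 (F i))"
proof (induction A rule: infinite_finite_induct)
  case (insert a A)
  then show ?case using l2_triangle[of "F a" "\<lambda>x. \<Sum>i\<in>A. F i x"] L12_sum[of A F] by auto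
qed (auto simp: l2_def)

lemma integral_abs_le_l2:
  assumes "L12 F" "\<And>x. R < norm x \<Longrightarrow> F x = 0"
  shows "(LBINT x. \<bar>F x\<bar>) \<le> sqrt (measure lborel (cball (0::'a::euclidean_space) R)) * l2 (F::'a \<Rightarrow> real)"
proof -
  let ?I = "indicator (cball 0 R) :: 'a \<Rightarrow> real"
  have sq: "(\<lambda>x. (?I x)\<^sup>2) = ?I" by (simp add: indicator_def fun_eq_iff)
  have I: "L12 ?I"
    unfolding L12_def sq by (intro conjI integrable_real_indicator emeasure_lborel_cball_finite) simp_all
  have "(LBINT x. \<bar>F x\<bar>) = (LBINT x. ?I x * \<bar>F x\<bar>)"
    using assms(2) by (intro Bochner_Integration.integral_cong) (auto simp: indicator_def not_le)
  also have "\<dots> \<le> l2 ?I * l2 (\<lambda>x. \<bar>F x\<bar>)"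
    using cauchy_schwarz_l2[OF I L12_abs[OF assms(1)]] by linarith
  also have "l2 ?I = sqrt (measure lborel (cball (0::'a) R))"
    unfolding l2_def sq by simp
  finally show ?thesis by (simp add: l2_abs)
qed

text \<open>The variance of \<open>F\<close> under the density \<open>\<phi> (x - \<cdot>)\<close> is nonnegative.\<close>

lemma conv_sq_le:
  assumes "csmooth \<phi>" "\<And>x. \<phi> x \<ge> 0" "(LBINT x. \<phi> x) = 1" "L12 F"
  shows "(conv \<phi> F x)\<^sup>2 \<le> conv \<phi> (\<lambda>y. (F y)\<^sup>2) x"
proof -
  let ?c = "conv \<phi> F x"
  have i: "integrable lborel (\<lambda>y. \<phi> (x - y) * F y)" "integrable lborel (\<lambda>y. \<phi> (x - y) * (F y)\<^sup>2)"
    using assms by (auto intro!: integrable_conv dest: L12_integrable L12_sq)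
  have i1: "integrable lborel (\<lambda>y. \<phi> (x - y))" "(LBINT y. \<phi> (x - y)) = 1"
    using integral_reflect_translate[OF borel_measurable_csmooth[OF assms(1)]] assms(3)
      integrable_reflect_translate[OF csmooth_integrable[OF assms(1)]] by auto
  have "0 \<le> (LBINT y. \<phi> (x - y) * (F y - ?c)\<^sup>2)"
    using assms(2) by (intro Bochner_Integration.integral_nonneg) simp
  also have "\<dots> = (LBINT y. \<phi> (x - y) * (F y)\<^sup>2 - 2 * ?c * (\<phi> (x - y) * F y) + ?c\<^sup>2 * \<phi> (x - y))"
    by (rule Bochner_Integration.integral_cong) (auto simp: power2_eq_square algebra_simps)
  also have "\<dots> = conv \<phi> (\<lambda>y. (F y)\<^sup>2) x - 2 * ?c * ?c + ?c\<^sup>2"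
    using i i1 by (simp add: conv_def)
  finally show ?thesis by (simp add: power2_eq_square)
qed

text \<open>Integrating \<open>conv_sq_le\<close> gives a contraction in L2. That the constant is
  exactly one matters for the contraction factor in \<open>barrier_step\<close>.\<close>

lemma
  assumes "csmooth \<phi>" "\<And>x. \<phi> x \<ge> 0" "(LBINT x. \<phi> x) = 1" "L12 F"
  shows L12_conv: "L12 (conv \<phi> F)" and l2_conv_le: "l2 (conv \<phi> F) \<le> l2 F"
proof -
  note i = csmooth_integrable[OF assms(1)]
  have m: "conv \<phi> F \<in> borel_measurable borel"
    using smooth_conv[OF assms(1) L12_integrable[OF assms(4)]] by (rule borel_measurable_smooth)
  have j: "integrable lborel (conv \<phi> (\<lambda>y. (F y)\<^sup>2))"
    by (rule integrable_conv_fun[OF i L12_sq[OF assms(4)]])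
  have sq: "integrable lborel (\<lambda>x. (conv \<phi> F x)\<^sup>2)"
    using conv_sq_le[OF assms] m conv_nonneg[of \<phi> "\<lambda>y. (F y)\<^sup>2"] assms(2)
    by (intro Bochner_Integration.integrable_bound[OF j]) auto
  then show "L12 (conv \<phi> F)"
    unfolding L12_def using integrable_conv_fun[OF i L12_integrable[OF assms(4)]] by simp
  have "(LBINT x. (conv \<phi> F x)\<^sup>2) \<le> (LBINT x. conv \<phi> (\<lambda>y. (F y)\<^sup>2) x)"
    by (intro integral_mono sq j conv_sq_le assms)
  also have "\<dots> = (LBINT x. (F x)\<^sup>2)"
    using integral_conv[OF i L12_sq[OF assms(4)]] assms(3) by simp
  finally show "l2 (conv \<phi> F) \<le> l2 F" unfolding l2_def by (rule real_sqrt_le_mono)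
qed

section \<open>Approximation in L2 by continuous functions and by mollifications\<close>

text \<open>Stated for the completed measure, because the continuous approximations of a measurable
  function used below converge outside a Lebesgue negligible set.\<close>

lemma tendsto_integral_sq:
  fixes F :: "nat \<Rightarrow> 'a::euclidean_space \<Rightarrow> real"
  assumes "\<And>n. F n \<in> borel_measurable lebesgue" "f \<in> borel_measurable lebesgue"
    "integrable lebesgue (\<lambda>x. (w x)\<^sup>2)" "\<And>n x. \<bar>F n x\<bar> \<le> w x" "\<And>x. \<bar>f x\<bar> \<le> w x"
    "AE x in lebesgue. (\<lambda>n. F n x) \<longlonglongrightarrow> f x"
  shows "(\<lambda>n. LINT x|lebesgue. (F n x - f x)\<^sup>2) \<longlonglongrightarrow> 0"
proof -
  have "(\<lambda>n. LINT x|lebesgue. (F n x - f x)\<^sup>2) \<longlonglongrightarrow> (LINT x|(lebesgue::'a measure). 0)"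
  proof (rule integral_dominated_convergence[where w="\<lambda>x. 4 * (w x)\<^sup>2"])
    show "integrable lebesgue (\<lambda>x. 4 * (w x)\<^sup>2)" using assms by simp
    show "AE x in lebesgue. (\<lambda>n. (F n x - f x)\<^sup>2) \<longlonglongrightarrow> 0"
      using assms(6)
    proof eventually_elim
      case (elim x)
      then have "(\<lambda>n. (F n x - f x)\<^sup>2) \<longlonglongrightarrow> (f x - f x)\<^sup>2" by (intro tendsto_intros)
      then show ?case by simp
    qed
    show "AE x in lebesgue. norm ((F n x - f x)\<^sup>2) \<le> 4 * (w x)\<^sup>2" for n
    proof (rule AE_I2)
      fix x
      have "\<bar>F n x - f x\<bar> \<le> 2 * w x" using assms(4)[of n x] assms(5)[of x] by linarith
      then have "\<bar>F n x - f x\<bar>\<^sup>2 \<le> (2 * w x)\<^sup>2" by (intro power_mono) auto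
      then show "norm ((F n x - f x)\<^sup>2) \<le> 4 * (w x)\<^sup>2" by (simp add: power_mult_distrib)
    qed
    show "(\<lambda>x. (F n x - f x)\<^sup>2) \<in> borel_measurable lebesgue" for n
      using assms(1)[of n] assms(2) by measurable
  qed simp
  then show ?thesis by simp
qed

lemma integral_lborel_lebesgue: "f \<in> borel_measurable borel \<Longrightarrow> (LBINT x. f x :: real) = (LINT x|lebesgue. f x)"
  by (simp add: integral_completion)

lemma integrable_lborel_lebesgue: "f \<in> borel_measurable borel \<Longrightarrow> integrable lborel f \<longleftrightarrow> integrable lebesgue (f :: _ \<Rightarrow> real)"
  by (simp add: integrable_completion)

text \<open>Two successive limits: \<open>F\<close> is cut off in space by \<open>cut m\<close> and
  in height by \<open>cl m\<close>, and the resulting bounded function is then approximated by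
  continuous ones. Dominated convergence gives L2 closeness in both.\<close>

lemma L2_dense_continuous:
  fixes F :: "'a::euclidean_space \<Rightarrow> real"
  assumes "L12 F" "\<epsilon> > 0"
  shows "\<exists>g R. continuous_on UNIV g \<and> (\<forall>x. R < norm x \<longrightarrow> g x = 0) \<and> L12 g \<and> l2 (\<lambda>x. F x - g x) < \<epsilon>"
proof -
  have mF: "F \<in> borel_measurable borel" "F \<in> borel_measurable lebesgue"
    using L12_measurable[OF assms(1)] by (simp_all add: measurable_completion)
  define cut where "cut m x = max 0 (min 1 (real m + 1 - norm x))" for m :: nat and x :: 'a
  define cl where "cl m t = max (- real m) (min (real m) t)" for m :: nat and t :: real
  have cut: "0 \<le> cut m x" "cut m x \<le> 1" "real m + 1 < norm x \<Longrightarrow> cut m x = 0" for m x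
    by (auto simp: cut_def)
  have cl: "\<bar>cl m t\<bar> \<le> real m" "\<bar>cl m t\<bar> \<le> \<bar>t\<bar>" for m t
    by (auto simp: cl_def)
  have ccut: "continuous_on UNIV (cut m)" for m
    unfolding cut_def[abs_def] by (intro continuous_intros)
  have ccl: "continuous_on UNIV (cl m)" for m
    unfolding cl_def[abs_def] by (intro continuous_intros)
  have mcut: "cut m \<in> borel_measurable borel" "cl m \<in> borel_measurable borel" for m
    by (intro borel_measurable_continuous_onI ccut ccl)+
  have mt: "(\<lambda>x. cut m x * cl m (F x)) \<in> borel_measurable borel" for m
    using mcut[of m] mF(1) by measurable
  have le: "\<bar>cut m x * cl m t\<bar> \<le> \<bar>t\<bar>" "\<bar>cut m x * cl m t\<bar> \<le> real m" for m x t
    unfolding abs_mult using cl[of m t] cut[of m x]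
    by (auto intro: order_trans[OF mult_left_le_one_le])
  have "(\<lambda>m. LINT x|lebesgue. (cut m x * cl m (F x) - F x)\<^sup>2) \<longlonglongrightarrow> 0"
  proof (rule tendsto_integral_sq[where w="\<lambda>x. \<bar>F x\<bar>"])
    show "integrable lebesgue (\<lambda>x. \<bar>F x\<bar>\<^sup>2)"
      using L12_sq[OF assms(1)] mF integrable_lborel_lebesgue[of "\<lambda>x. (F x)\<^sup>2"] by simp
    show "AE x in lebesgue. (\<lambda>m. cut m x * cl m (F x)) \<longlonglongrightarrow> F x"
    proof (intro AE_I2 tendsto_eventually)
      fix x
      obtain N :: nat where N: "norm x \<le> real N" "\<bar>F x\<bar> \<le> real N"
        using real_arch_simple[of "max (norm x) \<bar>F x\<bar>"] by auto
      show "\<forall>\<^sub>F m in sequentially. cut m x * cl m (F x) = F x"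
        using eventually_ge_at_top[of N]
      proof eventually_elim
        case (elim m)
        then have "real N \<le> real m" by simp
        then have "cut m x = 1" "cl m (F x) = F x" using N by (auto simp: cut_def cl_def)
        then show ?case by simp
      qed
    qed
    show "(\<lambda>x. cut n x * cl n (F x)) \<in> borel_measurable lebesgue" for n
      using mt by (simp add: measurable_completion)
  qed (use le mF in auto)
  then have "\<forall>\<^sub>F m in sequentially. (LINT x|lebesgue. (cut m x * cl m (F x) - F x)\<^sup>2) < (\<epsilon> / 2)\<^sup>2"
    using assms(2) by (intro order_tendstoD(2)) auto
  then obtain m where m: "(LINT x|lebesgue. (cut m x * cl m (F x) - F x)\<^sup>2) < (\<epsilon> / 2)\<^sup>2"
    by (auto simp: eventually_sequentially)
  have "F measurable_on UNIV"
    using measurable_on_iff_borel_measurable[of UNIV F] mF by (simp add: lebesgue_on_UNIV_eq)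
  then obtain N g where g: "negligible N" "\<And>n. continuous_on UNIV (g n)" "\<And>x. x \<notin> N \<Longrightarrow> (\<lambda>n. g n x) \<longlonglongrightarrow> F x"
    by (auto simp: measurable_on_def)
  \<comment> \<open>The approximants \<open>g n\<close> converge almost everywhere but carry no
    bound; applying the same two cutoffs to them produces the common majorant
    \<open>?w\<close>.\<close>
  define G where "G n x = cut m x * cl m (g n x)" for n :: nat and x
  have cG: "continuous_on UNIV (G n)" for n
    unfolding G_def[abs_def]
    by (intro continuous_intros ccut continuous_on_compose2[OF ccl[of m] g(2)]) auto
  have mG: "G n \<in> borel_measurable borel" for n
    by (rule borel_measurable_continuous_onI[OF cG])
  let ?w = "\<lambda>x::'a. real m * indicator (cball 0 (real m + 1)) x"
  have wle: "\<bar>cut m x * cl m t\<bar> \<le> ?w x" for x t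
    using le(2)[of m x t] cut(3)[of m x] by (auto simp: indicator_def not_le)
  have wsq: "(\<lambda>x. (?w x)\<^sup>2) = (\<lambda>x. (real m)\<^sup>2 * indicator (cball 0 (real m + 1)) x)"
    by (auto simp: indicator_def)
  have iI: "integrable lborel (indicator (cball (0::'a) (real m + 1)) :: 'a \<Rightarrow> real)"
    by (intro integrable_real_indicator emeasure_lborel_cball_finite) simp
  have w: "L12 ?w" unfolding L12_def wsq using iI by simp
  have LG: "L12 (G n)" for n
    by (rule L12_bound[OF w mG]) (use wle in \<open>force simp: G_def\<close>)
  have LT: "L12 (\<lambda>x. cut m x * cl m (F x))"
    by (rule L12_bound[OF assms(1) mt le(1)])
  have "(\<lambda>n. LINT x|lebesgue. (G n x - cut m x * cl m (F x))\<^sup>2) \<longlonglongrightarrow> 0"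
  proof (rule tendsto_integral_sq[where w="?w"])
    show "integrable lebesgue (\<lambda>x. (?w x)\<^sup>2)"
      using L12_sq[OF w] by (subst integrable_lborel_lebesgue[symmetric]) auto
    show "AE x in lebesgue. (\<lambda>n. G n x) \<longlonglongrightarrow> cut m x * cl m (F x)"
    proof -
      have "AE x in lebesgue. x \<notin> N"
        using g(1) by (simp add: AE_not_in negligible_iff_null_sets)
      then show ?thesis
      proof eventually_elim
        case (elim x)
        have "isCont (cl m) (F x)" using ccl continuous_on_eq_continuous_at by blast
        then have "(\<lambda>n. cl m (g n x)) \<longlonglongrightarrow> cl m (F x)"
          using g(3)[OF elim] by (rule isCont_tendsto_compose)
        then show ?case unfolding G_def by (rule tendsto_mult_left)
      qed
    qed
    show "G n \<in> borel_measurable lebesgue" for n using mG by (simp add: measurable_completion)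
    show "(\<lambda>x. cut m x * cl m (F x)) \<in> borel_measurable lebesgue" using mt by (simp add: measurable_completion)
  qed (auto simp: G_def wle)
  then have "\<forall>\<^sub>F n in sequentially. (LINT x|lebesgue. (G n x - cut m x * cl m (F x))\<^sup>2) < (\<epsilon> / 2)\<^sup>2"
    using assms(2) by (intro order_tendstoD(2)) auto
  then obtain n where n: "(LINT x|lebesgue. (G n x - cut m x * cl m (F x))\<^sup>2) < (\<epsilon> / 2)\<^sup>2"
    by (auto simp: eventually_sequentially)
  let ?T = "\<lambda>x. cut m x * cl m (F x)"
  have small: "l2 h < \<epsilon> / 2" if "h \<in> borel_measurable borel" "(LINT x|lebesgue. (h x)\<^sup>2) < (\<epsilon> / 2)\<^sup>2" for h :: "'a \<Rightarrow> real"
  proof -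
    have "(LBINT x. (h x)\<^sup>2) < (\<epsilon> / 2)\<^sup>2"
      using that integral_lborel_lebesgue[of "\<lambda>x. (h x)\<^sup>2"] by simp
    then have "l2 h < sqrt ((\<epsilon> / 2)\<^sup>2)" unfolding l2_def by (rule real_sqrt_less_mono)
    then show ?thesis using assms(2) by simp
  qed
  have "l2 (\<lambda>x. ?T x - F x) < \<epsilon> / 2" "l2 (\<lambda>x. G n x - ?T x) < \<epsilon> / 2"
    by (intro small m n borel_measurable_diff mt mF mG)+
  moreover have "l2 (\<lambda>x. F x - G n x) = l2 (\<lambda>x. (?T x - F x) + (G n x - ?T x))"
    unfolding l2_def by (intro arg_cong[where f=sqrt] Bochner_Integration.integral_cong) (auto simp: power2_commute)
  moreover have "\<dots> \<le> l2 (\<lambda>x. ?T x - F x) + l2 (\<lambda>x. G n x - ?T x)"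
    by (intro l2_triangle L12_diff LT LG assms)
  ultimately have "l2 (\<lambda>x. F x - G n x) < \<epsilon>" by linarith
  moreover have "G n x = 0" if "real m + 1 < norm x" for x using cut(3)[OF that] by (simp add: G_def)
  ultimately show ?thesis using cG LG by blast
qed

lemma uniformly_continuous_compact_support:
  fixes g :: "'a::euclidean_space \<Rightarrow> real"
  assumes "continuous_on UNIV g" "\<And>x. R < norm x \<Longrightarrow> g x = 0"
  shows "uniformly_continuous_on UNIV g"
  unfolding uniformly_continuous_on_def
proof (intro allI impI)
  fix e :: real assume "e > 0"
  have "uniformly_continuous_on (cball 0 (R + 1)) g"
    by (intro compact_uniformly_continuous continuous_on_subset[OF assms(1)]) auto
  then obtain d where d: "d > 0" "\<And>x y. x \<in> cball 0 (R + 1) \<Longrightarrow> y \<in> cball 0 (R + 1) \<Longrightarrow> dist y x < d \<Longrightarrow> dist (g y) (g x) < e"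
    using \<open>e > 0\<close> unfolding uniformly_continuous_on_def by metis
  have "dist (g y) (g x) < e" if "dist y x < min d 1" for x y
  proof (cases "norm x \<le> R + 1 \<and> norm y \<le> R + 1")
    case True then show ?thesis using d(2)[of x y] that by simp
  next
    case False
    have "\<bar>norm x - norm y\<bar> < 1" using that norm_triangle_ineq3[of y x] by (simp add: dist_norm abs_minus_commute)
    then have "R < norm x" "R < norm y" using False by auto
    then show ?thesis using assms(2) \<open>e > 0\<close> by simp
  qed
  then show "\<exists>d>0. \<forall>x\<in>UNIV. \<forall>x'\<in>UNIV. dist x' x < d \<longrightarrow> dist (g x') (g x) < e"
    using d(1) by (intro exI[of _ "min d 1"]) auto
qed

lemma conv_moll_const:
  fixes x :: "real^'n"
  assumes "0 < s"
  shows "(LBINT y. moll s (x - y)) = 1" "integrable lborel (\<lambda>y. moll s (x - y))"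
  using integral_reflect_translate[OF borel_measurable_csmooth[OF csmooth_moll[OF assms]], of x]
    integral_moll[OF assms, where 'n='n] integrable_reflect_translate[OF csmooth_integrable[OF csmooth_moll[OF assms]], of x]
  by auto

lemma conv_moll_close:
  fixes g :: "real^'n \<Rightarrow> real"
  assumes "0 < s" "integrable lborel g" "\<And>y. norm (x - y) < s \<Longrightarrow> \<bar>g y - g x\<bar> \<le> e"
  shows "\<bar>conv (moll s) g x - g x\<bar> \<le> e"
proof -
  note c = conv_moll_const[OF assms(1), of x]
  have i: "integrable lborel (\<lambda>y. moll s (x - y) * g y)"
    by (rule integrable_conv[OF csmooth_moll[OF assms(1)] assms(2)])
  have "conv (moll s) g x - g x = (LBINT y. moll s (x - y) * g y - moll s (x - y) * g x)"
    using i c by (simp add: conv_def)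
  also have "\<bar>\<dots>\<bar> \<le> (LBINT y. moll s (x - y) * e)"
  proof (rule order_trans[OF integral_abs_bound], rule integral_mono)
    show "integrable lborel (\<lambda>y. \<bar>moll s (x - y) * g y - moll s (x - y) * g x\<bar>)" using i c by simp
    show "integrable lborel (\<lambda>y. moll s (x - y) * e)" using c by simp
    show "\<bar>moll s (x - y) * g y - moll s (x - y) * g x\<bar> \<le> moll s (x - y) * e" for y
    proof (cases "norm (x - y) < s")
      case True
      then show ?thesis using assms(3)[of y] moll_nonneg[OF assms(1), of "x - y"]
        by (simp add: abs_mult mult_left_mono flip: right_diff_distrib)
    next
      case False
      then have "moll s (x - y) = 0" using assms(1) by (intro moll_eq_0) auto
      then show ?thesis by simp
    qed
  qed
  also have "\<dots> = e" using c by simp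
  finally show ?thesis .
qed

lemma conv_moll_uniform:
  fixes g :: "real^'n \<Rightarrow> real"
  assumes "continuous_on UNIV g" "\<And>x. R < norm x \<Longrightarrow> g x = 0" "integrable lborel g" "e > 0"
  shows "\<exists>s0>0. \<forall>s x. 0 < s \<longrightarrow> s < s0 \<longrightarrow> \<bar>conv (moll s) g x - g x\<bar> \<le> e"
proof -
  obtain d where d: "d > 0" "\<And>x y. dist y x < d \<Longrightarrow> dist (g y) (g x) < e"
    using uniformly_continuous_compact_support[OF assms(1,2)] assms(4)
    unfolding uniformly_continuous_on_def by (metis UNIV_I)
  have "\<bar>conv (moll s) g x - g x\<bar> \<le> e" if "0 < s" "s < d" for s x
  proof (rule conv_moll_close[OF that(1) assms(3)])
    fix y assume "norm (x - y) < s"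
    then have "dist y x < d" using that by (simp add: dist_norm norm_minus_commute)
    from d(2)[OF this] show "\<bar>g y - g x\<bar> \<le> e" by (simp add: dist_real_def)
  qed
  then show ?thesis using d(1) by blast
qed

text \<open>Three-epsilon argument: the L2 contraction handles \<open>F - g\<close>, and uniform
  convergence on a fixed ball handles the continuous \<open>g\<close>.\<close>

lemma conv_moll_L2:
  fixes F :: "real^'n \<Rightarrow> real"
  assumes "L12 F" "\<epsilon> > 0"
  shows "\<exists>s0>0. \<forall>s. 0 < s \<longrightarrow> s < s0 \<longrightarrow> l2 (\<lambda>x. conv (moll s) F x - F x) \<le> \<epsilon>"
proof -
  obtain g R where g: "continuous_on UNIV g" "\<And>x. R < norm x \<Longrightarrow> g x = 0" "L12 g" "l2 (\<lambda>x. F x - g x) < \<epsilon> / 3"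
    using L2_dense_continuous[OF assms(1), of "\<epsilon> / 3"] assms(2) by auto
  \<comment> \<open>Radius \<open>R + 1\<close>, since mollifying at a scale below 1 enlarges the
    support by less than 1.\<close>
  let ?I = "indicator (cball 0 (R + 1)) :: real^'n \<Rightarrow> real"
  have sq: "(\<lambda>x. (?I x)\<^sup>2) = ?I" by (simp add: indicator_def fun_eq_iff)
  have I: "L12 ?I"
    unfolding L12_def sq by (intro conjI integrable_real_indicator emeasure_lborel_cball_finite) simp_all
  define K where "K = l2 ?I + 1"
  have K: "K > 0" "l2 ?I \<le> K" using l2_nonneg[of ?I] by (auto simp: K_def add_nonneg_pos)
  define e where "e = \<epsilon> / (3 * K)"
  have e: "e > 0" using assms(2) K by (simp add: e_def)
  obtain s0 where s0: "s0 > 0" "\<And>s x. 0 < s \<Longrightarrow> s < s0 \<Longrightarrow> \<bar>conv (moll s) g x - g x\<bar> \<le> e"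
    using conv_moll_uniform[where R=R, OF g(1,2) L12_integrable[OF g(3)] e] by blast
  have "l2 (\<lambda>x. conv (moll s) F x - F x) \<le> \<epsilon>" if s: "0 < s" "s < min s0 1" for s
  proof -
    have cs: "csmooth (moll s :: real^'n \<Rightarrow> real)" by (rule csmooth_moll[OF s(1)])
    note mo = cs moll_nonneg[OF s(1)] integral_moll[OF s(1)]
    let ?A = "conv (moll s) (\<lambda>x. F x - g x)" and ?B = "\<lambda>x. conv (moll s) g x - g x" and ?C = "\<lambda>x. g x - F x"
    have L: "L12 ?A" "L12 ?B" "L12 ?C"
      by (intro L12_conv[OF mo] L12_diff assms(1) g(3))+
    have "(\<lambda>x. conv (moll s) F x - F x) = (\<lambda>x. (?A x + ?B x) + ?C x)"
      using conv_diff[OF cs L12_integrable[OF assms(1)] L12_integrable[OF g(3)]] by auto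
    then have "l2 (\<lambda>x. conv (moll s) F x - F x) \<le> l2 ?A + l2 ?B + l2 ?C"
      using l2_triangle[OF L12_add[OF L(1,2)] L(3)] l2_triangle[OF L(1,2)] by simp
    moreover have "l2 ?A \<le> l2 (\<lambda>x. F x - g x)"
      by (intro l2_conv_le[OF mo] L12_diff assms(1) g(3))
    moreover have "l2 ?C = l2 (\<lambda>x. F x - g x)" by (simp add: l2_def power2_commute)
    moreover have "l2 ?B \<le> \<epsilon> / 3"
    proof -
      have "l2 ?B \<le> l2 (\<lambda>x. e * ?I x)"
      proof (rule l2_mono)
        show "L12 (\<lambda>x. e * ?I x)" by (rule L12_cmult[OF I])
        fix x
        show "\<bar>?B x\<bar> \<le> \<bar>e * ?I x\<bar>"
        proof (cases "R + 1 < norm x")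
          case True
          then have "conv (moll s) g x = 0"
            using moll_eq_0[OF s(1)] g(2) s by (intro conv_eq_0[of s _ R]) auto
          then show ?thesis using True g(2)[of x] by simp
        next
          case False
          then show ?thesis using s0(2)[of s x] s e by (simp add: not_less)
        qed
      qed
      also have "\<dots> = e * l2 ?I" using e by (simp add: l2_cmult)
      also have "\<dots> \<le> e * K" using e K by (intro mult_left_mono) auto
      also have "\<dots> = \<epsilon> / 3" using K by (simp add: e_def)
      finally show ?thesis .
    qed
    ultimately show ?thesis using g(4) by linarith
  qed
  then show ?thesis using s0(1) by (intro exI[of _ "min s0 1"]) auto
qed

section \<open>Barriers\<close>

definition hess :: "(real^'n \<Rightarrow> real) \<Rightarrow> real^'n \<Rightarrow> real^'n^'n" where
  "hess \<phi> x = (\<chi> i j. partial i (partial j \<phi>) x)"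

abbreviation lap :: "(real^'n \<Rightarrow> real) \<Rightarrow> real^'n \<Rightarrow> real" where
  "lap \<phi> x \<equiv> trace (hess \<phi> x)"

lemma lap_eq: "lap \<phi> x = (\<Sum>i\<in>UNIV. partial i (partial i \<phi>) x)"
  by (simp add: trace_def hess_def)

lemma hess_nth: "hess \<phi> x $ i $ j = partial i (partial j \<phi>) x"
  by (simp add: hess_def)

lemma transpose_hess: "smooth \<phi> \<Longrightarrow> transpose (hess \<phi> x) = hess \<phi> x"
  by (simp add: transpose_def hess_def vec_eq_iff partial_commute[of \<phi>])

lemma hess_add: "smooth f \<Longrightarrow> smooth g \<Longrightarrow> hess (\<lambda>x. f x + g x) x = hess f x + hess g x"
  by (simp add: hess_def vec_eq_iff partial_add smooth_partial)

lemma hess_diff: "smooth f \<Longrightarrow> smooth g \<Longrightarrow> hess (\<lambda>x. f x - g x) x = hess f x - hess g x"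
  by (simp add: hess_def vec_eq_iff partial_diff smooth_partial)

lemma hess_inner_self: "hess (\<lambda>x. c - b * (x \<bullet> x)) (x::real^'n) = (- (2 * b)) *\<^sub>R mat 1"
proof -
  have "partial j (\<lambda>x. c - b * (x \<bullet> x)) = (\<lambda>x::real^'n. (- (2 * b)) * x $ j)" for j :: 'n
    by (subst partial_diff) (auto simp: partial_cmult partial_inner_self smooth_inner_self intro!: smooth_mult)
  then show ?thesis
    unfolding hess_def vec_eq_iff by (simp only: partial_cmult[OF smooth_component] partial_component) (simp add: mat_def)
qed

lemma conv_commute: "\<phi> \<in> borel_measurable borel \<Longrightarrow> F \<in> borel_measurable borel \<Longrightarrow> conv \<phi> F x = conv F \<phi> x"
  using integral_reflect_translate[of "\<lambda>y. \<phi> (x - y) * F y" x] by (simp add: conv_def mult.commute)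

lemma norm_hess_sq: "(norm (hess \<phi> x))\<^sup>2 = (\<Sum>i\<in>UNIV. \<Sum>j\<in>UNIV. (partial i (partial j \<phi>) x)\<^sup>2)"
  unfolding norm_matrix_eq hess_nth by (simp add: sum_nonneg)

lemma csmooth_lap: "csmooth z \<Longrightarrow> csmooth (lap z)"
  unfolding lap_eq by (intro csmooth_sum csmooth_partial)

lemma borel_measurable_norm_hess:
  assumes "smooth z"
  shows "(\<lambda>x. norm (hess z x)) \<in> borel_measurable borel"
proof -
  have [measurable]: "partial i (partial j z) \<in> borel_measurable borel" for i j
    by (intro borel_measurable_smooth smooth_partial assms)
  show ?thesis unfolding norm_matrix_eq hess_nth by measurable
qed

lemma
  assumes "csmooth z"
  shows L12_norm_hess: "L12 (\<lambda>x. norm (hess z x))" and l2_norm_hess: "l2 (\<lambda>x. norm (hess z x)) = l2 (lap z)"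
proof -
  have sq: "integrable lborel (\<lambda>x. (partial i (partial j z) x)\<^sup>2)" for i j
    by (intro L12_sq csmooth_L12 csmooth_partial assms)
  have pr: "integrable lborel (\<lambda>x. partial i (partial i z) x * partial j (partial j z) x)" for i j
    by (intro L12_mult csmooth_L12 csmooth_partial assms)
  have "L12 (\<lambda>x. \<Sum>i\<in>UNIV. \<Sum>j\<in>UNIV. \<bar>partial i (partial j z) x\<bar>)"
    by (intro L12_sum L12_abs csmooth_L12 csmooth_partial assms)
  moreover have "\<bar>norm (hess z x)\<bar> \<le> \<bar>\<Sum>i\<in>UNIV. \<Sum>j\<in>UNIV. \<bar>partial i (partial j z) x\<bar>\<bar>" for x
  proof -
    have "norm (hess z x) \<le> (\<Sum>i\<in>UNIV. norm (hess z x $ i))"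
      unfolding norm_vec_def[of "hess z x"] by (rule L2_set_le_sum) simp
    also have "\<dots> \<le> (\<Sum>i\<in>UNIV. \<Sum>j\<in>UNIV. \<bar>hess z x $ i $ j\<bar>)"
      by (intro sum_mono norm_le_l1_cart)
    finally show ?thesis by (simp add: hess_nth)
  qed
  ultimately show "L12 (\<lambda>x. norm (hess z x))"
    by (rule L12_bound[OF _ borel_measurable_norm_hess[OF csmooth_imp_smooth[OF assms]]])
  have "(LBINT x. (norm (hess z x))\<^sup>2) = (\<Sum>i\<in>UNIV. \<Sum>j\<in>UNIV. LBINT x. (partial i (partial j z) x)\<^sup>2)"
    unfolding norm_hess_sq using sq by (simp add: Bochner_Integration.integral_sum)
  also have "\<dots> = (\<Sum>i\<in>UNIV. \<Sum>j\<in>UNIV. LBINT x. partial i (partial i z) x * partial j (partial j z) x)"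
    by (simp add: integral_hessian_sq[OF assms])
  also have "\<dots> = (LBINT x. (\<Sum>i\<in>UNIV. \<Sum>j\<in>UNIV. partial i (partial i z) x * partial j (partial j z) x))"
    using pr by (simp add: Bochner_Integration.integral_sum)
  also have "\<dots> = (LBINT x. (lap z x)\<^sup>2)"
    unfolding lap_eq power2_eq_square sum_product ..
  finally show "l2 (\<lambda>x. norm (hess z x)) = l2 (lap z)" by (simp add: l2_def)
qed

text \<open>Minkowski's inequality for an average of matrices: pair the averaged matrix with itself,
  apply Cauchy-Schwarz under the integral, and divide by its norm. With \<kappa> \<ge> 0 it shows
  that bounds on trace plus \<kappa> times norm from above survive mollification.\<close>

lemma norm_conv_le:
  fixes A :: "real^'n \<Rightarrow> real^'m^'k"
  assumes "csmooth \<phi>" "\<And>x. \<phi> x \<ge> 0" "\<And>i j. integrable lborel (\<lambda>y. A y $ i $ j)" "integrable lborel (\<lambda>y. norm (A y))"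
  shows "norm (\<chi> i j. conv \<phi> (\<lambda>y. A y $ i $ j) x) \<le> conv \<phi> (\<lambda>y. norm (A y)) x"
proof -
  let ?B = "\<chi> i j. conv \<phi> (\<lambda>y. A y $ i $ j) x"
  have i: "integrable lborel (\<lambda>y. ?B \<bullet> A y)"
    unfolding inner_matrix_eq by (intro Bochner_Integration.integrable_sum integrable_mult_right assms)
  have "?B \<bullet> ?B = conv \<phi> (\<lambda>y. ?B \<bullet> A y) x"
  proof -
    have "?B \<bullet> ?B = (\<Sum>i\<in>UNIV. \<Sum>j\<in>UNIV. ?B $ i $ j * conv \<phi> (\<lambda>y. A y $ i $ j) x)"
      by (simp add: inner_matrix_eq)
    also have "\<dots> = (\<Sum>i\<in>UNIV. \<Sum>j\<in>UNIV. conv \<phi> (\<lambda>y. ?B $ i $ j * A y $ i $ j) x)"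
      by (simp only: conv_cmult)
    also have "\<dots> = (\<Sum>i\<in>UNIV. conv \<phi> (\<lambda>y. \<Sum>j\<in>UNIV. ?B $ i $ j * A y $ i $ j) x)"
      by (intro sum.cong refl conv_sum[symmetric] assms(1) integrable_mult_right assms(3))
    also have "\<dots> = conv \<phi> (\<lambda>y. \<Sum>i\<in>UNIV. \<Sum>j\<in>UNIV. ?B $ i $ j * A y $ i $ j) x"
      by (intro conv_sum[symmetric] Bochner_Integration.integrable_sum assms(1) integrable_mult_right assms(3))
    finally show ?thesis unfolding inner_matrix_eq .
  qed
  also have "\<dots> \<le> conv \<phi> (\<lambda>y. norm ?B * norm (A y)) x"
    by (intro conv_mono assms(1,2) i integrable_mult_right assms(4) norm_cauchy_schwarz)
  also have "\<dots> = norm ?B * conv \<phi> (\<lambda>y. norm (A y)) x" by (rule conv_cmult)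
  finally have "norm ?B * norm ?B \<le> norm ?B * conv \<phi> (\<lambda>y. norm (A y)) x"
    by (simp add: power2_eq_square flip: power2_norm_eq_inner)
  then show ?thesis
    using conv_nonneg[of \<phi> "\<lambda>y. norm (A y)" x] assms(2) by (cases "norm ?B = 0") (auto simp: mult_le_cancel_left)
qed

text \<open>The derivatives are first put on \<open>z\<close>; commuting the convolution then
  exhibits the Hessian as an average of \<open>hess z\<close> with weight \<phi>.\<close>

lemma hess_conv:
  fixes z :: "real^'n \<Rightarrow> real"
  assumes "csmooth z" "csmooth \<phi>"
  shows "hess (conv z \<phi>) x = (\<chi> i j. conv \<phi> (\<lambda>y. hess z y $ i $ j) x)"
proof -
  have "partial i (partial j (conv z \<phi>)) x = conv \<phi> (partial i (partial j z)) x" for i j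
  proof -
    have "partial i (partial j (conv z \<phi>)) x = conv (partial i (partial j z)) \<phi> x"
      using assms by (simp add: partial_conv csmooth_partial csmooth_integrable)
    also have "\<dots> = conv \<phi> (partial i (partial j z)) x"
      using assms by (intro conv_commute borel_measurable_csmooth csmooth_partial)
    finally show ?thesis .
  qed
  then show ?thesis by (simp add: hess_nth vec_eq_iff)
qed

lemma lap_conv:
  assumes "csmooth z" "csmooth \<phi>"
  shows "lap (conv z \<phi>) x = conv \<phi> (lap z) x"
proof -
  have "lap (conv z \<phi>) x = (\<Sum>i\<in>UNIV. conv \<phi> (partial i (partial i z)) x)"
    by (simp add: hess_conv[OF assms] trace_def hess_nth)
  also have "\<dots> = conv \<phi> (\<lambda>y. \<Sum>i\<in>UNIV. partial i (partial i z) y) x"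
    by (intro conv_sum[symmetric] assms csmooth_integrable csmooth_partial)
  finally show ?thesis by (simp add: lap_eq[abs_def])
qed

text \<open>The square of the L2 norm is at most supremum times integral. Here the supremum is at
  most \<open>B\<close> times the integral of \<open>F\<close>, the mass is preserved, and the
  bounded support turns the integral of \<open>F\<close> into an L2 norm.\<close>

lemma l2_conv_moll_le:
  fixes F :: "real^'n \<Rightarrow> real"
  assumes "T > 0" "\<And>x. moll T (x::real^'n) \<le> B" "L12 F" "\<And>x. F x \<ge> 0" "\<And>x. R < norm x \<Longrightarrow> F x = 0"
  shows "l2 (conv (moll T) F) \<le> sqrt (B * measure lborel (cball (0::real^'n) R)) * l2 F"
proof -
  note cs = csmooth_moll[OF assms(1), where 'a='n]
  note mo = cs moll_nonneg[OF assms(1)] integral_moll[OF assms(1), where 'n='n]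
  let ?I = "LBINT x. F x"
  have I: "?I \<ge> 0" using assms(4) by simp
  have B: "B \<ge> 0" using assms(2)[of 0] moll_nonneg[OF assms(1), of "0::real^'n"] by linarith
  have le: "conv (moll T) F x \<le> B * ?I" for x
  proof -
    have "conv (moll T) F x \<le> (LBINT y. B * F y)"
      unfolding conv_def
      using integrable_conv[OF cs L12_integrable[OF assms(3)], of x] L12_integrable[OF assms(3)] assms(2,4)
      by (intro integral_mono mult_right_mono) auto
    then show ?thesis by simp
  qed
  have "(LBINT x. (conv (moll T) F x)\<^sup>2) \<le> (LBINT x. (B * ?I) * conv (moll T) F x)"
  proof (rule integral_mono)
    show "integrable lborel (\<lambda>x. (conv (moll T) F x)\<^sup>2)" by (intro L12_sq L12_conv[OF mo assms(3)])
    show "integrable lborel (\<lambda>x. (B * ?I) * conv (moll T) F x)"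
      by (intro integrable_mult_right L12_integrable L12_conv[OF mo assms(3)])
    show "(conv (moll T) F x)\<^sup>2 \<le> (B * ?I) * conv (moll T) F x" for x
      unfolding power2_eq_square
      by (intro mult_right_mono le conv_nonneg moll_nonneg assms)
  qed
  also have "\<dots> = B * ?I * ?I"
    using integral_conv[OF csmooth_integrable[OF cs] L12_integrable[OF assms(3)]] mo(3) by simp
  also have "\<dots> = B * ?I\<^sup>2" by (simp add: power2_eq_square)
  finally have "l2 (conv (moll T) F) \<le> sqrt (B * ?I\<^sup>2)"
    unfolding l2_def by (rule real_sqrt_le_mono)
  also have "\<dots> = sqrt B * ?I" using I by (simp add: real_sqrt_mult)
  also have "?I = (LBINT x. \<bar>F x\<bar>)" using assms(4) by simp
  also have "sqrt B * \<dots> \<le> sqrt B * (sqrt (measure lborel (cball (0::real^'n) R)) * l2 F)"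
    using B by (intro mult_left_mono integral_abs_le_l2 assms) auto
  finally show ?thesis by (simp add: real_sqrt_mult mult.assoc)
qed

lemma moll_small:
  assumes "e > 0" shows "\<exists>T>0. \<forall>x::real^'n. moll T x \<le> e"
proof -
  obtain M where M: "M > 0" "\<And>s x. s > 0 \<Longrightarrow> moll s (x::real^'n) \<le> M * inverse s ^ CARD('n)"
    using moll_bounded by metis
  define T where "T = max 1 (M / e)"
  have T: "T \<ge> 1" "T > 0" by (auto simp: T_def)
  have "inverse T ^ CARD('n) \<le> inverse T ^ 1"
    using T by (intro power_decreasing) (auto simp: inverse_le_1_iff Suc_leI)
  moreover have "M * inverse T \<le> e"
  proof -
    have "M / e \<le> T" by (simp add: T_def)
    then show ?thesis using assms T by (simp add: field_simps)
  qed
  ultimately have "M * inverse T ^ CARD('n) \<le> e"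
    using M(1) by (auto intro: order_trans[OF mult_left_mono])
  then show ?thesis using M(2) T by (meson order_trans)
qed

section \<open>The Neumann series of truncated Newton potentials\<close>

definition supp_pos :: "real \<Rightarrow> (real^'n \<Rightarrow> real) \<Rightarrow> bool" where
  "supp_pos R F \<longleftrightarrow> L12 F \<and> (\<forall>x. F x \<ge> 0) \<and> (\<forall>x. R < norm x \<longrightarrow> F x = 0)"

text \<open>\<open>F'\<close> is the residual that \<open>w\<close> leaves behind. The scale
  \<open>s\<close> is the same for all terms, so such inequalities can be added, and
  \<open>x\<close> keeps distance \<open>s\<close> from the sphere because residuals are recorded
  only inside the ball.\<close>

definition barrier_with :: "real \<Rightarrow> real \<Rightarrow> real \<Rightarrow> (real^'n \<Rightarrow> real) \<Rightarrow> (real^'n \<Rightarrow> real) \<Rightarrow> (real^'n \<Rightarrow> real) \<Rightarrow> bool" where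
  "barrier_with \<kappa> R s F F' w \<longleftrightarrow> csmooth w \<and> (\<forall>x. w x \<ge> 0) \<and> supp_pos R F' \<and>
     (\<forall>x. norm x + s \<le> R \<longrightarrow> lap w x + \<kappa> * norm (hess w x) \<le> - conv (moll s) F x + conv (moll s) F' x)"

text \<open>With \<open>z = kern * F\<close> one has \<open>-\<Delta>z \<approx> F\<close> and \<open>\<parallel>D\<^sup>2z\<parallel> \<le> (1+\<eta>) \<parallel>F\<parallel>\<close>, so that the
  term \<open>\<kappa> |D\<^sup>2z|\<close> leaves a residual that is smaller than \<open>F\<close> by a fixed factor.\<close>

lemma barrier_step:
  assumes "0 \<le> \<kappa>" "\<kappa> < 1" "R > 0"
  shows "\<exists>C\<ge>0. \<forall>(F :: real^'n \<Rightarrow> real) s. supp_pos R F \<longrightarrow> s > 0 \<longrightarrow>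
    (\<exists>F' w. barrier_with \<kappa> R s F F' w \<and> l2 F' \<le> (1 + \<kappa>) / 2 * l2 F \<and> (LBINT x. w x) \<le> C * l2 F)"
proof -
  define V where "V = measure lborel (cball (0::real^'n) R)"
  have V: "V \<ge> 0" by (simp add: V_def)
  \<comment> \<open>Each of the three errors is at most \<eta>, and 2 \<eta> + \<kappa> (1 + \<eta>)
    \<le> \<kappa> + 3 \<eta> \<le> (1 + \<kappa>) / 2.\<close>
  define \<eta> where "\<eta> = (1 - \<kappa>) / 8"
  have \<eta>: "\<eta> > 0" using assms by (simp add: \<eta>_def)
  have "\<eta>\<^sup>2 / (V + 1) > 0" using \<eta> V by (simp add: add_nonneg_pos)
  \<comment> \<open>The outer scale depends only on \<kappa>, \<open>R\<close> and the dimension.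
    This makes the constant \<open>C\<close> uniform in \<open>F\<close> and \<open>s\<close>; the
    summand 1 avoids a division by zero.\<close>
  from moll_small[OF this] obtain T where T: "T > 0" "\<And>x::real^'n. moll T x \<le> \<eta>\<^sup>2 / (V + 1)" by blast
  have tail: "l2 (conv (moll T) F) \<le> \<eta> * l2 F" if "supp_pos R F" for F :: "real^'n \<Rightarrow> real"
  proof -
    have "l2 (conv (moll T) F) \<le> sqrt (\<eta>\<^sup>2 / (V + 1) * V) * l2 F"
      using l2_conv_moll_le[OF T(1) T(2), of F R] that by (simp add: supp_pos_def V_def)
    also have "\<dots> \<le> sqrt (\<eta>\<^sup>2) * l2 F"
    proof (intro mult_right_mono real_sqrt_le_mono l2_nonneg)
      have "\<eta>\<^sup>2 * V \<le> \<eta>\<^sup>2 * (V + 1)" by (intro mult_left_mono) auto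
      then show "\<eta>\<^sup>2 / (V + 1) * V \<le> \<eta>\<^sup>2" using V by (simp add: divide_le_eq add_nonneg_pos)
    qed
    finally show ?thesis using \<eta> by simp
  qed
  show ?thesis
  proof (intro exI[of _ "T\<^sup>2 * sqrt V"] conjI allI impI)
    show "0 \<le> T\<^sup>2 * sqrt V" using V by simp
    fix F :: "real^'n \<Rightarrow> real" and s :: real
    assume F: "supp_pos R F" and s: "s > 0"
    note LF = F[unfolded supp_pos_def, THEN conjunct1]
    have F0: "F x \<ge> 0" "R < norm x \<Longrightarrow> F x = 0" for x using F by (auto simp: supp_pos_def)
    note iF = L12_integrable[OF LF]
    \<comment> \<open>The inner scale may depend on \<open>F\<close>, since
      \<open>integral_kern_le\<close> bounds the mass of the kernel without reference to it. If
      \<open>l2 F = 0\<close> the tolerance is zero and \<open>conv_moll_L2\<close> does not apply,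
      but then any scale works.\<close>
    have "\<exists>s'. 0 < s' \<and> s' \<le> T \<and> l2 (\<lambda>x. conv (moll s') F x - F x) \<le> \<eta> * l2 F"
    proof (cases "l2 F = 0")
      case True
      note mo = csmooth_moll[OF T(1), where 'a='n] moll_nonneg[OF T(1)] integral_moll[OF T(1)]
      have "l2 (\<lambda>x. conv (moll T) F x + (-1) * F x) \<le> l2 (conv (moll T) F) + l2 (\<lambda>x. (-1) * F x)"
        by (intro l2_triangle L12_conv[OF mo] L12_cmult LF)
      also have "\<dots> \<le> 0" using l2_conv_le[OF mo LF] l2_cmult[of "-1" F] True by simp
      finally show ?thesis using T(1) True by (intro exI[of _ T]) auto
    next
      case False
      then have "\<eta> * l2 F > 0" using \<eta> l2_nonneg[of F] by simp
      from conv_moll_L2[OF LF this] obtain s0 where "s0 > 0"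
        "\<And>s. 0 < s \<Longrightarrow> s < s0 \<Longrightarrow> l2 (\<lambda>x. conv (moll s) F x - F x) \<le> \<eta> * l2 F" by blast
      then show ?thesis using T(1) by (intro exI[of _ "min T (s0 / 2)"]) auto
    qed
    then obtain s' where s': "0 < s'" "s' \<le> T" "l2 (\<lambda>x. conv (moll s') F x - F x) \<le> \<eta> * l2 F" by blast
    note cT = csmooth_moll[OF T(1), where 'a='n] and cs' = csmooth_moll[OF s'(1), where 'a='n] and cs = csmooth_moll[OF s, where 'a='n]
    note moT = cT moll_nonneg[OF T(1)] integral_moll[OF T(1)]
    note mos' = cs' moll_nonneg[OF s'(1)] integral_moll[OF s'(1)]
    have cK: "csmooth (kern s' T :: real^'n \<Rightarrow> real)" by (rule csmooth_kern[OF s'(1) T(1)])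
    define z where "z = conv (kern s' T) F"
    have cz: "csmooth z" unfolding z_def by (rule csmooth_conv[where R=R, OF cK iF F0(2)])
    have z0: "z x \<ge> 0" for x unfolding z_def by (intro conv_nonneg kern_nonneg s' F0)
    have lapz: "lap z x = conv (moll T) F x - conv (moll s') F x" for x
    proof -
      have "lap z x = (\<Sum>i\<in>UNIV. conv (partial i (partial i (kern s' T))) F x)"
        unfolding lap_eq z_def using cK iF by (simp add: partial_conv csmooth_partial)
      also have "\<dots> = (LBINT y. (\<Sum>i\<in>UNIV. partial i (partial i (kern s' T)) (x - y) * F y))"
        unfolding conv_def
        by (intro Bochner_Integration.integral_sum[symmetric] integrable_conv csmooth_partial cK iF)
      also have "\<dots> = (LBINT y. moll T (x - y) * F y - moll s' (x - y) * F y)"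
        by (simp add: laplace_kern[OF s'(1,2)] left_diff_distrib flip: sum_distrib_right)
      also have "\<dots> = conv (moll T) F x - conv (moll s') F x"
        unfolding conv_def using integrable_conv[OF cT iF] integrable_conv[OF cs' iF] by simp
      finally show ?thesis .
    qed
    \<comment> \<open>Everything by which \<open>lap z + \<kappa> |hess z|\<close> can exceed
      \<open>- F\<close>: the mollification error, the far part of the Laplacian and the Hessian
      term. Its restriction \<open>F'\<close> to the ball has the support needed for the next
      step.\<close>
    define F1 where "F1 y = \<bar>conv (moll s') F y - F y\<bar> + conv (moll T) F y + \<kappa> * norm (hess z y)" for y
    define F' where "F' y = indicator (cball 0 R) y * F1 y" for y
    have L: "L12 (\<lambda>y. \<bar>conv (moll s') F y - F y\<bar>)" "L12 (conv (moll T) F)" "L12 (\<lambda>y. norm (hess z y))"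
      by (intro L12_abs L12_diff L12_conv[OF mos'] L12_conv[OF moT] LF L12_norm_hess cz)+
    have LF1: "L12 F1" unfolding F1_def[abs_def] by (intro L12_add L12_cmult L)
    have F1_0: "F1 y \<ge> 0" for y
      unfolding F1_def using assms(1) by (intro add_nonneg_nonneg mult_nonneg_nonneg conv_nonneg moll_nonneg T F0) auto
    have SF': "supp_pos R F'"
      unfolding supp_pos_def F'_def[abs_def] using F1_0
      by (auto intro!: L12_indicator LF1)
    have "l2 F' \<le> l2 F1"
      by (rule l2_mono[OF LF1]) (auto simp: F'_def indicator_def F1_0)
    also have "\<dots> \<le> l2 (\<lambda>y. \<bar>conv (moll s') F y - F y\<bar>) + l2 (conv (moll T) F) + l2 (\<lambda>y. \<kappa> * norm (hess z y))"
      unfolding F1_def[abs_def]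
      using l2_triangle[OF L12_add[OF L(1,2)] L12_cmult[OF L(3)]] l2_triangle[OF L(1,2)] by (rule order_trans[OF _ add_right_mono])
    also have "\<dots> \<le> \<eta> * l2 F + \<eta> * l2 F + \<kappa> * (l2 F + \<eta> * l2 F)"
    proof (intro add_mono)
      show "l2 (\<lambda>y. \<bar>conv (moll s') F y - F y\<bar>) \<le> \<eta> * l2 F" unfolding l2_abs by (rule s'(3))
      show "l2 (conv (moll T) F) \<le> \<eta> * l2 F" by (rule tail[OF F])
      have "l2 (\<lambda>x. conv (moll T) F x + (-1) * conv (moll s') F x) \<le> l2 (conv (moll T) F) + l2 (\<lambda>x. (-1) * conv (moll s') F x)"
        by (intro l2_triangle L12_cmult L12_conv[OF mos'] L12_conv[OF moT] LF)
      also have "\<dots> \<le> \<eta> * l2 F + l2 F"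
        using tail[OF F] l2_conv_le[OF mos' LF] l2_cmult[of "-1" "conv (moll s') F"] by simp
      finally have "l2 (lap z) \<le> l2 F + \<eta> * l2 F" by (simp add: lapz[abs_def])
      then show "l2 (\<lambda>y. \<kappa> * norm (hess z y)) \<le> \<kappa> * (l2 F + \<eta> * l2 F)"
        unfolding l2_cmult l2_norm_hess[OF cz] using assms(1) by (simp add: mult_left_mono)
    qed
    also have "\<dots> = (2 * \<eta> + \<kappa> * (1 + \<eta>)) * l2 F" by (simp add: algebra_simps)
    also have "\<dots> \<le> (1 + \<kappa>) / 2 * l2 F"
    proof (intro mult_right_mono l2_nonneg)
      have "\<kappa> * \<eta> \<le> 1 * \<eta>" using assms \<eta> by (intro mult_right_mono) auto
      moreover have "2 * \<eta> + (\<kappa> + p) \<le> (1 + \<kappa>) / 2" if "p \<le> \<eta>" for p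
        using that assms(2) unfolding \<eta>_def by (simp add: field_simps)
      ultimately show "2 * \<eta> + \<kappa> * (1 + \<eta>) \<le> (1 + \<kappa>) / 2"
        unfolding distrib_left mult_1_right mult_1_left by blast
    qed
    finally have l2F': "l2 F' \<le> (1 + \<kappa>) / 2 * l2 F" .
    \<comment> \<open>Residuals are controlled only in L2. Averaging at the common scale
      \<open>s\<close> will turn a residual that is small in L2 into one that is uniformly
      small.\<close>
    define w where "w = conv z (moll s)"
    have cw: "csmooth w"
      unfolding w_def
    proof (rule csmooth_conv[where R=s, OF cz csmooth_integrable[OF cs]])
      show "moll s y = 0" if "s < norm y" for y :: "real^'n" using that s by (intro moll_eq_0) auto
    qed
    have w0: "w x \<ge> 0" for x unfolding w_def by (intro conv_nonneg z0 moll_nonneg s)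
    have "(LBINT x. w x) = (LBINT x. z x)"
      unfolding w_def using integral_conv[OF csmooth_integrable[OF cz] csmooth_integrable[OF cs]] integral_moll[OF s, where 'n='n] by simp
    also have "\<dots> = (LBINT x. kern s' T (x::real^'n)) * (LBINT x. F x)"
      unfolding z_def by (rule integral_conv[OF csmooth_integrable[OF cK] iF])
    also have "\<dots> \<le> T\<^sup>2 * (sqrt V * l2 F)"
    proof (rule mult_mono)
      show "(LBINT x. kern s' T (x::real^'n)) \<le> T\<^sup>2" by (rule integral_kern_le[OF s'(1,2)])
      have "(LBINT x. F x) = (LBINT x. \<bar>F x\<bar>)" using F0(1) by simp
      also have "\<dots> \<le> sqrt V * l2 F" unfolding V_def by (intro integral_abs_le_l2 LF F0(2))
      finally show "(LBINT x. F x) \<le> sqrt V * l2 F" .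
    qed (use F0(1) in auto)
    finally have intw: "(LBINT x. w x) \<le> T\<^sup>2 * sqrt V * l2 F" by (simp add: mult.assoc)
    have ineq: "lap w x + \<kappa> * norm (hess w x) \<le> - conv (moll s) F x + conv (moll s) F' x" if x: "norm x + s \<le> R" for x
    proof -
      have ih: "integrable lborel (\<lambda>y. hess z y $ i $ j)" for i j
        unfolding hess_nth by (intro csmooth_integrable csmooth_partial cz)
      have il: "integrable lborel (lap z)" by (intro csmooth_integrable csmooth_lap cz)
      have "norm (hess w x) \<le> conv (moll s) (\<lambda>y. norm (hess z y)) x"
        unfolding w_def hess_conv[OF cz cs]
        by (intro norm_conv_le cs moll_nonneg s ih L12_integrable L)
      then have "lap w x + \<kappa> * norm (hess w x) \<le> conv (moll s) (lap z) x + \<kappa> * conv (moll s) (\<lambda>y. norm (hess z y)) x"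
        unfolding w_def lap_conv[OF cz cs] using assms(1) by (simp add: mult_left_mono)
      also have "\<dots> = conv (moll s) (\<lambda>y. lap z y + \<kappa> * norm (hess z y)) x"
        unfolding conv_cmult[symmetric]
        by (intro conv_add[symmetric] cs il L12_integrable L12_cmult L)
      also have "\<dots> \<le> conv (moll s) (\<lambda>y. F' y - F y) x"
      proof (rule conv_mono[OF cs moll_nonneg[OF s]])
        show "integrable lborel (\<lambda>y. lap z y + \<kappa> * norm (hess z y))"
          using il L12_integrable[OF L(3)] by simp
        show "integrable lborel (\<lambda>y. F' y - F y)"
          using SF' iF by (auto simp: supp_pos_def dest: L12_integrable)
        fix y assume "moll s (x - y) \<noteq> 0"
        then have "norm (x - y) < s" using moll_eq_0[OF s, of "x - y"] by (cases "s \<le> norm (x - y)") auto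
        then have "y \<in> cball 0 R" using x norm_triangle_sub[of y x] by (simp add: norm_minus_commute)
        then show "lap z y + \<kappa> * norm (hess z y) \<le> F' y - F y"
          using abs_ge_minus_self[of "conv (moll s') F y - F y"]
          unfolding F'_def F1_def lapz by (simp del: abs_ge_minus_self)
      qed
      also have "\<dots> = conv (moll s) F' x - conv (moll s) F x"
        using SF' by (intro conv_diff cs iF) (auto simp: supp_pos_def dest: L12_integrable)
      finally show ?thesis by simp
    qed
    have "barrier_with \<kappa> R s F F' w"
      unfolding barrier_with_def using cw w0 SF' ineq by blast
    then show "\<exists>F' w. barrier_with \<kappa> R s F F' w \<and> l2 F' \<le> (1 + \<kappa>) / 2 * l2 F \<and> (LBINT x. w x) \<le> T\<^sup>2 * sqrt V * l2 F"
      using l2F' intw by blast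
  qed
qed

text \<open>The intermediate residual cancels, because trace is linear and the norm
  subadditive.\<close>

lemma barrier_with_trans:
  assumes "barrier_with \<kappa> R s F F' w" "barrier_with \<kappa> R s F' F'' w'" "0 \<le> \<kappa>"
  shows "barrier_with \<kappa> R s F F'' (\<lambda>x. w x + w' x)"
  unfolding barrier_with_def
proof (intro conjI allI impI)
  show "csmooth (\<lambda>x. w x + w' x)" using assms by (simp add: barrier_with_def csmooth_add)
  show "0 \<le> w x + w' x" for x using assms by (simp add: barrier_with_def)
  show "supp_pos R F''" using assms by (simp add: barrier_with_def)
  fix x :: "real^'a" assume x: "norm x + s \<le> R"
  have sm: "smooth w" "smooth w'" using assms by (auto simp: barrier_with_def csmooth_imp_smooth)
  have "\<kappa> * norm (hess w x + hess w' x) \<le> \<kappa> * (norm (hess w x) + norm (hess w' x))"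
    using assms(3) by (intro mult_left_mono norm_triangle_ineq)
  moreover have "lap w x + \<kappa> * norm (hess w x) \<le> - conv (moll s) F x + conv (moll s) F' x"
    "lap w' x + \<kappa> * norm (hess w' x) \<le> - conv (moll s) F' x + conv (moll s) F'' x"
    using assms(1,2) x unfolding barrier_with_def by blast+
  ultimately show "lap (\<lambda>x. w x + w' x) x + \<kappa> * norm (hess (\<lambda>x. w x + w' x) x) \<le> - conv (moll s) F x + conv (moll s) F'' x"
    unfolding hess_add[OF sm] trace_add distrib_left by linarith
qed

text \<open>Partial sums of the Neumann series: the residual of one step becomes the right-hand side
  of the next.\<close>

lemma barrier_iterate:
  assumes "0 \<le> \<kappa>" "\<kappa> < 1" "R > 0"
  shows "\<exists>C\<ge>0. \<forall>(F :: real^'n \<Rightarrow> real) s m. supp_pos R F \<longrightarrow> s > 0 \<longrightarrow>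
    (\<exists>F' w. barrier_with \<kappa> R s F F' w \<and> l2 F' \<le> ((1 + \<kappa>) / 2) ^ m * l2 F \<and>
      (LBINT x. w x) \<le> C * (\<Sum>k<m. ((1 + \<kappa>) / 2) ^ k) * l2 F)"
proof -
  let ?q = "(1 + \<kappa>) / 2"
  obtain C where C: "C \<ge> 0" and step: "\<And>(F :: real^'n \<Rightarrow> real) s. supp_pos R F \<Longrightarrow> s > 0 \<Longrightarrow>
    \<exists>F' w. barrier_with \<kappa> R s F F' w \<and> l2 F' \<le> ?q * l2 F \<and> (LBINT x. w x) \<le> C * l2 F"
    using barrier_step[OF assms] by metis
  have "\<exists>F' w. barrier_with \<kappa> R s F F' w \<and> l2 F' \<le> ?q ^ m * l2 F \<and> (LBINT x. w x) \<le> C * (\<Sum>k<m. ?q ^ k) * l2 F"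
    if F: "supp_pos R F" "s > 0" for F :: "real^'n \<Rightarrow> real" and s m
  proof (induction m)
    case 0
    have "hess (\<lambda>x. 0) x = (0 :: real^'n^'n)" for x by (simp add: hess_def vec_eq_iff)
    moreover have "trace (0 :: real^'n^'n) = 0" by (simp add: trace_def)
    ultimately have "barrier_with \<kappa> R s F F (\<lambda>x. 0)" using F(1) by (simp add: barrier_with_def)
    then show ?case by (intro exI[of _ F] exI[of _ "\<lambda>x. 0"]) simp
  next
    case (Suc m)
    then obtain F' w where w: "barrier_with \<kappa> R s F F' w" "l2 F' \<le> ?q ^ m * l2 F"
      "(LBINT x. w x) \<le> C * (\<Sum>k<m. ?q ^ k) * l2 F" by blast
    then have F': "supp_pos R F'" by (simp add: barrier_with_def)
    obtain F'' w' where w': "barrier_with \<kappa> R s F' F'' w'" "l2 F'' \<le> ?q * l2 F'"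
      "(LBINT x. w' x) \<le> C * l2 F'" using step[OF F' F(2)] by blast
    have "l2 F'' \<le> ?q * (?q ^ m * l2 F)"
      using w'(2) w(2) assms by (elim order_trans) (intro mult_left_mono, auto)
    then have 1: "l2 F'' \<le> ?q ^ Suc m * l2 F" by (simp only: power_Suc mult.assoc)
    have "csmooth w" "csmooth w'" using w(1) w'(1) by (auto simp: barrier_with_def)
    then have "(LBINT x. w x + w' x) = (LBINT x. w x) + (LBINT x. w' x)"
      by (intro Bochner_Integration.integral_add csmooth_integrable)
    also have "\<dots> \<le> C * (\<Sum>k<m. ?q ^ k) * l2 F + C * (?q ^ m * l2 F)"
      using w'(3) mult_left_mono[OF w(2) C] w(3) by linarith
    also have "\<dots> = C * (\<Sum>k<Suc m. ?q ^ k) * l2 F"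
      unfolding sum.lessThan_Suc distrib_left distrib_right mult.assoc ..
    finally show ?case
      using 1 barrier_with_trans[OF w(1) w'(1) assms(1)]
      by (intro exI[of _ F''] exI[of _ "\<lambda>x. w x + w' x"] conjI)
  qed
  then show ?thesis using C by blast
qed

text \<open>The series is stopped once the averaged residual lies below \<sigma> everywhere. The
  number of terms depends on \<open>s\<close>, \<sigma> and \<open>F\<close>, but the bound on the
  integral does not depend on it, since the geometric sums are bounded.\<close>

lemma barrier:
  assumes "0 \<le> \<kappa>" "\<kappa> < 1" "R > 0"
  shows "\<exists>C\<ge>0. \<forall>(F :: real^'n \<Rightarrow> real) s \<sigma>. supp_pos R F \<longrightarrow> s > 0 \<longrightarrow> \<sigma> > 0 \<longrightarrow>
    (\<exists>w. csmooth w \<and> (\<forall>x. w x \<ge> 0) \<and> (LBINT x. w x) \<le> C * l2 F \<and>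
     (\<forall>x. norm x + s \<le> R \<longrightarrow> lap w x + \<kappa> * norm (hess w x) \<le> - conv (moll s) F x + \<sigma>))"
proof -
  let ?q = "(1 + \<kappa>) / 2"
  have q: "0 \<le> ?q" "?q < 1" using assms by auto
  obtain C where C: "C \<ge> 0" and iter: "\<And>(F :: real^'n \<Rightarrow> real) s m. supp_pos R F \<Longrightarrow> s > 0 \<Longrightarrow>
    \<exists>F' w. barrier_with \<kappa> R s F F' w \<and> l2 F' \<le> ?q ^ m * l2 F \<and> (LBINT x. w x) \<le> C * (\<Sum>k<m. ?q ^ k) * l2 F"
    using barrier_iterate[OF assms] by metis
  have geo: "(\<Sum>k<m. ?q ^ k) \<le> 1 / (1 - ?q)" for m
    unfolding suminf_geometric[of ?q, unfolded real_norm_def abs_of_nonneg[OF q(1)], OF q(2), symmetric]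
    using q by (intro sum_le_suminf summable_geometric) auto
  show ?thesis
  proof (intro exI[of _ "C * (1 / (1 - ?q))"] conjI allI impI)
    show "0 \<le> C * (1 / (1 - ?q))" using C q by (intro mult_nonneg_nonneg divide_nonneg_nonneg) auto
    fix F :: "real^'n \<Rightarrow> real" and s \<sigma> :: real
    assume F: "supp_pos R F" "s > 0" "\<sigma> > 0"
    note cs = csmooth_moll[OF F(2), where 'a='n]
    obtain B where B: "B > 0" "\<And>x::real^'n. \<bar>moll s x\<bar> \<le> B" using csmooth_bounded[OF cs] by auto
    define V where "V = sqrt (measure lborel (cball (0::real^'n) R))"
    have V: "V \<ge> 0" by (simp add: V_def)
    have "(\<lambda>m. ?q ^ m * (B * V * l2 F)) \<longlonglongrightarrow> 0 * (B * V * l2 F)"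
      by (intro tendsto_mult LIMSEQ_power_zero tendsto_const) (use q in auto)
    then have "\<forall>\<^sub>F m in sequentially. ?q ^ m * (B * V * l2 F) < \<sigma>"
      using F(3) by (intro order_tendstoD(2)) auto
    then obtain m where m: "?q ^ m * (B * V * l2 F) < \<sigma>" by (auto simp: eventually_sequentially)
    obtain F' w where w: "barrier_with \<kappa> R s F F' w" "l2 F' \<le> ?q ^ m * l2 F"
      "(LBINT x. w x) \<le> C * (\<Sum>k<m. ?q ^ k) * l2 F" using iter[OF F(1,2)] by blast
    have LF': "L12 F'" "\<And>x. F' x \<ge> 0" "\<And>x. R < norm x \<Longrightarrow> F' x = 0"
      using w(1) by (auto simp: barrier_with_def supp_pos_def)
    have small: "conv (moll s) F' x \<le> \<sigma>" for x
    proof -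
      have "conv (moll s) F' x \<le> (LBINT y. B * \<bar>F' y\<bar>)"
        unfolding conv_def
      proof (rule integral_mono)
        show "integrable lborel (\<lambda>y. moll s (x - y) * F' y)" by (intro integrable_conv cs L12_integrable LF')
        show "integrable lborel (\<lambda>y. B * \<bar>F' y\<bar>)" by (intro integrable_mult_right L12_integrable L12_abs LF')
        have "moll s (x - y) \<le> B" for y using B(2)[of "x - y"] by linarith
        then show "moll s (x - y) * F' y \<le> B * \<bar>F' y\<bar>" for y
          using LF'(2)[of y] by (simp add: mult_right_mono)
      qed
      also have "\<dots> = B * (LBINT y. \<bar>F' y\<bar>)" by simp
      also have "\<dots> \<le> B * (V * l2 F')"
        unfolding V_def using B(1) by (intro mult_left_mono integral_abs_le_l2 LF') auto
      also have "\<dots> \<le> B * (V * (?q ^ m * l2 F))"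
        using B(1) V by (intro mult_left_mono w) auto
      also have "\<dots> = ?q ^ m * (B * V * l2 F)" by (simp only: mult_ac)
      finally show ?thesis using m by linarith
    qed
    have "C * (\<Sum>k<m. ?q ^ k) * l2 F \<le> C * (1 / (1 - ?q)) * l2 F"
      by (intro mult_right_mono mult_left_mono geo l2_nonneg C)
    with w(3) have "(LBINT x. w x) \<le> C * (1 / (1 - ?q)) * l2 F" by (rule order_trans)
    moreover have "lap w x + \<kappa> * norm (hess w x) \<le> - conv (moll s) F x + \<sigma>" if "norm x + s \<le> R" for x
    proof -
      have "lap w x + \<kappa> * norm (hess w x) \<le> - conv (moll s) F x + conv (moll s) F' x"
        using w(1) that unfolding barrier_with_def by blast
      then show ?thesis using small[of x] by linarith
    qed
    moreover have "csmooth w" "\<forall>x. w x \<ge> 0" using w(1) by (auto simp: barrier_with_def)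
    ultimately show "\<exists>w. csmooth w \<and> (\<forall>x. w x \<ge> 0) \<and> (LBINT x. w x) \<le> C * (1 / (1 - ?q)) * l2 F \<and>
     (\<forall>x. norm x + s \<le> R \<longrightarrow> lap w x + \<kappa> * norm (hess w x) \<le> - conv (moll s) F x + \<sigma>)"
      by blast
  qed
qed

section \<open>Comparison\<close>

lemma inner_matrix_vector: "\<xi> \<bullet> (A *v \<xi>) = (\<Sum>i\<in>UNIV. \<Sum>j\<in>UNIV. \<xi> $ i * A $ i $ j * \<xi> $ j)"
  for A :: "real^'n^'n"
  by (simp add: inner_vec_def matrix_vector_mult_def sum_distrib_left mult.assoc)

text \<open>The two-by-two principal minors give Z_ij^2 \<le> Z_ii Z_jj; summing over all entries
  bounds |Z|^2 by (tr Z)^2, without diagonalizing \<open>Z\<close>.\<close>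

lemma norm_le_trace_psd:
  fixes Z :: "real^'n^'n"
  assumes "transpose Z = Z" "\<And>\<xi>. \<xi> \<bullet> (Z *v \<xi>) \<ge> 0"
  shows "norm Z \<le> trace Z"
proof -
  have sym: "Z $ i $ j = Z $ j $ i" for i j
    using assms(1) by (metis transpose_def vec_lambda_beta)
  have ax: "(Z *v axis i 1) $ k = Z $ k $ i" for i k
    by (simp add: matrix_vector_mult_basis column_def)
  have q: "0 \<le> a\<^sup>2 * Z $ i $ i + 2 * a * b * Z $ i $ j + b\<^sup>2 * Z $ j $ j" for a b i j
  proof -
    have "0 \<le> (a *\<^sub>R axis i 1 + b *\<^sub>R axis j 1) \<bullet> (Z *v (a *\<^sub>R axis i 1 + b *\<^sub>R axis j 1))"
      by (rule assms(2))
    also have "\<dots> = a * a * Z $ i $ i + a * b * Z $ j $ i + a * b * Z $ i $ j + b * b * Z $ j $ j"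
      by (simp add: matrix_vector_right_distrib matrix_vector_mult_scaleR inner_add_left inner_add_right inner_axis' ax algebra_simps)
    finally show ?thesis using sym[of i j] by (simp add: power2_eq_square)
  qed
  have d: "Z $ i $ i \<ge> 0" for i using q[of 1 i 0 i] by simp
  have sq: "(Z $ i $ j)\<^sup>2 \<le> Z $ i $ i * Z $ j $ j" for i j
  \<comment> \<open>A vanishing diagonal entry makes the form affine in \<open>a\<close>, so
    nonnegativity forces the off-diagonal entry to vanish; otherwise the form is evaluated at a = -
    Z_ij, b = Z_ii.\<close>
  proof (cases "Z $ i $ i = 0")
    case True
    have "Z $ i $ j = 0"
    proof (rule ccontr)
      assume n: "Z $ i $ j \<noteq> 0"
      have "0 \<le> 2 * (- (Z $ j $ j + 1) / (2 * Z $ i $ j)) * Z $ i $ j + Z $ j $ j"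
        using q[of "- (Z $ j $ j + 1) / (2 * Z $ i $ j)" i 1 j] True by simp
      also have "\<dots> = -1" using n by (simp add: field_simps)
      finally show False by simp
    qed
    then show ?thesis using True by simp
  next
    case False
    then have pos: "Z $ i $ i > 0" using d[of i] by simp
    have "0 \<le> (- Z $ i $ j)\<^sup>2 * Z $ i $ i + 2 * (- Z $ i $ j) * Z $ i $ i * Z $ i $ j + (Z $ i $ i)\<^sup>2 * Z $ j $ j"
      by (rule q)
    also have "\<dots> = Z $ i $ i * (Z $ i $ i * Z $ j $ j - (Z $ i $ j)\<^sup>2)"
      by (simp add: power2_eq_square algebra_simps)
    finally show ?thesis using pos by (simp add: zero_le_mult_iff)
  qed
  have "norm Z \<le> sqrt (\<Sum>i\<in>UNIV. \<Sum>j\<in>UNIV. Z $ i $ i * Z $ j $ j)"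
    unfolding norm_matrix_eq by (intro real_sqrt_le_mono sum_mono sq)
  also have "(\<Sum>i\<in>UNIV. \<Sum>j\<in>UNIV. Z $ i $ i * Z $ j $ j) = (trace Z)\<^sup>2"
    by (simp add: trace_def power2_eq_square sum_product)
  also have "sqrt ((trace Z)\<^sup>2) = trace Z" using d by (simp add: trace_def sum_nonneg)
  finally show ?thesis .
qed

text \<open>On the line through \<open>x\<close> a positive second derivative would make the first
  derivative, which is zero at the maximum, positive just to the right; by the mean value theorem
  the function would then increase.\<close>

lemma hess_local_max:
  fixes h :: "real^'n \<Rightarrow> real"
  assumes "smooth h" "e > 0" "\<And>y. norm (y - x) < e \<Longrightarrow> h y \<le> h x"
  shows "\<xi> \<bullet> (hess h x *v \<xi>) \<le> 0"
proof (rule ccontr)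
  assume neg: "\<not> ?thesis"
  define g where "g t = h (x + t *\<^sub>R \<xi>)" for t
  define g' where "g' t = (\<Sum>i\<in>UNIV. partial i h (x + t *\<^sub>R \<xi>) * \<xi> $ i)" for t
  have g: "(g has_real_derivative g' t) (at t)" for t
    unfolding g_def[abs_def] g'_def by (rule smooth_directional[OF assms(1)])
  have "(g' has_real_derivative (\<Sum>i\<in>UNIV. (\<Sum>j\<in>UNIV. partial j (partial i h) (x + t *\<^sub>R \<xi>) * \<xi> $ j) * \<xi> $ i)) (at t)" for t
    unfolding g'_def[abs_def] by (intro DERIV_sum DERIV_cmult_right smooth_directional smooth_partial assms(1))
  from this[of 0] have g'': "(g' has_real_derivative (\<xi> \<bullet> (hess h x *v \<xi>))) (at 0)"
    unfolding inner_matrix_vector hess_nth partial_commute[OF assms(1)]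
    by (simp add: sum_distrib_left sum_distrib_right mult_ac)
  define N where "N = norm \<xi> + 1"
  have N: "N > 0" "norm \<xi> \<le> N" by (simp_all add: N_def add_nonneg_pos)
  define d where "d = e / N"
  have d: "d > 0" using assms(2) N by (simp add: d_def)
  have max: "g t \<le> g 0" if "\<bar>t\<bar> < d" for t
  proof -
    have "norm (t *\<^sub>R \<xi>) \<le> \<bar>t\<bar> * N" using N by (simp add: mult_left_mono)
    also have "\<dots> < d * N" using that N by (intro mult_strict_right_mono) auto
    also have "\<dots> = e" using N by (simp add: d_def)
    finally show ?thesis using assms(3)[of "x + t *\<^sub>R \<xi>"] by (simp add: g_def)
  qed
  have "g' 0 = 0" using DERIV_local_max[OF g d] max by auto
  obtain \<delta> where \<delta>: "\<delta> > 0" "\<And>t. 0 < t \<Longrightarrow> t < \<delta> \<Longrightarrow> g' 0 < g' t"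
    using DERIV_pos_inc_right[OF g''] neg by auto
  define t where "t = min d \<delta> / 2"
  have t: "0 < t" "t < d" "t < \<delta>" using d \<delta>(1) by (auto simp: t_def)
  obtain z where "0 < z" "z < t" "g t - g 0 = (t - 0) * g' z"
    using MVT2[OF t(1) g] by blast
  then have "g t - g 0 > 0" using \<delta>(2)[of z] t \<open>g' 0 = 0\<close> by simp
  then show False using max[of t] t by simp
qed

lemma norm_mat_1: "norm (mat 1 :: real^'n^'n) = sqrt (real CARD('n))"
proof -
  have "(\<Sum>j\<in>UNIV. ((mat 1 :: real^'n^'n) $ i $ j)\<^sup>2) = 1" for i
    by (simp add: mat_def if_distrib[where f="\<lambda>a. a\<^sup>2"] cong: if_cong)
  then show ?thesis by (simp add: norm_matrix_eq)
qed

lemma trace_mat_1: "trace (mat 1 :: real^'n^'n) = real CARD('n)"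
  by (simp add: trace_def mat_def)

lemma trace_scaleR: "trace (c *\<^sub>R A) = c * trace A" for A :: "real^'n^'n"
  by (simp add: trace_def sum_distrib_left)

lemma
  fixes X :: "real^'n^'n"
  shows abs_trace_le_sum: "\<bar>trace X\<bar> \<le> (\<Sum>i\<in>UNIV. \<Sum>j\<in>UNIV. \<bar>X $ i $ j\<bar>)"
    and norm_matrix_le_sum: "norm X \<le> (\<Sum>i\<in>UNIV. \<Sum>j\<in>UNIV. \<bar>X $ i $ j\<bar>)"
proof -
  have "\<bar>trace X\<bar> \<le> (\<Sum>i\<in>UNIV. \<bar>X $ i $ i\<bar>)" unfolding trace_def by (rule sum_abs)
  also have "\<dots> \<le> (\<Sum>i\<in>UNIV. \<Sum>j\<in>UNIV. \<bar>X $ i $ j\<bar>)"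
    by (intro sum_mono member_le_sum) auto
  finally show "\<bar>trace X\<bar> \<le> (\<Sum>i\<in>UNIV. \<Sum>j\<in>UNIV. \<bar>X $ i $ j\<bar>)" .
  have "norm X \<le> (\<Sum>i\<in>UNIV. norm (X $ i))"
    unfolding norm_vec_def[of X] by (rule L2_set_le_sum) simp
  also have "\<dots> \<le> (\<Sum>i\<in>UNIV. \<Sum>j\<in>UNIV. \<bar>X $ i $ j\<bar>)"
    by (intro sum_mono norm_le_l1_cart)
  finally show "norm X \<le> (\<Sum>i\<in>UNIV. \<Sum>j\<in>UNIV. \<bar>X $ i $ j\<bar>)" .
qed

text \<open>At an interior maximum of \<open>U - w\<close>, the matrix \<open>Z = D\<^sup>2w - S \<ge> D\<^sup>2w - D\<^sup>2U \<ge> 0\<close> would satisfy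
  \<open>tr Z < \<kappa> |Z| \<le> tr Z\<close>.\<close>

lemma comparison:
  fixes U w :: "real^'n \<Rightarrow> real"
  assumes "smooth U" "smooth w" "0 \<le> \<kappa>" "\<kappa> \<le> 1"
    and bdry: "\<And>x. norm x = r \<Longrightarrow> U x \<le> w x"
    and S: "\<And>x. transpose (S x) = S x" "\<And>x \<xi>. \<xi> \<bullet> (S x *v \<xi>) \<le> \<xi> \<bullet> (hess U x *v \<xi>)"
    and strict: "\<And>x. norm x < r \<Longrightarrow> lap w x + \<kappa> * norm (hess w x) < trace (S x) + \<kappa> * norm (S x)"
    and x: "norm x \<le> r"
  shows "U x \<le> w x"
proof -
  let ?h = "\<lambda>x. U x - w x"
  have sm: "smooth ?h" using assms by (intro smooth_diff)
  have "compact (cball (0::real^'n) r)" "cball (0::real^'n) r \<noteq> {}" using x norm_ge_zero[of x] by (auto simp del: norm_ge_zero)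
  from continuous_attains_sup[OF this continuous_on_subset[OF smooth_continuous[OF sm]]]
  obtain y where y: "norm y \<le> r" "\<And>z. norm z \<le> r \<Longrightarrow> ?h z \<le> ?h y" by auto
  have "?h y \<le> 0"
  proof (cases "norm y = r")
    case True then show ?thesis using bdry[of y] by simp
  next
    case False
    then have ny: "norm y < r" using y(1) by simp
    let ?Z = "hess w y - S y"
    have psd: "0 \<le> \<xi> \<bullet> (?Z *v \<xi>)" for \<xi>
    proof -
      have "\<xi> \<bullet> (hess ?h y *v \<xi>) \<le> 0"
      proof (rule hess_local_max[OF sm])
        show "0 < r - norm y" using ny by simp
        fix z assume "norm (z - y) < r - norm y"
        then have "norm z \<le> r" using norm_triangle_sub[of z y] by simp
        then show "?h z \<le> ?h y" by (rule y(2))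
      qed
      then have "\<xi> \<bullet> (hess U y *v \<xi>) \<le> \<xi> \<bullet> (hess w y *v \<xi>)"
        unfolding hess_diff[OF assms(1,2)] by (simp add: matrix_vector_mult_diff_rdistrib inner_diff_right)
      then have "\<xi> \<bullet> (S y *v \<xi>) \<le> \<xi> \<bullet> (hess w y *v \<xi>)" using S(2)[of \<xi> y] by linarith
      then show ?thesis by (simp add: matrix_vector_mult_diff_rdistrib inner_diff_right)
    qed
    have "transpose ?Z = ?Z"
      using transpose_hess[OF assms(2), of y] S(1)[of y]
      by (simp add: transpose_def vec_eq_iff)
    from norm_le_trace_psd[OF this psd] have le: "norm ?Z \<le> trace ?Z" .
    have "norm (S y) \<le> norm (hess w y) + norm ?Z"
      using norm_triangle_ineq4[of "hess w y" ?Z] by simp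
    then have "\<kappa> * norm (S y) \<le> \<kappa> * norm (hess w y) + \<kappa> * norm ?Z"
      using assms(3) by (metis mult_left_mono distrib_left)
    moreover have "\<kappa> * norm ?Z \<le> norm ?Z" using assms(3,4) by (simp add: mult_left_le_one_le)
    moreover have "trace ?Z = lap w y - trace (S y)" by (simp add: trace_def sum_subtractf)
    ultimately have False using strict[OF ny] le by linarith
    then show ?thesis ..
  qed
  then show ?thesis using y(2)[OF x] by simp
qed

text \<open>Two parameters tend to zero in turn. For fixed \<delta> the mollified \<open>U\<close>
  is compared with the barrier of the defect \<open>f\<close>, and \<sigma> tending to 0 bounds the
  integral of \<open>U\<close> by \<open>C * l2 f\<close>. Then \<delta> tends to 0, and
  \<open>f\<close> vanishes in L2 because the mollified \<open>S\<close> converges to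
  \<open>S\<close>. Assumption \<open>US\<close> is the distributional inequality tested against
  mollifiers only.\<close>

lemma psd_hessian_imp_zero:
  fixes U :: "real^'n \<Rightarrow> real" and S :: "real^'n \<Rightarrow> real^'n^'n"
  assumes \<kappa>: "0 \<le> \<kappa>" "\<kappa> < 1" and R0: "R0 > 0"
    and U: "L12 U" "\<And>x. R0 < norm x \<Longrightarrow> U x = 0"
    and S: "\<And>i j. L12 (\<lambda>x. S x $ i $ j)" "\<And>x. R0 < norm x \<Longrightarrow> S x = 0" "\<And>x. transpose (S x) = S x"
      "\<And>x. 0 \<le> trace (S x) + \<kappa> * norm (S x)"
    and US: "\<And>\<delta> x \<xi>. \<delta> > 0 \<Longrightarrow>
      \<xi> \<bullet> ((\<chi> i j. conv (moll \<delta>) (\<lambda>y. S y $ i $ j) x) *v \<xi>) \<le> \<xi> \<bullet> (hess (conv (moll \<delta>) U) x *v \<xi>)"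
  shows "(LBINT x. U x) \<le> 0"
proof -
  \<comment> \<open>One unit for the growth of supports under mollification at scale \<delta> < 1, a
    second one for the distance s \<le> 1 to the sphere that the barrier inequality demands.\<close>
  define R where "R = R0 + 2"
  have R: "R > 0" using R0 by (simp add: R_def)
  let ?V = "measure lborel (cball (0::real^'n) (R0 + 1))"
  let ?d = "real CARD('n)"
  \<comment> \<open>This is tr I - \<kappa> |I|. Adding - b |x|^2 lowers trace plus \<kappa> times
    norm of a Hessian by at least 2 b k0, which will supply strictness.\<close>
  define k0 where "k0 = ?d - \<kappa> * sqrt ?d"
  have "?d \<ge> 1" by (simp add: Suc_leI)
  then have "sqrt ?d \<le> ?d" using real_le_lsqrt[of ?d ?d] by (simp add: power2_eq_square)
  moreover have "\<kappa> * sqrt ?d < 1 * sqrt ?d" using \<kappa> by (intro mult_strict_right_mono) auto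
  ultimately have k0: "k0 > 0" unfolding k0_def by linarith
  obtain C where C: "C \<ge> 0" and barr: "\<And>(F :: real^'n \<Rightarrow> real) s \<sigma>. supp_pos R F \<Longrightarrow> s > 0 \<Longrightarrow> \<sigma> > 0 \<Longrightarrow>
    \<exists>w. csmooth w \<and> (\<forall>x. w x \<ge> 0) \<and> (LBINT x. w x) \<le> C * l2 F \<and>
     (\<forall>x. norm x + s \<le> R \<longrightarrow> lap w x + \<kappa> * norm (hess w x) \<le> - conv (moll s) F x + \<sigma>)"
    using barrier[OF \<kappa> R, where 'n='n] by metis
  have main: "(LBINT x. U x) \<le> C * (2 * (\<Sum>i\<in>UNIV. \<Sum>j\<in>UNIV. l2 (\<lambda>x. conv (moll \<delta>) (\<lambda>y. S y $ i $ j) x - S x $ i $ j)))"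
    if \<delta>: "0 < \<delta>" "\<delta> < 1" for \<delta>
  proof -
    note cs = csmooth_moll[OF \<delta>(1), where 'a='n]
    note mo = cs moll_nonneg[OF \<delta>(1)] integral_moll[OF \<delta>(1)]
    note iU = L12_integrable[OF U(1)]
    define Ud where "Ud = conv (moll \<delta>) U"
    define Sd where "Sd x = (\<chi> i j. conv (moll \<delta>) (\<lambda>y. S y $ i $ j) x)" for x
    have Sd_nth: "Sd x $ i $ j = conv (moll \<delta>) (\<lambda>y. S y $ i $ j) x" for x i j by (simp add: Sd_def)
    have sU: "smooth Ud" unfolding Ud_def by (rule smooth_conv[OF cs iU])
    have far: "R0 + \<delta> \<le> norm x \<Longrightarrow> Ud x = 0" "R0 + \<delta> \<le> norm x \<Longrightarrow> Sd x = 0" for x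
      unfolding Ud_def vec_eq_iff Sd_nth
      using moll_eq_0[OF \<delta>(1)] U(2) S(2) by (auto intro!: conv_eq_0[of \<delta> _ R0])
    have sS: "smooth (\<lambda>x. Sd x $ i $ j)" for i j
      unfolding Sd_nth by (rule smooth_conv[OF cs L12_integrable[OF S(1)]])
    define f where "f x = max 0 (- (trace (Sd x) + \<kappa> * norm (Sd x)))" for x
    have cf: "continuous_on UNIV f"
      unfolding f_def[abs_def] norm_matrix_eq trace_def
      by (intro continuous_intros smooth_continuous sS)
    have f0: "f x \<ge> 0" "R0 + 1 < norm x \<Longrightarrow> f x = 0" for x
      using far(2)[of x] \<delta> by (auto simp: f_def trace_def)
    let ?E = "\<lambda>i j x. conv (moll \<delta>) (\<lambda>y. S y $ i $ j) x - S x $ i $ j"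
    let ?G = "\<lambda>x. 2 * (\<Sum>i\<in>UNIV. \<Sum>j\<in>UNIV. \<bar>?E i j x\<bar>)"
    have LE: "L12 (?E i j)" for i j by (intro L12_diff L12_conv[OF mo] S(1))
    have LG: "L12 ?G" by (intro L12_cmult L12_sum L12_abs LE)
    \<comment> \<open>\<open>S\<close> itself has no defect, so \<open>f\<close> is bounded by the
      change of trace and of \<kappa> times norm between \<open>S\<close> and \<open>Sd\<close>.
      Each is at most the entrywise sum, hence the factor 2.\<close>
    have fG: "\<bar>f x\<bar> \<le> \<bar>?G x\<bar>" for x
    proof -
      let ?s = "\<Sum>i\<in>UNIV. \<Sum>j\<in>UNIV. \<bar>?E i j x\<bar>"
      have s: "?s \<ge> 0" by (intro sum_nonneg) auto
      have e: "(\<Sum>i\<in>UNIV. \<Sum>j\<in>UNIV. \<bar>(Sd x - S x) $ i $ j\<bar>) = ?s" by (simp add: Sd_nth)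
      have "\<bar>trace (Sd x) - trace (S x)\<bar> \<le> ?s"
        using abs_trace_le_sum[of "Sd x - S x"] unfolding e by (simp add: trace_def sum_subtractf)
      moreover have "norm (S x) \<le> norm (Sd x) + ?s"
        using norm_matrix_le_sum[of "Sd x - S x"] norm_triangle_ineq4[of "Sd x" "Sd x - S x"] unfolding e by simp
      then have "\<kappa> * norm (S x) \<le> \<kappa> * (norm (Sd x) + ?s)" using \<kappa>(1) by (rule mult_left_mono)
      then have "\<kappa> * norm (S x) \<le> \<kappa> * norm (Sd x) + \<kappa> * ?s" unfolding distrib_left .
      moreover have "\<kappa> * ?s \<le> ?s" using \<kappa> s by (simp add: mult_left_le_one_le)
      ultimately have "- (trace (Sd x) + \<kappa> * norm (Sd x)) \<le> 2 * ?s"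
        using S(4)[of x] by linarith
      then have "f x \<le> 2 * ?s" using s by (simp add: f_def)
      then show ?thesis using f0(1)[of x] s by simp
    qed
    have Lf: "L12 f" by (rule L12_bound[OF LG borel_measurable_continuous_onI[OF cf] fG])
    have sf: "supp_pos R f" using Lf f0 by (auto simp: supp_pos_def R_def)
    have "l2 f \<le> l2 ?G" by (rule l2_mono[OF LG fG])
    also have "\<dots> = 2 * l2 (\<lambda>x. \<Sum>i\<in>UNIV. \<Sum>j\<in>UNIV. \<bar>?E i j x\<bar>)" by (simp only: l2_cmult)
    also have "\<dots> \<le> 2 * (\<Sum>i\<in>UNIV. l2 (\<lambda>x. \<Sum>j\<in>UNIV. \<bar>?E i j x\<bar>))"
      by (intro mult_left_mono l2_sum_le L12_sum L12_abs LE) simp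
    also have "\<dots> \<le> 2 * (\<Sum>i\<in>UNIV. \<Sum>j\<in>UNIV. l2 (\<lambda>x. \<bar>?E i j x\<bar>))"
      by (intro mult_left_mono sum_mono l2_sum_le L12_abs LE) simp
    also have "\<dots> = 2 * (\<Sum>i\<in>UNIV. \<Sum>j\<in>UNIV. l2 (?E i j))" by (simp only: l2_abs)
    finally have l2f: "l2 f \<le> 2 * (\<Sum>i\<in>UNIV. \<Sum>j\<in>UNIV. l2 (?E i j))" .
    \<comment> \<open>The defect is continuous with bounded support, so at a small scale
      \<open>s\<close> it is uniformly \<sigma>-close to its average, the quantity the barrier
      actually dominates.\<close>
    have bound: "(LBINT x. U x) \<le> C * l2 f + \<sigma> * (2 / k0 * (R0 + 1)\<^sup>2 * ?V)" if \<sigma>: "\<sigma> > 0" for \<sigma>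
    proof -
      obtain s0 where s0: "s0 > 0" "\<And>s x. 0 < s \<Longrightarrow> s < s0 \<Longrightarrow> \<bar>conv (moll s) f x - f x\<bar> \<le> \<sigma>"
        using conv_moll_uniform[where R="R0 + 1", OF cf f0(2) L12_integrable[OF Lf] \<sigma>] by blast
      define s where "s = min 1 (s0 / 2)"
      have s: "0 < s" "s < s0" "s \<le> 1" using s0(1) by (auto simp: s_def)
      obtain w where w: "csmooth w" "\<And>x. w x \<ge> 0" "(LBINT x. w x) \<le> C * l2 f"
        "\<And>x. norm x + s \<le> R \<Longrightarrow> lap w x + \<kappa> * norm (hess w x) \<le> - conv (moll s) f x + \<sigma>"
        using barr[OF sf s(1) \<sigma>] by blast
      note sw = csmooth_imp_smooth[OF w(1)]
      \<comment> \<open>The quadratic gains 2 b k0 = 4 \<sigma>, more than the two losses of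
        \<sigma> each: the remainder of the barrier and the distance of \<open>f\<close> from its
        average.\<close>
      define b where "b = 2 * \<sigma> / k0"
      have b: "b > 0" using \<sigma> k0 by (simp add: b_def)
      \<comment> \<open>The constant makes the quadratic nonnegative on the comparison ball and zero
        on its boundary.\<close>
      let ?q = "\<lambda>x::real^'n. b * (R0 + 1)\<^sup>2 - b * (x \<bullet> x)"
      have sq: "smooth ?q" by (intro smooth_diff smooth_const smooth_mult smooth_inner_self)
      have qle: "0 \<le> ?q x" "?q x \<le> b * (R0 + 1)\<^sup>2" if "norm x \<le> R0 + 1" for x
      proof -
        have "x \<bullet> x \<le> (R0 + 1)\<^sup>2" using power_mono[OF that, of 2] by (simp add: power2_norm_eq_inner)
        then show "0 \<le> ?q x" using b by (simp add: mult_left_mono)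
        show "?q x \<le> b * (R0 + 1)\<^sup>2" using b by simp
      qed
      have cmp: "Ud x \<le> w x + ?q x" if x: "norm x \<le> R0 + 1" for x
      proof (rule comparison[where S=Sd and \<kappa>=\<kappa> and r="R0 + 1", OF sU smooth_add[OF sw sq]])
        show "0 \<le> \<kappa>" "\<kappa> \<le> 1" using \<kappa> by auto
        show "Ud y \<le> w y + ?q y" if "norm y = R0 + 1" for y
          using far(1)[of y] qle[of y] w(2)[of y] that \<delta> by simp
        show "transpose (Sd y) = Sd y" for y
        proof -
          have "S z $ i $ j = S z $ j $ i" for z i j
            using S(3)[of z] by (metis transpose_def vec_lambda_beta)
          then show ?thesis by (simp add: transpose_def Sd_def vec_eq_iff)
        qed
        show "\<xi> \<bullet> (Sd y *v \<xi>) \<le> \<xi> \<bullet> (hess Ud y *v \<xi>)" for y \<xi>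
          unfolding Ud_def Sd_def by (rule US[OF \<delta>(1)])
        show "norm x \<le> R0 + 1" by (rule x)
        fix y :: "real^'n" assume y: "norm y < R0 + 1"
        let ?H = "(- (2 * b)) *\<^sub>R (mat 1 :: real^'n^'n)"
        have h: "hess (\<lambda>x. w x + ?q x) y = hess w y + ?H"
          unfolding hess_add[OF sw sq] hess_inner_self ..
        have nH: "norm ?H = 2 * b * sqrt ?d" using b by (simp add: norm_mat_1)
        have tH: "trace ?H = - (2 * b * ?d)" by (simp only: trace_scaleR trace_mat_1 mult_minus_left)
        have "\<kappa> * norm (hess w y + ?H) \<le> \<kappa> * (norm (hess w y) + norm ?H)"
          using \<kappa>(1) by (intro mult_left_mono norm_triangle_ineq)
        then have "\<kappa> * norm (hess w y + ?H) \<le> \<kappa> * norm (hess w y) + \<kappa> * (2 * b * sqrt ?d)"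
          unfolding nH distrib_left .
        moreover have "lap w y + \<kappa> * norm (hess w y) \<le> - conv (moll s) f y + \<sigma>"
          using y s by (intro w(4)) (simp add: R_def)
        moreover have "\<bar>conv (moll s) f y - f y\<bar> \<le> \<sigma>" by (rule s0(2)[OF s(1,2)])
        moreover have "- (trace (Sd y) + \<kappa> * norm (Sd y)) \<le> f y" by (simp add: f_def)
        moreover have "2 * b * ?d - \<kappa> * (2 * b * sqrt ?d) = 4 * \<sigma>"
        proof -
          have "2 * b * ?d - \<kappa> * (2 * b * sqrt ?d) = 2 * (b * k0)" by (simp add: k0_def algebra_simps)
          also have "b * k0 = 2 * \<sigma>" using k0 by (simp add: b_def)
          finally show ?thesis by simp
        qed
        ultimately show "lap (\<lambda>x. w x + ?q x) y + \<kappa> * norm (hess (\<lambda>x. w x + ?q x) y) < trace (Sd y) + \<kappa> * norm (Sd y)"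
          unfolding h trace_add tH using \<sigma> by linarith
      qed
      let ?I = "indicator (cball (0::real^'n) (R0 + 1)) :: real^'n \<Rightarrow> real"
      have iI: "integrable lborel ?I"
        by (intro integrable_real_indicator emeasure_lborel_cball_finite) simp
      \<comment> \<open>Mollification preserves the integral, so comparing \<open>Ud\<close> with
        the barrier bounds the integral of \<open>U\<close> itself for each \<delta>.\<close>
      have "(LBINT x. U x) = (LBINT x. Ud x)"
        unfolding Ud_def using integral_conv[OF csmooth_integrable[OF cs] iU] integral_moll[OF \<delta>(1), where 'n='n] by simp
      also have "\<dots> \<le> (LBINT x. w x + b * (R0 + 1)\<^sup>2 * ?I x)"
      proof (rule integral_mono)
        show "integrable lborel Ud" unfolding Ud_def by (rule integrable_conv_fun[OF csmooth_integrable[OF cs] iU])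
        show "integrable lborel (\<lambda>x. w x + b * (R0 + 1)\<^sup>2 * ?I x)"
          using csmooth_integrable[OF w(1)] iI by simp
        show "Ud x \<le> w x + b * (R0 + 1)\<^sup>2 * ?I x" for x
        proof (cases "norm x \<le> R0 + 1")
          case True
          then show ?thesis using cmp[OF True] qle(2)[OF True] by simp
        next
          case False
          then show ?thesis using far(1)[of x] w(2)[of x] \<delta> by simp
        qed
      qed
      also have "\<dots> = (LBINT x. w x) + b * (R0 + 1)\<^sup>2 * ?V"
        using csmooth_integrable[OF w(1)] iI by simp
      also have "b * (R0 + 1)\<^sup>2 * ?V = \<sigma> * (2 / k0 * (R0 + 1)\<^sup>2 * ?V)" by (simp add: b_def)
      finally show ?thesis using w(3) by linarith
    qed
    have "(LBINT x. U x) \<le> C * l2 f"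
    proof (rule field_le_epsilon)
      fix e :: real assume e: "e > 0"
      let ?K = "2 / k0 * (R0 + 1)\<^sup>2 * ?V"
      have K: "?K \<ge> 0" using k0 by (intro mult_nonneg_nonneg) auto
      define \<sigma> where "\<sigma> = e / (?K + 1)"
      have "\<sigma> > 0" using e K unfolding \<sigma>_def by (intro divide_pos_pos) linarith+
      moreover have "\<sigma> * ?K \<le> e"
      proof -
        have "\<sigma> * ?K \<le> \<sigma> * (?K + 1)" using \<open>\<sigma> > 0\<close> by (intro mult_left_mono) auto
        also have "\<dots> = e" unfolding \<sigma>_def using K by (intro nonzero_eq_divide_eq[THEN iffD1]) linarith+
        finally show ?thesis .
      qed
      ultimately show "(LBINT x. U x) \<le> C * l2 f + e" using bound[of \<sigma>] by linarith
    qed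
    also have "\<dots> \<le> C * (2 * (\<Sum>i\<in>UNIV. \<Sum>j\<in>UNIV. l2 (?E i j)))" by (intro mult_left_mono l2f C)
    finally show ?thesis .
  qed
  show ?thesis
  proof (rule field_le_epsilon)
    fix e :: real assume e: "e > 0"
    define \<epsilon> where "\<epsilon> = e / (2 * C * ?d * ?d + 1)"
    have den: "2 * C * ?d * ?d + 1 > 0" using C by (intro add_nonneg_pos mult_nonneg_nonneg) auto
    have \<epsilon>: "\<epsilon> > 0" using e den by (simp add: \<epsilon>_def)
    define P where "P i j t \<longleftrightarrow> t > 0 \<and> (\<forall>s. 0 < s \<longrightarrow> s < t \<longrightarrow>
      l2 (\<lambda>x. conv (moll s) (\<lambda>y. S y $ i $ j) x - S x $ i $ j) \<le> \<epsilon>)" for i j t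
    have "\<exists>t. P i j t" for i j
      using conv_moll_L2[OF S(1)[of i j] \<epsilon>] unfolding P_def by blast
    then have "\<exists>g. \<forall>j. P i j (g j)" for i by (intro choice allI)
    then have "\<exists>s0. \<forall>i j. P i j (s0 i j)" by (intro choice[of "\<lambda>i g. \<forall>j. P i j (g j)"] allI)
    then obtain s0 where P: "\<And>i j. P i j (s0 i j)" by blast
    have s0: "s0 i j > 0" "0 < s \<Longrightarrow> s < s0 i j \<Longrightarrow> l2 (\<lambda>x. conv (moll s) (\<lambda>y. S y $ i $ j) x - S x $ i $ j) \<le> \<epsilon>" for i j s
      using P[of i j] by (auto simp: P_def)
    \<comment> \<open>The least of the finitely many thresholds for the entries; the inserted 1
      ensures the condition \<delta> < 1 of \<open>main\<close>.\<close>
    define m where "m = Min (insert 1 (range (\<lambda>(i, j). s0 i j)))"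
    have m: "m > 0" using s0(1) by (auto simp: m_def)
    have m1: "m \<le> 1" unfolding m_def by (intro Min_le) auto
    have m2: "m \<le> s0 i j" for i j
      unfolding m_def by (intro Min_le) (auto intro: rev_image_eqI[of "(i, j)"])
    define \<delta> where "\<delta> = m / 2"
    have \<delta>: "0 < \<delta>" "\<delta> < 1" "\<delta> < s0 i j" for i j using m m1 m2[of i j] by (auto simp: \<delta>_def)
    have "(LBINT x. U x) \<le> C * (2 * (\<Sum>i\<in>(UNIV::'n set). \<Sum>j\<in>(UNIV::'n set). \<epsilon>))"
      by (rule order_trans[OF main[OF \<delta>(1,2)]])
         (intro mult_left_mono sum_mono s0(2) \<delta> C, simp_all)
    also have "\<dots> = 2 * C * ?d * ?d * \<epsilon>" by simp
    also have "\<dots> \<le> (2 * C * ?d * ?d + 1) * \<epsilon>" using \<epsilon> by (intro mult_right_mono) auto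
    also have "\<dots> = e" using den by (simp add: \<epsilon>_def)
    finally show "(LBINT x. U x) \<le> 0 + e" by simp
  qed
qed

section \<open>Weak derivatives\<close>

lemma borel_measurable_lebesgue_on: "f \<in> borel_measurable borel \<Longrightarrow> f \<in> borel_measurable (lebesgue_on S)"
  by (intro measurable_restrict_space1) (simp add: measurable_completion)

text \<open>Links the spaces over \<open>lebesgue_on\<close> with the convolution calculus over
  \<open>lborel\<close>: modulo a null set the function is Borel, and the value zero outside
  \<open>S\<close> turns integrals over \<open>S\<close> into integrals over the whole
  space.\<close>

lemma borel_representative:
  fixes f :: "'a::euclidean_space \<Rightarrow> real"
  assumes "f \<in> borel_measurable (lebesgue_on S)" "S \<in> sets borel"
  shows "\<exists>b\<in>borel_measurable borel. (\<forall>x. x \<notin> S \<longrightarrow> b x = 0) \<and> (AE x in lebesgue_on S. f x = b x)"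
proof -
  have S: "S \<in> sets lebesgue" using assms(2) by simp
  have "(\<lambda>x. if x \<in> S then f x else 0) \<in> borel_measurable lebesgue"
    by (rule borel_measurable_if_I[OF assms(1) S])
  from completion_ex_borel_measurable_real[OF this]
  obtain g where g: "g \<in> borel_measurable lborel" "AE x in lborel. (if x \<in> S then f x else 0) = g x" by blast
  have "AE x in lebesgue. (if x \<in> S then f x else 0) = g x" by (rule AE_completion[OF g(2)])
  then have "AE x in lebesgue_on S. f x = (if x \<in> S then g x else 0)"
    using S by (auto simp: AE_restrict_space_iff elim: eventually_mono)
  moreover have "(\<lambda>x. if x \<in> S then g x else 0) \<in> borel_measurable borel"
    using g(1) assms(2) by (intro measurable_If_set) auto
  ultimately show ?thesis by (intro bexI[of _ "\<lambda>x. if x \<in> S then g x else 0"]) auto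
qed

lemma integral_lebesgue_on_borel:
  fixes b :: "'a::euclidean_space \<Rightarrow> real"
  assumes "b \<in> borel_measurable borel" "\<And>x. x \<notin> S \<Longrightarrow> b x = 0" "S \<in> sets borel"
  shows "(LINT x|lebesgue_on S. b x) = (LBINT x. b x)"
    and "integrable (lebesgue_on S) b \<longleftrightarrow> integrable lborel b"
proof -
  have S: "S \<in> sets lebesgue" using assms(3) by simp
  have e: "(\<lambda>x. if x \<in> S then b x else 0) = b" using assms(2) by auto
  show "(LINT x|lebesgue_on S. b x) = (LBINT x. b x)"
    using Lebesgue_Measure.integral_restrict_UNIV[OF S, of b] integral_lborel_lebesgue[OF assms(1)] by (simp add: e)
  show "integrable (lebesgue_on S) b \<longleftrightarrow> integrable lborel b"
    using Lebesgue_Measure.integrable_restrict_UNIV[OF S, of b] integrable_lborel_lebesgue[OF assms(1)] by (simp add: e)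
qed

lemma moll_conv_bounded:
  fixes h :: "real^'n \<Rightarrow> real"
  assumes "0 < s" "integrable lborel h" "\<And>x. \<bar>h x\<bar> \<le> 1"
  shows "\<bar>conv (moll s) h x\<bar> \<le> 1"
proof -
  note c = conv_moll_const[OF assms(1), of x]
  have "\<bar>conv (moll s) h x\<bar> \<le> (LBINT y. moll s (x - y))"
    unfolding conv_def
  proof (rule order_trans[OF integral_abs_bound], rule integral_mono)
    show "integrable lborel (\<lambda>y. \<bar>moll s (x - y) * h y\<bar>)"
      using integrable_conv[OF csmooth_moll[OF assms(1)] assms(2)] by simp
    show "\<bar>moll s (x - y) * h y\<bar> \<le> moll s (x - y)" for y
      using mult_left_mono[OF assms(3)[of y] moll_nonneg[OF assms(1), of "x - y"]] moll_nonneg[OF assms(1), of "x - y"]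
      by (simp add: abs_mult)
  qed (use c in simp)
  then show ?thesis using c by simp
qed

lemma test_functionsI:
  assumes "smooth \<phi>" "compact K" "K \<subseteq> \<Omega>" "\<And>x. x \<notin> K \<Longrightarrow> \<phi> x = 0"
  shows "\<phi> \<in> test_functions \<Omega>"
proof -
  have "closure {x. \<phi> x \<noteq> 0} \<subseteq> K"
    using assms(2,4) by (intro closure_minimal compact_imp_closed) auto
  moreover from this have "compact (closure {x. \<phi> x \<noteq> 0})"
    using assms(2) by (meson closed_closure compact_imp_bounded bounded_subset compact_eq_bounded_closed)
  ultimately show ?thesis using assms by (auto simp: test_functions_def smooth_def)
qed

text \<open>Tests \<open>w\<close> against mollifications of \<open>sgn w\<close> cut off to a compact set.\<close>

lemma fundamental_lemma_compact:
  fixes w :: "real^'n \<Rightarrow> real"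
  assumes \<Omega>: "open \<Omega>" and w: "w \<in> L1_loc \<Omega>" and K: "compact K" "K \<subseteq> \<Omega>"
    and zero: "\<And>\<phi>. \<phi> \<in> test_functions \<Omega> \<Longrightarrow> (LINT x|lebesgue_on \<Omega>. w x * \<phi> x) = 0"
  shows "AE x in lebesgue. x \<in> K \<longrightarrow> w x = 0"
proof (cases "K = {}")
  case False
  \<comment> \<open>The margin \<open>e\<close> keeps the mollified sign function supported in a
    compact subset of \<Omega>, so that it is an admissible test function.\<close>
  obtain e where e: "e > 0" "{x. infdist x K \<le> e} \<subseteq> \<Omega>"
    using compact_in_open_separated[OF False K(1) \<Omega> K(2)] .
  define K' where "K' = {x. infdist x K \<le> e}"
  have K': "compact K'" unfolding K'_def by (rule compact_infdist_le[OF False K(1) e(1)])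
  have KK': "K \<subseteq> K'" using e(1) by (auto simp: K'_def)
  have \<Omega>_leb: "\<Omega> \<in> sets lebesgue" using \<Omega> by simp
  have "integrable lebesgue (\<lambda>x. indicator K' x *\<^sub>R w x)"
    using w K' e(2) by (auto simp: L1_loc_def set_integrable_def K'_def)
  then have iF: "integrable lebesgue (\<lambda>x. if x \<in> K' then w x else 0)"
    unfolding indicator_scaleR_eq_if .
  obtain b where b: "b \<in> borel_measurable lborel" "AE x in lborel. (if x \<in> K' then w x else 0) = b x"
    using completion_ex_borel_measurable_real[OF borel_measurable_integrable[OF iF]] by blast
  have bl: "AE x in lebesgue. (if x \<in> K' then w x else 0) = b x" by (rule AE_completion[OF b(2)])
  have mb: "b \<in> borel_measurable borel" "b \<in> borel_measurable lebesgue"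
    using b(1) by (simp_all add: measurable_completion)
  have "integrable lebesgue b"
    by (rule integrable_cong_AE_imp[OF iF mb(2)]) (use bl in \<open>auto elim: eventually_mono\<close>)
  then have ib: "integrable lborel b" using integrable_lborel_lebesgue[OF mb(1)] by simp
  define h where "h x = indicator K x * sgn (b x)" for x
  have Kb: "K \<in> sets borel" using K(1) by (simp add: borel_compact)
  have mh: "h \<in> borel_measurable borel"
    unfolding h_def[abs_def] using Kb mb(1) by measurable
  have h1: "\<bar>h x\<bar> \<le> 1" for x by (auto simp: h_def indicator_def sgn_if)
  obtain R where R: "\<And>x. x \<in> K \<Longrightarrow> norm x \<le> R" using K(1) compact_imp_bounded bounded_iff by metis
  have h0: "h x = 0" if "R < norm x" for x using R[of x] that by (auto simp: h_def indicator_def)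
  have "\<bar>(h x)\<^sup>2\<bar> \<le> 1" for x using h1[of x] by (simp add: abs_square_le_1)
  then have Lh: "L12 h"
    unfolding L12_def
    using integrable_bounded_support[OF mh h1 h0] integrable_bounded_support[of "\<lambda>x. (h x)\<^sup>2" 1 R] mh h0 by auto
  note ih = L12_integrable[OF Lh]
  have orth: "(LBINT x. b x * conv (moll s) h x) = 0" if s: "0 < s" "s < e" for s
  proof -
    let ?\<psi> = "conv (moll s) h"
    have sm: "smooth ?\<psi>" by (rule smooth_conv[OF csmooth_moll[OF s(1)] ih])
    have out: "?\<psi> x = 0" if x: "x \<notin> K'" for x
    proof -
      have "moll s (x - y) * h y = 0" for y
      proof (cases "y \<in> K")
        case True
        have "e < infdist x K" using x by (simp add: K'_def)
        also have "\<dots> \<le> dist x y" by (rule infdist_le[OF True])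
        finally have "s \<le> norm (x - y)" using s by (simp add: dist_norm)
        then show ?thesis using moll_eq_0[OF s(1), of "x - y"] by simp
      qed (simp add: h_def)
      then show ?thesis unfolding conv_def by (simp only: integral_zero)
    qed
    have "?\<psi> \<in> test_functions \<Omega>"
      by (rule test_functionsI[OF sm K' _ out]) (use e(2) in \<open>simp add: K'_def\<close>)
    then have "0 = (LINT x|lebesgue_on \<Omega>. w x * ?\<psi> x)" using zero by simp
    also have "\<dots> = (LINT x|lebesgue. (if x \<in> \<Omega> then w x * ?\<psi> x else 0))"
      by (rule Lebesgue_Measure.integral_restrict_UNIV[OF \<Omega>_leb, symmetric])
    also have "\<dots> = (LINT x|lebesgue. (if x \<in> K' then w x else 0) * ?\<psi> x)"
      by (rule Bochner_Integration.integral_cong) (use out e(2) in \<open>auto simp: K'_def\<close>)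
    also have "\<dots> = (LINT x|lebesgue. b x * ?\<psi> x)"
    proof (rule integral_cong_AE)
      have m\<psi>: "?\<psi> \<in> borel_measurable lebesgue" using borel_measurable_smooth[OF sm] by (simp add: measurable_completion)
      show "(\<lambda>x. (if x \<in> K' then w x else 0) * ?\<psi> x) \<in> borel_measurable lebesgue"
        using iF m\<psi> by (intro borel_measurable_times) auto
      show "(\<lambda>x. b x * ?\<psi> x) \<in> borel_measurable lebesgue" using mb m\<psi> by (intro borel_measurable_times)
    qed (use bl in \<open>auto elim: eventually_mono\<close>)
    also have "\<dots> = (LBINT x. b x * ?\<psi> x)"
      using mb(1) borel_measurable_smooth[OF sm] by (intro integral_lborel_lebesgue[symmetric] borel_measurable_times)
    finally show ?thesis by simp
  qed
  have "\<exists>s. 0 < s \<and> s < e \<and> l2 (\<lambda>x. conv (moll s) h x - h x) \<le> inverse (real (Suc n))" for n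
  proof -
    have "inverse (real (Suc n)) > 0" by simp
    from conv_moll_L2[OF Lh this] obtain s0 where "s0 > 0"
      "\<And>s. 0 < s \<Longrightarrow> s < s0 \<Longrightarrow> l2 (\<lambda>x. conv (moll s) h x - h x) \<le> inverse (real (Suc n))" by blast
    then show ?thesis using e(1) by (intro exI[of _ "min s0 e / 2"]) auto
  qed
  then have "\<exists>s. \<forall>n. 0 < s n \<and> s n < e \<and> l2 (\<lambda>x. conv (moll (s n)) h x - h x) \<le> inverse (real (Suc n))"
    by (intro choice allI)
  then obtain s where s: "\<And>n. 0 < s n" "\<And>n. s n < e" "\<And>n. l2 (\<lambda>x. conv (moll (s n)) h x - h x) \<le> inverse (real (Suc n))"
    by blast
  define \<psi> where "\<psi> n = conv (moll (s n)) h" for n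
  have m\<psi>: "\<psi> n \<in> borel_measurable borel" for n
    unfolding \<psi>_def by (intro borel_measurable_smooth smooth_conv csmooth_moll s ih)
  have L\<psi>: "L12 (\<lambda>x. \<psi> n x - h x)" for n
    unfolding \<psi>_def by (intro L12_diff L12_conv csmooth_moll moll_nonneg integral_moll s Lh)
  \<comment> \<open>Since \<open>b\<close> is only integrable, L2 convergence of the test functions
    cannot be paired with it. A subsequence converging almost everywhere, bounded by 1, allows
    dominated convergence with majorant |b|.\<close>
  have "(\<lambda>n. LBINT x. norm ((\<psi> n x - h x)\<^sup>2)) \<longlonglongrightarrow> 0"
  proof (rule tendsto_sandwich[OF _ _ tendsto_const])
    have "(\<lambda>n. (inverse (real (Suc n)))\<^sup>2) \<longlonglongrightarrow> 0\<^sup>2" by (intro tendsto_power LIMSEQ_inverse_real_of_nat)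
    then show "(\<lambda>n. (inverse (real (Suc n)))\<^sup>2) \<longlonglongrightarrow> 0" by simp
    have "(LBINT x. (\<psi> n x - h x)\<^sup>2) \<le> (inverse (real (Suc n)))\<^sup>2" for n
      unfolding l2_sq[symmetric] \<psi>_def by (intro power_mono s l2_nonneg)
    then show "\<forall>\<^sub>F n in sequentially. (LBINT x. norm ((\<psi> n x - h x)\<^sup>2)) \<le> (inverse (real (Suc n)))\<^sup>2"
      by simp
  qed simp
  from tendsto_L1_AE_subseq[OF L12_sq[OF L\<psi>] this] obtain r where
    r: "strict_mono (r :: nat \<Rightarrow> nat)" "AE x in lborel. (\<lambda>n. (\<psi> (r n) x - h x)\<^sup>2) \<longlonglongrightarrow> 0" by blast
  have "(\<lambda>n. LBINT x. b x * \<psi> (r n) x) \<longlonglongrightarrow> (LBINT x. b x * h x)"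
  proof (rule integral_dominated_convergence[where w="\<lambda>x. \<bar>b x\<bar>"])
    show "AE x in lborel. (\<lambda>n. b x * \<psi> (r n) x) \<longlonglongrightarrow> b x * h x"
      using r(2)
    proof eventually_elim
      case (elim x)
      have "(\<lambda>n. sqrt ((\<psi> (r n) x - h x)\<^sup>2)) \<longlonglongrightarrow> sqrt 0" by (intro tendsto_real_sqrt elim)
      then have "(\<lambda>n. \<psi> (r n) x - h x) \<longlonglongrightarrow> 0" by (simp add: tendsto_rabs_zero_iff)
      then have "(\<lambda>n. \<psi> (r n) x) \<longlonglongrightarrow> h x" by (rule LIM_zero_cancel)
      then show ?case by (rule tendsto_mult_left)
    qed
    show "AE x in lborel. norm (b x * \<psi> (r n) x) \<le> \<bar>b x\<bar>" for n
    proof (rule AE_I2)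
      fix x
      have "\<bar>\<psi> (r n) x\<bar> \<le> 1" unfolding \<psi>_def by (intro moll_conv_bounded s ih h1)
      then show "norm (b x * \<psi> (r n) x) \<le> \<bar>b x\<bar>" by (simp add: abs_mult mult_left_le)
    qed
  qed (use mb m\<psi> mh ib in auto)
  moreover have "(LBINT x. b x * \<psi> (r n) x) = 0" for n
    unfolding \<psi>_def by (intro orth s)
  ultimately have "(LBINT x. b x * h x) = 0" by (simp add: LIMSEQ_const_iff)
  moreover have "b x * h x = indicator K x * \<bar>b x\<bar>" for x by (simp add: h_def abs_sgn)
  ultimately have z: "(LBINT x. indicator K x * \<bar>b x\<bar>) = 0" by simp
  have "AE x in lborel. indicator K x * \<bar>b x\<bar> = 0"
  proof (subst integral_nonneg_eq_0_iff_AE[symmetric])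
    show "integrable lborel (\<lambda>x. indicator K x * \<bar>b x\<bar>)"
      using ib Kb by (intro integrable_real_mult_indicator[unfolded mult.commute[of _ "indicator _ _"]]) auto
  qed (use z in auto)
  then have "AE x in lebesgue. indicator K x * \<bar>b x\<bar> = 0" by (rule AE_completion)
  then show ?thesis using bl
  proof eventually_elim
    case (elim x)
    then show ?case using KK' by (auto simp: indicator_def)
  qed
qed simp

text \<open>An exhaustion by countably many compact sets keeps the exceptional set null.\<close>

lemma fundamental_lemma:
  fixes w :: "real^'n \<Rightarrow> real"
  assumes \<Omega>: "open \<Omega>" and w: "w \<in> L1_loc \<Omega>"
    and zero: "\<And>\<phi>. \<phi> \<in> test_functions \<Omega> \<Longrightarrow> (LINT x|lebesgue_on \<Omega>. w x * \<phi> x) = 0"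
  shows "AE x in lebesgue_on \<Omega>. w x = 0"
proof -
  have "\<exists>C::nat \<Rightarrow> (real^'n) set. (\<forall>n. compact (C n)) \<and> (\<forall>n. C n \<subseteq> \<Omega>) \<and> \<Union>(range C) = \<Omega>"
  proof (rule open_Union_compact_subsets[OF \<Omega>])
    fix C :: "nat \<Rightarrow> (real^'n) set"
    assume "\<And>n. compact (C n)" "\<And>n. C n \<subseteq> \<Omega>" "\<Union>(range C) = \<Omega>"
    then show ?thesis by (intro exI[of _ C]) simp
  qed
  then obtain C :: "nat \<Rightarrow> (real^'n) set"
    where C: "\<forall>n. compact (C n)" "\<forall>n. C n \<subseteq> \<Omega>" "\<Union>(range C) = \<Omega>" by blast
  have "AE x in lebesgue. \<forall>n. x \<in> C n \<longrightarrow> w x = 0"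
    by (subst AE_all_countable) (intro allI fundamental_lemma_compact[OF \<Omega> w C(1,2)[rule_format] zero])
  then have "AE x in lebesgue. x \<in> \<Omega> \<longrightarrow> w x = 0"
    by (rule eventually_mono) (use C(3) in blast)
  then show ?thesis using \<Omega> by (simp add: AE_restrict_space_iff)
qed

lemma test_functionsD:
  assumes "\<phi> \<in> test_functions \<Omega>"
  shows "smooth \<phi>" "csmooth \<phi>" "x \<notin> \<Omega> \<Longrightarrow> \<phi> x = 0"
proof -
  show s: "smooth \<phi>" using assms by (simp add: test_functions_def smooth_def)
  have "bounded (closure {x. \<phi> x \<noteq> 0})"
    using assms compact_imp_bounded by (auto simp: test_functions_def)
  then obtain r where r: "\<And>x. x \<in> closure {x. \<phi> x \<noteq> 0} \<Longrightarrow> norm x \<le> r" by (auto simp: bounded_iff)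
  have "\<phi> x = 0" if "r < norm x" for x
    using r[of x] that closure_subset[of "{x. \<phi> x \<noteq> 0}"] by force
  then show "csmooth \<phi>" using s by (auto simp: csmooth_def)
  show "x \<notin> \<Omega> \<Longrightarrow> \<phi> x = 0"
    using assms closure_subset[of "{x. \<phi> x \<noteq> 0}"] by (auto simp: test_functions_def)
qed

text \<open>The third assumption expresses locality: \<psi> vanishes wherever \<phi> vanishes on a
  neighbourhood. It covers derivatives and compositions alike.\<close>

lemma test_functions_closed_under:
  assumes "\<phi> \<in> test_functions \<Omega>" "smooth \<psi>" "\<And>S x. open S \<Longrightarrow> x \<in> S \<Longrightarrow> (\<And>y. y \<in> S \<Longrightarrow> \<phi> y = 0) \<Longrightarrow> \<psi> x = 0"
  shows "\<psi> \<in> test_functions \<Omega>"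
proof (rule test_functionsI[OF assms(2)])
  show "compact (closure {x. \<phi> x \<noteq> 0})" "closure {x. \<phi> x \<noteq> 0} \<subseteq> \<Omega>"
    using assms(1) by (auto simp: test_functions_def)
  fix x assume "x \<notin> closure {x. \<phi> x \<noteq> 0}"
  then show "\<psi> x = 0"
    using closure_subset[of "{x. \<phi> x \<noteq> 0}"]
    by (intro assms(3)[of "- closure {x. \<phi> x \<noteq> 0}"]) auto
qed

lemma test_functions_partial: "\<phi> \<in> test_functions \<Omega> \<Longrightarrow> partial i \<phi> \<in> test_functions \<Omega>"
  by (rule test_functions_closed_under) (auto intro: smooth_partial test_functionsD partial_eq_0_open)

lemma test_functions_compose:
  assumes "\<phi> \<in> test_functions \<Omega>" "smooth1 f" "f 0 = 0" "smooth \<psi>"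
  shows "(\<lambda>x. f (\<phi> x) * \<psi> x) \<in> test_functions \<Omega>"
proof (rule test_functions_closed_under[OF assms(1)])
  show "smooth (\<lambda>x. f (\<phi> x) * \<psi> x)"
    by (rule smooth_mult[OF smooth_compose1[OF assms(2) test_functionsD(1)[OF assms(1)]] assms(4)])
qed (use assms(3) in auto)

lemma L1_loc_integrable:
  fixes w :: "real^'n \<Rightarrow> real"
  assumes "open \<Omega>" "w \<in> L1_loc \<Omega>" "\<phi> \<in> test_functions \<Omega>"
  shows "integrable (lebesgue_on \<Omega>) (\<lambda>x. w x * \<phi> x)"
proof -
  let ?K = "closure {x. \<phi> x \<noteq> 0}"
  have K: "compact ?K" "?K \<subseteq> \<Omega>" using assms(3) by (auto simp: test_functions_def)
  obtain B where B: "\<forall>x. \<bar>\<phi> x\<bar> \<le> B" using csmooth_bounded[OF test_functionsD(2)[OF assms(3)]] by auto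
  have "integrable lebesgue (\<lambda>x. indicator ?K x *\<^sub>R w x)"
    using assms(2) K by (simp add: L1_loc_def set_integrable_def)
  then have "integrable lebesgue (\<lambda>x. \<phi> x * (indicator ?K x *\<^sub>R w x))"
    using B borel_measurable_smooth[OF test_functionsD(1)[OF assms(3)]]
    by (intro integrable_bounded_mult[of _ _ B]) (auto simp: measurable_completion)
  also have "(\<lambda>x. \<phi> x * (indicator ?K x *\<^sub>R w x)) = (\<lambda>x. if x \<in> \<Omega> then w x * \<phi> x else 0)"
    using closure_subset[of "{x. \<phi> x \<noteq> 0}"] K(2) by (auto simp: indicator_def fun_eq_iff)
  finally show ?thesis using assms(1) by (simp add: Lebesgue_Measure.integrable_restrict_UNIV)
qed

lemma L1_loc_diff: "u \<in> L1_loc \<Omega> \<Longrightarrow> w \<in> L1_loc \<Omega> \<Longrightarrow> (\<lambda>x. u x - w x) \<in> L1_loc \<Omega>"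
  by (auto simp: L1_loc_def intro: set_integral_diff)

lemma L1_loc_csmooth: "csmooth \<phi> \<Longrightarrow> \<phi> \<in> L1_loc \<Omega>"
proof -
  assume \<phi>: "csmooth \<phi>"
  then have "integrable lebesgue \<phi>"
    using csmooth_integrable[of \<phi>] integrable_lborel_lebesgue[OF borel_measurable_csmooth] by blast
  then have "integrable lebesgue (\<lambda>x. indicator K x *\<^sub>R \<phi> x)" if "compact K" for K
    using that by (intro integrable_mult_indicator fmeasurableD lmeasurable_compact)
  then show ?thesis by (simp add: L1_loc_def set_integrable_def)
qed

lemma has_weak_partial_diff:
  assumes "open \<Omega>" "has_weak_partial \<Omega> i u w" "has_weak_partial \<Omega> i u' w'"
  shows "has_weak_partial \<Omega> i (\<lambda>x. u x - u' x) (\<lambda>x. w x - w' x)"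
proof -
  have l: "u \<in> L1_loc \<Omega>" "w \<in> L1_loc \<Omega>" "u' \<in> L1_loc \<Omega>" "w' \<in> L1_loc \<Omega>"
    using assms by (auto simp: has_weak_partial_def)
  have "(LINT x|lebesgue_on \<Omega>. (u x - u' x) * partial i \<phi> x) = - (LINT x|lebesgue_on \<Omega>. (w x - w' x) * \<phi> x)"
    if "\<phi> \<in> test_functions \<Omega>" for \<phi>
    using assms that l
    by (simp add: left_diff_distrib L1_loc_integrable test_functions_partial has_weak_partial_def)
  then show ?thesis using l by (simp add: has_weak_partial_def L1_loc_diff)
qed

text \<open>Transfers square integrability from the derivative granted by the Sobolev spaces to the
  arbitrary representative \<open>weak_partial\<close>.\<close>

lemma has_weak_partial_unique:
  assumes "open \<Omega>" "has_weak_partial \<Omega> i u w" "has_weak_partial \<Omega> i u w'"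
  shows "AE x in lebesgue_on \<Omega>. w x = w' x"
proof -
  have "AE x in lebesgue_on \<Omega>. w x - w' x = 0"
    using has_weak_partial_diff[OF assms] assms(1)
    by (intro fundamental_lemma) (auto simp: has_weak_partial_def)
  then show ?thesis by simp
qed

lemma has_weak_partial_weak_partial:
  "has_weak_partial \<Omega> i u w \<Longrightarrow> has_weak_partial \<Omega> i u (weak_partial \<Omega> i u)"
  unfolding weak_partial_def by (rule someI[of "has_weak_partial \<Omega> i u"])

text \<open>Second derivatives are taken of a chosen first derivative, which is known to be the one
  granted by \<open>H2_space\<close> only up to a null set.\<close>

lemma has_weak_partial_cong_AE:
  assumes "open \<Omega>" "has_weak_partial \<Omega> i u w" "AE x in lebesgue_on \<Omega>. u x = u' x" "u' \<in> L1_loc \<Omega>"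
  shows "has_weak_partial \<Omega> i u' w"
proof -
  have "(LINT x|lebesgue_on \<Omega>. u' x * partial i \<phi> x) = (LINT x|lebesgue_on \<Omega>. u x * partial i \<phi> x)"
    if "\<phi> \<in> test_functions \<Omega>" for \<phi>
  proof (rule integral_cong_AE)
    show "(\<lambda>x. u' x * partial i \<phi> x) \<in> borel_measurable (lebesgue_on \<Omega>)"
      "(\<lambda>x. u x * partial i \<phi> x) \<in> borel_measurable (lebesgue_on \<Omega>)"
      using L1_loc_integrable[OF assms(1) _ test_functions_partial[OF that]] assms(2,4)
      by (auto simp: has_weak_partial_def)
    show "AE x in lebesgue_on \<Omega>. u' x * partial i \<phi> x = u x * partial i \<phi> x"
      using assms(3) by eventually_elim simp
  qed
  then show ?thesis using assms(2,4) by (simp add: has_weak_partial_def)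
qed

lemma has_weak_partial_test_function:
  assumes "open \<Omega>" "\<phi> \<in> test_functions \<Omega>"
  shows "has_weak_partial \<Omega> i \<phi> (partial i \<phi>)"
proof -
  have "(LINT x|lebesgue_on \<Omega>. \<phi> x * partial i \<psi> x) = - (LINT x|lebesgue_on \<Omega>. partial i \<phi> x * \<psi> x)"
    if "\<psi> \<in> test_functions \<Omega>" for \<psi>
  proof -
    have m: "\<phi> \<in> borel_measurable borel" "\<psi> \<in> borel_measurable borel"
      "partial i \<phi> \<in> borel_measurable borel" "partial i \<psi> \<in> borel_measurable borel"
      by (intro borel_measurable_smooth smooth_partial test_functionsD(1)[OF assms(2)] test_functionsD(1)[OF that])+
    have "(LINT x|lebesgue_on \<Omega>. \<phi> x * partial i \<psi> x) = (LBINT x. \<phi> x * partial i \<psi> x)"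
      using assms test_functionsD(3)[OF assms(2)] by (intro integral_lebesgue_on_borel borel_measurable_times m) auto
    also have "\<dots> = - (LBINT x. partial i \<phi> x * \<psi> x)"
      by (intro integral_by_parts test_functionsD[OF assms(2)] test_functionsD[OF that])
    also have "(LBINT x. partial i \<phi> x * \<psi> x) = (LINT x|lebesgue_on \<Omega>. partial i \<phi> x * \<psi> x)"
      using assms test_functionsD(3)[OF that] by (intro integral_lebesgue_on_borel[symmetric] borel_measurable_times m) auto
    finally show ?thesis .
  qed
  then show ?thesis
    using test_functionsD(2)[OF assms(2)]
    by (auto simp: has_weak_partial_def intro!: L1_loc_csmooth csmooth_partial)
qed

text \<open>Completeness of Lebesgue measure, by which a chosen weak derivative inherits
  measurability from its representative.\<close>

lemma borel_measurable_lebesgue_on_AE: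
  fixes f :: "'a::euclidean_space \<Rightarrow> real"
  assumes "S \<in> sets lebesgue" "f \<in> borel_measurable (lebesgue_on S)" "AE x in lebesgue_on S. f x = g x"
  shows "g \<in> borel_measurable (lebesgue_on S)"
proof (rule borel_measurable_if_D)
  show "(\<lambda>x. if x \<in> S then g x else 0) \<in> borel_measurable lebesgue"
  proof (rule borel_measurable_AE)
    show "(\<lambda>x. if x \<in> S then f x else 0) \<in> borel_measurable lebesgue"
      by (rule borel_measurable_if_I[OF assms(2,1)])
    show "AE x in lebesgue. (if x \<in> S then f x else 0) = (if x \<in> S then g x else 0)"
      using assms(3,1) by (auto simp: AE_restrict_space_iff elim: eventually_mono)
  qed
qed

text \<open>Boundedness of \<Omega> adds integrability to square integrability, through |b| \<le> 1
  + b^2 on \<Omega>.\<close>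

lemma L2_representative:
  fixes u :: "'a::euclidean_space \<Rightarrow> real"
  assumes "open \<Omega>" "bounded \<Omega>" "f \<in> L2_space \<Omega>" "AE x in lebesgue_on \<Omega>. f x = u x"
  shows "\<exists>b. L12 b \<and> (\<forall>x. x \<notin> \<Omega> \<longrightarrow> b x = 0) \<and> (AE x in lebesgue_on \<Omega>. u x = b x)"
proof -
  have \<Omega>: "\<Omega> \<in> sets borel" using assms(1) by simp
  have f: "f \<in> borel_measurable (lebesgue_on \<Omega>)" "integrable (lebesgue_on \<Omega>) (\<lambda>x. (f x)\<^sup>2)"
    using assms(3) by (auto simp: L2_space_def)
  obtain b where b: "b \<in> borel_measurable borel" "\<And>x. x \<notin> \<Omega> \<Longrightarrow> b x = 0" "AE x in lebesgue_on \<Omega>. f x = b x"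
    using borel_representative[OF f(1) \<Omega>] by blast
  have "integrable (lebesgue_on \<Omega>) (\<lambda>x. (b x)\<^sup>2)"
  proof (rule integrable_cong_AE_imp[OF f(2)])
    show "(\<lambda>x. (b x)\<^sup>2) \<in> borel_measurable (lebesgue_on \<Omega>)"
      by (intro borel_measurable_power borel_measurable_lebesgue_on b(1))
    show "AE x in lebesgue_on \<Omega>. (f x)\<^sup>2 = (b x)\<^sup>2" using b(3) by eventually_elim simp
  qed
  then have sq: "integrable lborel (\<lambda>x. (b x)\<^sup>2)"
    using integral_lebesgue_on_borel(2)[of "\<lambda>x. (b x)\<^sup>2" \<Omega>] b \<Omega> by simp
  have "integrable lborel b"
  proof (rule Bochner_Integration.integrable_bound)
    have "emeasure lborel \<Omega> < \<infinity>" by (rule emeasure_bounded_finite[OF assms(2)])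
    then show "integrable lborel (\<lambda>x. indicator \<Omega> x + (b x)\<^sup>2)" using sq \<Omega> by simp
    show "AE x in lborel. norm (b x) \<le> norm (indicator \<Omega> x + (b x)\<^sup>2)"
    proof (rule AE_I2)
      fix x
      have "2 * \<bar>b x\<bar> \<le> \<bar>b x\<bar>\<^sup>2 + 1" using sum_squares_bound[of "\<bar>b x\<bar>" 1] by simp
      then have "\<bar>b x\<bar> \<le> 1 + (b x)\<^sup>2" unfolding power2_abs by linarith
      then show "norm (b x) \<le> norm (indicator \<Omega> x + (b x)\<^sup>2)"
        using b(2)[of x] by (cases "x \<in> \<Omega>") (auto simp: add_nonneg_nonneg)
    qed
  qed (use b in simp)
  then have "L12 b" using sq by (simp add: L12_def)
  moreover have "AE x in lebesgue_on \<Omega>. u x = b x"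
    using assms(4) b(3) by eventually_elim simp
  ultimately show ?thesis using b(2) by blast
qed

lemma integral_representative:
  fixes u b \<psi> :: "'a::euclidean_space \<Rightarrow> real"
  assumes "open \<Omega>" "b \<in> borel_measurable borel" "\<And>x. x \<notin> \<Omega> \<Longrightarrow> b x = 0" "AE x in lebesgue_on \<Omega>. u x = b x"
    "\<psi> \<in> borel_measurable borel"
  shows "(LINT x|lebesgue_on \<Omega>. u x * \<psi> x) = (LBINT x. b x * \<psi> x)"
proof -
  have "(LINT x|lebesgue_on \<Omega>. u x * \<psi> x) = (LINT x|lebesgue_on \<Omega>. b x * \<psi> x)"
  proof (rule integral_cong_AE)
    show m: "(\<lambda>x. b x * \<psi> x) \<in> borel_measurable (lebesgue_on \<Omega>)"
      by (intro borel_measurable_lebesgue_on borel_measurable_times assms)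
    show ae: "AE x in lebesgue_on \<Omega>. u x * \<psi> x = b x * \<psi> x" using assms(4) by eventually_elim simp
    show "(\<lambda>x. u x * \<psi> x) \<in> borel_measurable (lebesgue_on \<Omega>)"
      by (rule borel_measurable_lebesgue_on_AE[OF _ m]) (use assms(1) ae in \<open>auto elim: eventually_mono\<close>)
  qed
  also have "\<dots> = (LBINT x. b x * \<psi> x)"
    using assms by (intro integral_lebesgue_on_borel borel_measurable_times) auto
  finally show ?thesis .
qed

text \<open>The data of \<open>v \<in> H\<^sup>2 \<inter> H\<^sup>1\<^sub>0\<close> in terms of Borel functions \<open>u\<close>, \<open>w i\<close>, \<open>h i j\<close> representing \<open>v\<close> and its
  derivatives, extended by zero.\<close>

lemma sobolev_representatives:
  fixes v :: "real^'n \<Rightarrow> real"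
  assumes \<Omega>: "open \<Omega>" "bounded \<Omega>" and v: "v \<in> H2_space \<Omega>" "v \<in> H10_space \<Omega>"
  shows "\<exists>u w h \<phi>. L12 u \<and> (\<forall>x. x \<notin> \<Omega> \<longrightarrow> u x = 0) \<and> (AE x in lebesgue_on \<Omega>. v x = u x) \<and>
    (\<forall>i. L12 (w i)) \<and>
    (\<forall>i j. L12 (h i j) \<and> (\<forall>x. x \<notin> \<Omega> \<longrightarrow> h i j x = 0) \<and> (AE x in lebesgue_on \<Omega>. weak_hessian \<Omega> v x $ i $ j = h i j x) \<and>
      (\<forall>\<psi>\<in>test_functions \<Omega>. (LBINT x. w i x * partial j \<psi> x) = - (LBINT x. h i j x * \<psi> x))) \<and>
    (\<forall>k. \<phi> k \<in> test_functions \<Omega>) \<and> (\<lambda>k. l2 (\<lambda>x. \<phi> k x - u x)) \<longlonglongrightarrow> 0 \<and>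
    (\<forall>i. (\<lambda>k. l2 (\<lambda>x. partial i (\<phi> k) x - w i x)) \<longlonglongrightarrow> 0)"
proof -
  have \<Omega>b: "\<Omega> \<in> sets borel" "\<Omega> \<in> sets lebesgue" using \<Omega>(1) by auto
  have vL: "v \<in> L2_space \<Omega>" using v(1) by (simp add: H2_space_def)
  have "\<exists>b. L12 b \<and> (\<forall>x. x \<notin> \<Omega> \<longrightarrow> b x = 0) \<and> (AE x in lebesgue_on \<Omega>. v x = b x)"
    by (rule L2_representative[OF \<Omega> vL]) simp
  then obtain u where u: "L12 u" "\<And>x. x \<notin> \<Omega> \<Longrightarrow> u x = 0" "AE x in lebesgue_on \<Omega>. v x = u x"
    by blast
  let ?W = "\<lambda>i. weak_partial \<Omega> i v"
  have W: "has_weak_partial \<Omega> i v (?W i)" for i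
    using v(1) has_weak_partial_weak_partial unfolding H2_space_def by blast
  have exw: "\<exists>b. L12 b \<and> (\<forall>x. x \<notin> \<Omega> \<longrightarrow> b x = 0) \<and> (AE x in lebesgue_on \<Omega>. ?W i x = b x)" for i
  proof -
    obtain f where f: "f \<in> H1_space \<Omega>" "has_weak_partial \<Omega> i v f" using v(1) unfolding H2_space_def by blast
    then have "f \<in> L2_space \<Omega>" unfolding H1_space_def by blast
    then show ?thesis by (rule L2_representative[OF \<Omega> _ has_weak_partial_unique[OF \<Omega>(1) f(2) W[of i]]])
  qed
  then have "\<exists>w. \<forall>i. L12 (w i) \<and> (\<forall>x. x \<notin> \<Omega> \<longrightarrow> w i x = 0) \<and> (AE x in lebesgue_on \<Omega>. ?W i x = w i x)"
    by (intro choice allI)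
  then obtain w where w: "\<And>i. L12 (w i)" "\<And>i x. x \<notin> \<Omega> \<Longrightarrow> w i x = 0" "\<And>i. AE x in lebesgue_on \<Omega>. ?W i x = w i x"
    by blast
  \<comment> \<open>\<open>H2_space\<close> differentiates some weak derivative \<open>f\<close> of
    \<open>v\<close>, whereas \<open>weak_hessian\<close> differentiates the chosen
    \<open>?W i\<close>; both agree almost everywhere, so \<open>g\<close> is a derivative of
    either.\<close>
  have H: "has_weak_partial \<Omega> j (?W i) (weak_partial \<Omega> j (?W i)) \<and>
    (\<exists>b. L12 b \<and> (\<forall>x. x \<notin> \<Omega> \<longrightarrow> b x = 0) \<and> (AE x in lebesgue_on \<Omega>. weak_partial \<Omega> j (?W i) x = b x))" for i j
  proof -
    obtain f where f: "f \<in> H1_space \<Omega>" "has_weak_partial \<Omega> i v f" using v(1) unfolding H2_space_def by blast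
    obtain g where g: "g \<in> L2_space \<Omega>" "has_weak_partial \<Omega> j f g" using f(1) unfolding H1_space_def by blast
    have gW: "has_weak_partial \<Omega> j (?W i) g"
      using has_weak_partial_cong_AE[OF \<Omega>(1) g(2) has_weak_partial_unique[OF \<Omega>(1) f(2) W[of i]]] W[of i]
      by (simp add: has_weak_partial_def)
    then have WW: "has_weak_partial \<Omega> j (?W i) (weak_partial \<Omega> j (?W i))"
      by (rule has_weak_partial_weak_partial)
    from WW L2_representative[OF \<Omega> g(1) has_weak_partial_unique[OF \<Omega>(1) gW WW]] show ?thesis by (rule conjI)
  qed
  define Q where "Q i j b \<longleftrightarrow> L12 b \<and> (\<forall>x. x \<notin> \<Omega> \<longrightarrow> b x = 0) \<and> (AE x in lebesgue_on \<Omega>. weak_partial \<Omega> j (?W i) x = b x)" for i j b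
  have "\<exists>b. Q i j b" for i j using H unfolding Q_def by blast
  then have "\<exists>g. \<forall>j. Q i j (g j)" for i by (intro choice allI)
  then have "\<exists>h. \<forall>i j. Q i j (h i j)" by (intro choice[of "\<lambda>i g. \<forall>j. Q i j (g j)"] allI)
  then obtain h where "\<And>i j. Q i j (h i j)" by blast
  then have h: "L12 (h i j)" "x \<notin> \<Omega> \<Longrightarrow> h i j x = 0" "AE x in lebesgue_on \<Omega>. weak_partial \<Omega> j (?W i) x = h i j x" for i j x
    unfolding Q_def by blast+
  have weak: "(LBINT x. w i x * partial j \<psi> x) = - (LBINT x. h i j x * \<psi> x)"
    if \<psi>: "\<psi> \<in> test_functions \<Omega>" for i j \<psi>
  proof -
    have m: "\<psi> \<in> borel_measurable borel" "partial j \<psi> \<in> borel_measurable borel"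
      by (intro borel_measurable_smooth smooth_partial test_functionsD(1)[OF \<psi>])+
    have "(LBINT x. w i x * partial j \<psi> x) = (LINT x|lebesgue_on \<Omega>. ?W i x * partial j \<psi> x)"
      by (rule integral_representative[OF \<Omega>(1) L12_measurable[OF w(1)] w(2) w(3) m(2), symmetric])
    also have "\<dots> = - (LINT x|lebesgue_on \<Omega>. weak_partial \<Omega> j (?W i) x * \<psi> x)"
      using H[of j i] \<psi> unfolding has_weak_partial_def by blast
    also have "(LINT x|lebesgue_on \<Omega>. weak_partial \<Omega> j (?W i) x * \<psi> x) = (LBINT x. h i j x * \<psi> x)"
      by (rule integral_representative[OF \<Omega>(1) L12_measurable[OF h(1)] h(2) h(3) m(1)])
    finally show ?thesis .
  qed
  obtain \<phi> where \<phi>: "\<And>k. \<phi> k \<in> test_functions \<Omega>" "(\<lambda>k. H1_norm \<Omega> (\<lambda>x. \<phi> k x - v x)) \<longlonglongrightarrow> 0"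
    using v(2) unfolding H10_space_def by blast
  have l2_eq: "l2 f = sqrt (LINT x|lebesgue_on \<Omega>. (g x)\<^sup>2)"
    if "f \<in> borel_measurable borel" "\<And>x. x \<notin> \<Omega> \<Longrightarrow> f x = 0" "AE x in lebesgue_on \<Omega>. g x = f x" for f g :: "real^'n \<Rightarrow> real"
  proof -
    have "AE x in lebesgue_on \<Omega>. (g x)\<^sup>2 = (f x)\<^sup>2" using that(3) by eventually_elim simp
    from integral_representative[OF \<Omega>(1) _ _ this, of "\<lambda>_. 1"]
    show ?thesis unfolding l2_def using that by simp
  qed
  have nn: "(LINT x|lebesgue_on \<Omega>. (f x)\<^sup>2) \<ge> 0" for f :: "real^'n \<Rightarrow> real" by simp
  have le1: "l2 (\<lambda>x. \<phi> k x - u x) \<le> H1_norm \<Omega> (\<lambda>x. \<phi> k x - v x)" for k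
  proof -
    have "l2 (\<lambda>x. \<phi> k x - u x) = sqrt (LINT x|lebesgue_on \<Omega>. (\<phi> k x - v x)\<^sup>2)"
    proof (rule l2_eq)
      show "(\<lambda>x. \<phi> k x - u x) \<in> borel_measurable borel"
        by (intro borel_measurable_diff borel_measurable_smooth test_functionsD(1)[OF \<phi>(1)] L12_measurable u)
      show "AE x in lebesgue_on \<Omega>. \<phi> k x - v x = \<phi> k x - u x" using u(3) by eventually_elim simp
    qed (use test_functionsD(3)[OF \<phi>(1)] u(2) in simp)
    also have "\<dots> \<le> H1_norm \<Omega> (\<lambda>x. \<phi> k x - v x)"
      unfolding H1_norm_def by (intro real_sqrt_le_mono) (simp add: sum_nonneg)
    finally show ?thesis .
  qed
  \<comment> \<open>\<open>H1_norm\<close> involves the chosen weak derivative of the difference; by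
    uniqueness it is almost everywhere the classical derivative of \<open>\<phi> k\<close> minus
    \<open>w i\<close>.\<close>
  have le2: "l2 (\<lambda>x. partial i (\<phi> k) x - w i x) \<le> H1_norm \<Omega> (\<lambda>x. \<phi> k x - v x)" for i k
  proof -
    let ?D = "weak_partial \<Omega> i (\<lambda>x. \<phi> k x - v x)"
    have d: "has_weak_partial \<Omega> i (\<lambda>x. \<phi> k x - v x) (\<lambda>x. partial i (\<phi> k) x - ?W i x)"
      by (rule has_weak_partial_diff[OF \<Omega>(1) has_weak_partial_test_function[OF \<Omega>(1) \<phi>(1)] W])
    then have D: "has_weak_partial \<Omega> i (\<lambda>x. \<phi> k x - v x) ?D"
      by (rule has_weak_partial_weak_partial)
    have "l2 (\<lambda>x. partial i (\<phi> k) x - w i x) = sqrt (LINT x|lebesgue_on \<Omega>. (?D x)\<^sup>2)"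
    proof (rule l2_eq)
      show "(\<lambda>x. partial i (\<phi> k) x - w i x) \<in> borel_measurable borel"
        by (intro borel_measurable_diff borel_measurable_smooth smooth_partial test_functionsD(1)[OF \<phi>(1)] L12_measurable w)
      show "AE x in lebesgue_on \<Omega>. ?D x = partial i (\<phi> k) x - w i x"
        using has_weak_partial_unique[OF \<Omega>(1) D d] w(3)[of i] by eventually_elim simp
    qed (use test_functionsD(3)[OF test_functions_partial[OF \<phi>(1)]] w(2) in simp)
    also have "\<dots> \<le> H1_norm \<Omega> (\<lambda>x. \<phi> k x - v x)"
      unfolding H1_norm_def
    proof (intro real_sqrt_le_mono)
      have "(LINT x|lebesgue_on \<Omega>. (?D x)\<^sup>2) \<le> (\<Sum>i\<in>UNIV. LINT x|lebesgue_on \<Omega>. (weak_partial \<Omega> i (\<lambda>x. \<phi> k x - v x) x)\<^sup>2)"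
        by (rule member_le_sum[of i UNIV "\<lambda>i. LINT x|lebesgue_on \<Omega>. (weak_partial \<Omega> i (\<lambda>x. \<phi> k x - v x) x)\<^sup>2"]) auto
      then show "(LINT x|lebesgue_on \<Omega>. (?D x)\<^sup>2) \<le> (LINT x|lebesgue_on \<Omega>. (\<phi> k x - v x)\<^sup>2) +
          (\<Sum>i\<in>UNIV. LINT x|lebesgue_on \<Omega>. (weak_partial \<Omega> i (\<lambda>x. \<phi> k x - v x) x)\<^sup>2)"
        using nn[of "\<lambda>x. \<phi> k x - v x"] by linarith
    qed
    finally show ?thesis .
  qed
  have "(\<lambda>k. l2 (\<lambda>x. \<phi> k x - u x)) \<longlonglongrightarrow> 0"
    by (rule tendsto_sandwich[OF _ _ tendsto_const \<phi>(2)]) (auto simp: l2_nonneg le1)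
  moreover have "(\<lambda>k. l2 (\<lambda>x. partial i (\<phi> k) x - w i x)) \<longlonglongrightarrow> 0" for i
    by (rule tendsto_sandwich[OF _ _ tendsto_const \<phi>(2)]) (auto simp: l2_nonneg le2)
  moreover have "AE x in lebesgue_on \<Omega>. weak_hessian \<Omega> v x $ i $ j = h i j x" for i j
    using h(3)[of j i] by (simp add: weak_hessian_def)
  ultimately have "L12 u \<and> (\<forall>x. x \<notin> \<Omega> \<longrightarrow> u x = 0) \<and> (AE x in lebesgue_on \<Omega>. v x = u x) \<and>
    (\<forall>i. L12 (w i)) \<and>
    (\<forall>i j. L12 (h i j) \<and> (\<forall>x. x \<notin> \<Omega> \<longrightarrow> h i j x = 0) \<and> (AE x in lebesgue_on \<Omega>. weak_hessian \<Omega> v x $ i $ j = h i j x) \<and>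
      (\<forall>\<psi>\<in>test_functions \<Omega>. (LBINT x. w i x * partial j \<psi> x) = - (LBINT x. h i j x * \<psi> x))) \<and>
    (\<forall>k. \<phi> k \<in> test_functions \<Omega>) \<and> (\<lambda>k. l2 (\<lambda>x. \<phi> k x - u x)) \<longlonglongrightarrow> 0 \<and>
    (\<forall>i. (\<lambda>k. l2 (\<lambda>x. partial i (\<phi> k) x - w i x)) \<longlonglongrightarrow> 0)"
    using u w(1) h(1,2) weak \<phi>(1) by (intro conjI allI impI ballI)
  then show ?thesis by (intro exI)
qed

section \<open>Kato's inequality\<close>

lemma lipschitz_of_deriv_bounded:
  fixes f :: "real \<Rightarrow> real"
  assumes "\<And>t. (f has_real_derivative f' t) (at t)" "\<And>t. \<bar>f' t\<bar> \<le> C"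
  shows "\<bar>f s - f t\<bar> \<le> C * \<bar>s - t\<bar>"
  using field_differentiable_bound[of UNIV f f' C s t] assms by simp

lemma L12_bounded_mult:
  assumes "L12 F" "g \<in> borel_measurable borel" "\<And>x. \<bar>g x\<bar> \<le> C"
  shows "L12 (\<lambda>x. g x * F x)" "l2 (\<lambda>x. g x * F x) \<le> C * l2 F"
proof -
  have C: "C \<ge> 0" using assms(3)[of undefined] by linarith
  have le: "\<bar>g x * F x\<bar> \<le> \<bar>C * F x\<bar>" for x
    using assms(3)[of x] C by (simp add: abs_mult mult_right_mono)
  show "L12 (\<lambda>x. g x * F x)"
    by (rule L12_bound[OF L12_cmult[OF assms(1)] _ le]) (intro borel_measurable_times assms(2) L12_measurable[OF assms(1)])
  have "l2 (\<lambda>x. g x * F x) \<le> l2 (\<lambda>x. C * F x)" by (rule l2_mono[OF L12_cmult[OF assms(1)] le])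
  then show "l2 (\<lambda>x. g x * F x) \<le> C * l2 F" using C by (simp add: l2_cmult)
qed

lemma tendsto_integral_mult:
  assumes "\<And>k. L12 (f k)" "L12 g" "L12 F" "(\<lambda>k. l2 (\<lambda>x. f k x - g x)) \<longlonglongrightarrow> 0"
  shows "(\<lambda>k. LBINT x. f k x * F x) \<longlonglongrightarrow> (LBINT x. g x * F x)"
proof -
  have le: "\<bar>(LBINT x. f k x * F x) - (LBINT x. g x * F x)\<bar> \<le> l2 (\<lambda>x. f k x - g x) * l2 F" for k
    using cauchy_schwarz_l2[OF L12_diff[OF assms(1)[of k] assms(2)] assms(3)] L12_mult[OF assms(1)[of k] assms(3)] L12_mult[OF assms(2,3)]
    by (simp add: left_diff_distrib)
  have lim: "(\<lambda>k. l2 (\<lambda>x. f k x - g x) * l2 F) \<longlonglongrightarrow> 0" using tendsto_mult_right[OF assms(4), of "l2 F"] by simp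
  have "(\<lambda>k. (LBINT x. f k x * F x) - (LBINT x. g x * F x)) \<longlonglongrightarrow> 0"
    by (rule Lim_null_comparison[OF always_eventually lim]) (unfold real_norm_def, intro allI le)
  then show ?thesis by (rule LIM_zero_cancel)
qed

lemma tendsto_l2_lipschitz:
  fixes r :: "real \<Rightarrow> real"
  assumes "\<And>k. L12 (f k)" "L12 g" "(\<lambda>k. l2 (\<lambda>x. f k x - g x)) \<longlonglongrightarrow> 0"
    and lip: "\<And>s t. \<bar>r s - r t\<bar> \<le> C * \<bar>s - t\<bar>"
  shows "(\<lambda>k. l2 (\<lambda>x. r (f k x) - r (g x))) \<longlonglongrightarrow> 0"
proof (rule tendsto_sandwich[OF _ _ tendsto_const])
  have C: "C \<ge> 0" using lip[of 1 0] by (simp add: order_trans[OF abs_ge_zero])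
  show "(\<lambda>k. C * l2 (\<lambda>x. f k x - g x)) \<longlonglongrightarrow> 0" using tendsto_mult_left[OF assms(3), of C] by simp
  have "l2 (\<lambda>x. r (f k x) - r (g x)) \<le> l2 (\<lambda>x. C * (f k x - g x))" for k
    by (rule l2_mono[OF L12_cmult[OF L12_diff[OF assms(1,2)]]]) (use lip C in \<open>simp add: abs_mult\<close>)
  then show "\<forall>\<^sub>F k in sequentially. l2 (\<lambda>x. r (f k x) - r (g x)) \<le> C * l2 (\<lambda>x. f k x - g x)"
    using C by (simp add: l2_cmult)
qed (simp add: l2_nonneg)

lemma L12_lipschitz:
  fixes r :: "real \<Rightarrow> real"
  assumes "L12 f" "r 0 = 0" "\<And>s t. \<bar>r s - r t\<bar> \<le> C * \<bar>s - t\<bar>" "r \<in> borel_measurable borel"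
  shows "L12 (\<lambda>x. r (f x))"
proof (rule L12_bound[OF L12_cmult[OF assms(1), of C]])
  show "(\<lambda>x. r (f x)) \<in> borel_measurable borel"
    using assms(4) L12_measurable[OF assms(1)] by measurable
  show "\<bar>r (f x)\<bar> \<le> \<bar>C * f x\<bar>" for x
    using assms(3)[of "f x" 0] assms(2) by (simp add: abs_mult) (meson abs_ge_self mult_right_mono abs_ge_zero order_trans)
qed

lemma integral_sum_sum:
  fixes F :: "'a \<Rightarrow> 'b \<Rightarrow> 'c \<Rightarrow> real"
  assumes "\<And>i j. integrable M (F i j)"
  shows "(LINT x|M. (\<Sum>i\<in>A. \<Sum>j\<in>B. F i j x)) = (\<Sum>i\<in>A. \<Sum>j\<in>B. LINT x|M. F i j x)"
  using assms by (simp add: Bochner_Integration.integral_sum Bochner_Integration.integrable_sum)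

text \<open>The smooth convex function \<open>\<beta>(t) = ramp (-t)\<close> vanishes exactly for \<open>t \<ge> 0\<close>; its derivatives are
  \<open>-flat [:1,1:] (-t)\<close> and \<open>flat [:0,0,0,1:] (-t) \<ge> 0\<close>.\<close>

lemma kato_inequality:
  fixes u :: "real^'n \<Rightarrow> real"
  assumes u: "L12 u" and w: "\<And>i. L12 (w i)" and h: "\<And>i j. L12 (h i j)"
    and weak: "\<And>i j \<psi>. \<psi> \<in> test_functions \<Omega> \<Longrightarrow>
      (LBINT x. w i x * partial j \<psi> x) = - (LBINT x. h i j x * \<psi> x)"
    and \<phi>: "\<And>k. \<phi> k \<in> test_functions \<Omega>" "(\<lambda>k. l2 (\<lambda>x. \<phi> k x - u x)) \<longlonglongrightarrow> 0"
      "\<And>i. (\<lambda>k. l2 (\<lambda>x. partial i (\<phi> k) x - w i x)) \<longlonglongrightarrow> 0"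
    and \<eta>: "csmooth \<eta>" "\<And>x. \<eta> x \<ge> 0"
  shows "(LBINT x. (- flat [:1,1:] (- u x)) * ((\<Sum>i\<in>UNIV. \<Sum>j\<in>UNIV. \<xi> $ i * \<xi> $ j * h i j x) * \<eta> x)) \<le>
    (LBINT x. ramp (- u x) * (\<Sum>i\<in>UNIV. \<Sum>j\<in>UNIV. \<xi> $ i * \<xi> $ j * partial i (partial j \<eta>) x))"
proof -
  define b b' b'' where "b t = ramp (- t)" and "b' t = - flat [:1,1:] (- t)" and "b'' t = flat [:0,0,0,1:] (- t)" for t
  have db: "(b has_real_derivative b' t) (at t)" for t
    unfolding b_def[abs_def] b'_def
    by (rule DERIV_cong[OF DERIV_chain2[OF ramp_has_derivative DERIV_minus[OF DERIV_ident]]]) simp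
  have db': "(b' has_real_derivative b'' t) (at t)" for t
    unfolding b'_def[abs_def] b''_def
    by (rule DERIV_cong[OF DERIV_minus[OF DERIV_chain2[OF flat_has_derivative_ramp DERIV_minus[OF DERIV_ident]]]]) simp
  have db'': "(b'' has_real_derivative - flat ([:0,0,1:] * ([:0,0,0,1:] - pderiv [:0,0,0,1:])) (- t)) (at t)" for t
    unfolding b''_def[abs_def]
    by (rule DERIV_cong[OF DERIV_chain2[OF flat_has_derivative DERIV_minus[OF DERIV_ident]]]) simp
  have sm_neg: "smooth1 (\<lambda>t. flat p (- t))" for p
    unfolding smooth1_def
  proof (intro exI conjI allI)
    let ?D = "\<lambda>n t. (-1) ^ n * flat (((\<lambda>p. [:0,0,1:] * (p - pderiv p)) ^^ n) p) (- t)"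
    show "?D 0 = (\<lambda>t. flat p (- t))" by simp
    show "(?D n has_real_derivative ?D (Suc n) x) (at x)" for n x
      unfolding funpow.simps comp_apply power_Suc
      by (rule DERIV_cong[OF DERIV_cmult[OF DERIV_chain2[OF flat_has_derivative DERIV_minus[OF DERIV_ident]]]]) simp
  qed
  have sb'': "smooth1 b''" unfolding b''_def[abs_def] by (rule sm_neg)
  have sb': "smooth1 b'" by (rule smooth1I[OF db' sb''])
  have sb: "smooth1 b" by (rule smooth1I[OF db sb'])
  have b0: "b 0 = 0" "b' 0 = 0" "b'' 0 = 0" by (simp_all add: b_def b'_def b''_def ramp_def)
  have b''0: "b'' t \<ge> 0" for t unfolding b''_def by (rule flat_nonneg) simp
  obtain C1 where C1: "\<And>t. \<bar>b' t\<bar> \<le> C1" using flat_bounded[of "[:1,1:]"] by (auto simp: b'_def)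
  obtain C2 where C2: "\<And>t. \<bar>b'' t\<bar> \<le> C2" using flat_bounded[of "[:0,0,0,1:]"] by (auto simp: b''_def)
  have lipb: "\<bar>b s - b t\<bar> \<le> C1 * \<bar>s - t\<bar>" for s t by (rule lipschitz_of_deriv_bounded[OF db C1])
  have lipb': "\<bar>b' s - b' t\<bar> \<le> C2 * \<bar>s - t\<bar>" for s t by (rule lipschitz_of_deriv_bounded[OF db' C2])
  have mb: "b \<in> borel_measurable borel" "b' \<in> borel_measurable borel" "b'' \<in> borel_measurable borel"
    by (intro borel_measurable_continuous_onI smooth1_continuous sb sb' sb'')+
  \<comment> \<open>Everything is reduced to the single direction \<xi>: \<open>D\<close>
    differentiates along it, while \<open>W\<close> and \<open>H\<close> are the first and second
    weak derivatives of \<open>u\<close> along it.\<close>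
  define D where "D f x = (\<Sum>i\<in>UNIV. \<xi> $ i * partial i f x)" for f :: "real^'n \<Rightarrow> real" and x
  define D2 where "D2 x = (\<Sum>i\<in>UNIV. \<Sum>j\<in>UNIV. \<xi> $ i * \<xi> $ j * partial i (partial j \<eta>) x)" for x
  define W where "W x = (\<Sum>i\<in>UNIV. \<xi> $ i * w i x)" for x
  define H where "H x = (\<Sum>i\<in>UNIV. \<Sum>j\<in>UNIV. \<xi> $ i * \<xi> $ j * h i j x)" for x
  have LW: "L12 W" unfolding W_def[abs_def] by (intro L12_sum L12_cmult w)
  have LH: "L12 H" unfolding H_def[abs_def] by (intro L12_sum L12_cmult h)
  have csD: "csmooth (D f)" if "csmooth f" for f
    unfolding D_def[abs_def] by (intro csmooth_sum csmooth_mult1 smooth_const csmooth_partial that)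
  have csD2: "csmooth D2"
    unfolding D2_def[abs_def] by (intro csmooth_sum csmooth_mult1[OF smooth_const] csmooth_partial \<eta>)
  note s\<eta> = csmooth_imp_smooth[OF \<eta>(1)]
  have s\<phi>: "smooth (\<phi> k)" "csmooth (\<phi> k)" for k using test_functionsD[OF \<phi>(1)] by auto
  define e where "e k x = D (\<phi> k) x - W x" for k x
  have Le: "L12 (e k)" for k
    unfolding e_def[abs_def] by (intro L12_diff LW csmooth_L12 csD s\<phi>)
  have e0: "(\<lambda>k. l2 (e k)) \<longlonglongrightarrow> 0"
  proof (rule tendsto_sandwich[OF _ _ tendsto_const])
    have L: "L12 (\<lambda>x. partial i (\<phi> k) x - w i x)" for i k
      by (intro L12_diff w csmooth_L12 csmooth_partial s\<phi>)
    have "e k = (\<lambda>x. \<Sum>i\<in>UNIV. \<xi> $ i * (partial i (\<phi> k) x - w i x))" for k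
      by (simp add: e_def D_def W_def right_diff_distrib sum_subtractf fun_eq_iff)
    then have "l2 (e k) \<le> (\<Sum>i\<in>UNIV. \<bar>\<xi> $ i\<bar> * l2 (\<lambda>x. partial i (\<phi> k) x - w i x))" for k
      using l2_sum_le[of UNIV "\<lambda>i x. \<xi> $ i * (partial i (\<phi> k) x - w i x)"] L12_cmult[OF L] by (simp add: l2_cmult)
    then show "\<forall>\<^sub>F k in sequentially. l2 (e k) \<le> (\<Sum>i\<in>UNIV. \<bar>\<xi> $ i\<bar> * l2 (\<lambda>x. partial i (\<phi> k) x - w i x))"
      by simp
    have "(\<lambda>k. \<Sum>i\<in>UNIV. \<bar>\<xi> $ i\<bar> * l2 (\<lambda>x. partial i (\<phi> k) x - w i x)) \<longlonglongrightarrow> (\<Sum>i\<in>(UNIV::'n set). \<bar>\<xi> $ i\<bar> * 0)"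
      by (intro tendsto_sum tendsto_mult tendsto_const \<phi>(3))
    then show "(\<lambda>k. \<Sum>i\<in>UNIV. \<bar>\<xi> $ i\<bar> * l2 (\<lambda>x. partial i (\<phi> k) x - w i x)) \<longlonglongrightarrow> 0" by simp
  qed (simp add: l2_nonneg)
  have bk: "(\<lambda>x. b (\<phi> k x)) \<in> test_functions \<Omega>" for k
    using test_functions_compose[OF \<phi>(1) sb b0(1) smooth_const[of 1]] by simp
  \<comment> \<open>Although \<eta> may reach beyond \<Omega>, this is a test function on \<Omega>:
    \<open>b' 0 = 0\<close> and \<open>\<phi> k\<close> has compact support there. This is how the
    zero boundary values eliminate boundary terms.\<close>
  define \<psi> where "\<psi> k x = b' (\<phi> k x) * \<eta> x" for k x
  have \<psi>: "\<psi> k \<in> test_functions \<Omega>" for k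
    unfolding \<psi>_def[abs_def] by (rule test_functions_compose[OF \<phi>(1) sb' b0(2) s\<eta>])
  have D\<psi>: "D (\<psi> k) x = b' (\<phi> k x) * D \<eta> x + \<eta> x * b'' (\<phi> k x) * D (\<phi> k) x" for k x
  proof -
    have "partial i (\<psi> k) x = b' (\<phi> k x) * partial i \<eta> x + b'' (\<phi> k x) * partial i (\<phi> k) x * \<eta> x" for i
      unfolding \<psi>_def[abs_def]
      by (simp add: partial_mult[OF smooth_compose1[OF sb' s\<phi>(1)] s\<eta>] partial_compose1[OF db' s\<phi>(1)])
    then show ?thesis
      unfolding D_def sum_distrib_left sum.distrib[symmetric] by (intro sum.cong) (auto simp: algebra_simps)
  qed
  have I: "(LBINT x. b (\<phi> k x) * D2 x) = - (LBINT x. b' (\<phi> k x) * D (\<phi> k) x * D \<eta> x)" for k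
  proof -
    have cb: "csmooth (\<lambda>x. b (\<phi> k x))" by (rule test_functionsD(2)[OF bk])
    have ci: "integrable lborel (\<lambda>x. \<xi> $ i * \<xi> $ j * (b (\<phi> k x) * partial i (partial j \<eta>) x))"
      "integrable lborel (\<lambda>x. \<xi> $ i * \<xi> $ j * (partial i (\<lambda>x. b (\<phi> k x)) x * partial j \<eta> x))" for i j
      by (intro integrable_mult_right csmooth_integrable csmooth_mult2 cb csmooth_partial smooth_partial s\<eta>)+
    have "(LBINT x. b (\<phi> k x) * D2 x) =
        (LBINT x. (\<Sum>i\<in>UNIV. \<Sum>j\<in>UNIV. \<xi> $ i * \<xi> $ j * (b (\<phi> k x) * partial i (partial j \<eta>) x)))"
      unfolding D2_def sum_distrib_left by (simp only: mult_ac)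
    also have "\<dots> = (\<Sum>i\<in>UNIV. \<Sum>j\<in>UNIV. \<xi> $ i * \<xi> $ j * (LBINT x. b (\<phi> k x) * partial i (partial j \<eta>) x))"
      unfolding integral_sum_sum[OF ci(1)] integral_mult_right_zero ..
    also have "\<dots> = (\<Sum>i\<in>UNIV. \<Sum>j\<in>UNIV. \<xi> $ i * \<xi> $ j * - (LBINT x. partial i (\<lambda>x. b (\<phi> k x)) x * partial j \<eta> x))"
      by (simp only: integral_by_parts[OF cb smooth_partial[OF s\<eta>]])
    also have "\<dots> = - (LBINT x. (\<Sum>i\<in>UNIV. \<Sum>j\<in>UNIV. \<xi> $ i * \<xi> $ j * (partial i (\<lambda>x. b (\<phi> k x)) x * partial j \<eta> x)))"
      unfolding integral_sum_sum[OF ci(2)] integral_mult_right_zero by (simp add: sum_negf)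
    also have "\<dots> = - (LBINT x. b' (\<phi> k x) * D (\<phi> k) x * D \<eta> x)"
      unfolding D_def mult.assoc sum_product partial_compose1[OF db s\<phi>(1)]
      by (simp only: sum_distrib_left mult_ac)
    finally show ?thesis .
  qed
  have II: "(LBINT x. W x * D (\<psi> k) x) = - (LBINT x. H x * \<psi> k x)" for k
  proof -
    have c\<psi>: "csmooth (\<psi> k)" by (rule test_functionsD(2)[OF \<psi>])
    have ci: "integrable lborel (\<lambda>x. \<xi> $ i * \<xi> $ j * (w i x * partial j (\<psi> k) x))"
      "integrable lborel (\<lambda>x. \<xi> $ i * \<xi> $ j * (h i j x * \<psi> k x))" for i j
      by (intro integrable_mult_right L12_mult w h csmooth_L12 csmooth_partial c\<psi>)+
    have "(LBINT x. W x * D (\<psi> k) x) =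
        (LBINT x. (\<Sum>i\<in>UNIV. \<Sum>j\<in>UNIV. \<xi> $ i * \<xi> $ j * (w i x * partial j (\<psi> k) x)))"
      unfolding W_def D_def sum_product by (simp only: mult_ac)
    also have "\<dots> = (\<Sum>i\<in>UNIV. \<Sum>j\<in>UNIV. \<xi> $ i * \<xi> $ j * (LBINT x. w i x * partial j (\<psi> k) x))"
      unfolding integral_sum_sum[OF ci(1)] integral_mult_right_zero ..
    also have "\<dots> = (\<Sum>i\<in>UNIV. \<Sum>j\<in>UNIV. \<xi> $ i * \<xi> $ j * - (LBINT x. h i j x * \<psi> k x))"
      by (simp only: weak[OF \<psi>])
    also have "\<dots> = - (LBINT x. (\<Sum>i\<in>UNIV. \<Sum>j\<in>UNIV. \<xi> $ i * \<xi> $ j * (h i j x * \<psi> k x)))"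
      unfolding integral_sum_sum[OF ci(2)] integral_mult_right_zero by (simp add: sum_negf)
    also have "\<dots> = - (LBINT x. H x * \<psi> k x)"
      unfolding H_def sum_distrib_right by (simp only: mult.assoc)
    finally show ?thesis .
  qed
  obtain B where B: "B > 0" "\<And>x. \<bar>\<eta> x\<bar> \<le> B" using csmooth_bounded[OF \<eta>(1)] by auto
  define K where "K = C1 * l2 (D \<eta>) + B * C2 * l2 W"
  have main: "(LBINT x. b' (\<phi> k x) * (H x * \<eta> x)) \<le> (LBINT x. b (\<phi> k x) * D2 x) + K * l2 (e k)" for k
  proof -
    have m: "(\<lambda>x. b' (\<phi> k x)) \<in> borel_measurable borel" "(\<lambda>x. \<eta> x * b'' (\<phi> k x)) \<in> borel_measurable borel"
      using mb borel_measurable_smooth[OF s\<phi>(1)] borel_measurable_smooth[OF s\<eta>] by measurable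
    have C2': "\<bar>\<eta> x * b'' (\<phi> k x)\<bar> \<le> B * C2" for x
      unfolding abs_mult using B C2 by (intro mult_mono) auto
    let ?p = "\<lambda>x. b' (\<phi> k x) * D \<eta> x" and ?q = "\<lambda>x. \<eta> x * b'' (\<phi> k x) * W x" and ?t = "\<lambda>x. \<eta> x * b'' (\<phi> k x) * D (\<phi> k) x"
    have L: "L12 ?p" "l2 ?p \<le> C1 * l2 (D \<eta>)"
      by (rule L12_bounded_mult[OF csmooth_L12[OF csD[OF \<eta>(1)]] m(1) C1])+
    have Lq: "L12 ?q" "l2 ?q \<le> B * C2 * l2 W"
      by (rule L12_bounded_mult[OF LW m(2) C2'])+
    have Lt: "L12 ?t" by (rule L12_bounded_mult(1)[OF csmooth_L12[OF csD[OF s\<phi>(2)]] m(2) C2'])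
    have LD: "L12 (D (\<phi> k))" by (intro csmooth_L12 csD s\<phi>)
    have i: "integrable lborel (\<lambda>x. ?p x * D (\<phi> k) x)" "integrable lborel (\<lambda>x. W x * ?p x)" "integrable lborel (\<lambda>x. W x * ?t x)"
      by (intro L12_mult L Lt LD LW)+
    have "(LBINT x. H x * \<psi> k x) = - (LBINT x. W x * ?p x + W x * ?t x)"
      using II[of k] unfolding D\<psi> distrib_left by simp
    then have H: "(LBINT x. H x * \<psi> k x) = - (LBINT x. W x * ?p x) - (LBINT x. W x * ?t x)"
      using i by simp
    have bD: "(LBINT x. b (\<phi> k x) * D2 x) = - (LBINT x. ?p x * D (\<phi> k) x)"
      unfolding I by (simp only: mult_ac)
    have "(LBINT x. H x * \<psi> k x) - (LBINT x. b (\<phi> k x) * D2 x) =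
      (LBINT x. ?p x * D (\<phi> k) x - W x * ?p x - W x * ?t x)"
      unfolding H bD using i by simp
    \<comment> \<open>As \<open>D (\<phi> k) = W + e k\<close>, the two terms with \<open>?p\<close>
      leave \<open>?p * e k\<close>, and \<open>W * ?t\<close> is the sum of \<eta> b'' W^2 and
      \<open>?q * e k\<close>. Convexity of \<open>b\<close> allows the square to be dropped, and
      the rest is of order \<open>l2 (e k)\<close>.\<close>
    also have "\<dots> \<le> (LBINT x. ?p x * e k x - ?q x * e k x)"
    proof (rule integral_mono)
      show "integrable lborel (\<lambda>x. ?p x * D (\<phi> k) x - W x * ?p x - W x * ?t x)" using i by simp
      show "integrable lborel (\<lambda>x. ?p x * e k x - ?q x * e k x)"
        by (intro Bochner_Integration.integrable_diff L12_mult L Lq Le)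
      show "?p x * D (\<phi> k) x - W x * ?p x - W x * ?t x \<le> ?p x * e k x - ?q x * e k x" for x
      proof -
        have "0 \<le> \<eta> x * b'' (\<phi> k x) * (W x)\<^sup>2" using \<eta>(2) b''0 by simp
        then show ?thesis by (simp add: e_def algebra_simps power2_eq_square)
      qed
    qed
    also have "\<dots> = (LBINT x. ?p x * e k x) - (LBINT x. ?q x * e k x)"
      by (intro Bochner_Integration.integral_diff L12_mult L Lq Le)
    also have "\<dots> \<le> l2 ?p * l2 (e k) + l2 ?q * l2 (e k)"
      using cauchy_schwarz_l2[OF L(1) Le[of k]] cauchy_schwarz_l2[OF Lq(1) Le[of k]] by linarith
    also have "\<dots> \<le> C1 * l2 (D \<eta>) * l2 (e k) + B * C2 * l2 W * l2 (e k)"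
      by (intro add_mono mult_right_mono L Lq l2_nonneg)
    also have "\<dots> = K * l2 (e k)" by (simp add: K_def distrib_right)
    finally have "(LBINT x. H x * \<psi> k x) - (LBINT x. b (\<phi> k x) * D2 x) \<le> K * l2 (e k)" .
    moreover have "(LBINT x. H x * \<psi> k x) = (LBINT x. b' (\<phi> k x) * (H x * \<eta> x))"
      unfolding \<psi>_def by (simp only: mult_ac)
    ultimately show ?thesis by linarith
  qed
  have L\<phi>: "L12 (\<phi> k)" for k by (rule csmooth_L12[OF s\<phi>(2)])
  have LH\<eta>: "L12 (\<lambda>x. H x * \<eta> x)"
    using L12_bounded_mult(1)[OF LH borel_measurable_smooth[OF s\<eta>] B(2)] by (simp only: mult.commute)
  \<comment> \<open>Passing to the limit is possible because \<open>b\<close> and \<open>b'\<close>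
    are Lipschitz and vanish at 0, so composition with them preserves L2 convergence.\<close>
  have "(\<lambda>k. LBINT x. b' (\<phi> k x) * (H x * \<eta> x)) \<longlonglongrightarrow> (LBINT x. b' (u x) * (H x * \<eta> x))"
    by (intro tendsto_integral_mult LH\<eta> L12_lipschitz[OF _ b0(2) lipb' mb(2)] L\<phi> u tendsto_l2_lipschitz[OF L\<phi> u \<phi>(2) lipb'])
  moreover have "(\<lambda>k. (LBINT x. b (\<phi> k x) * D2 x) + K * l2 (e k)) \<longlonglongrightarrow> (LBINT x. b (u x) * D2 x) + K * 0"
    by (intro tendsto_add tendsto_mult tendsto_const e0 tendsto_integral_mult csmooth_L12 csD2
        L12_lipschitz[OF _ b0(1) lipb mb(1)] L\<phi> u tendsto_l2_lipschitz[OF L\<phi> u \<phi>(2) lipb])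
  ultimately have "(LBINT x. b' (u x) * (H x * \<eta> x)) \<le> (LBINT x. b (u x) * D2 x) + K * 0"
    using main by (intro LIMSEQ_le) auto
  then show ?thesis unfolding b_def b'_def H_def D2_def by simp
qed

section \<open>The maximum principle\<close>

text \<open>The multiple \<open>t / n\<^sup>2\<close> of \<open>A\<close> is the orthogonal
  projection of the identity onto the line of \<open>A\<close>, so \<open>- B\<close> is the
  component of the identity orthogonal to \<open>A\<close>. Its squared norm is d - t^2 / n^2, and
  the Cordes condition bounds this by 1 - \<epsilon>. Splitting the trace accordingly, the part
  along \<open>A\<close> has the sign of A : X, and Cauchy-Schwarz bounds the rest.\<close>

lemma trace_le_of_cordes:
  fixes A X :: "real^'n^'n"
  assumes A: "A \<in> cordes_class \<nu>\<^sub>l \<nu>\<^sub>u \<epsilon>" and \<nu>: "0 < \<nu>\<^sub>l" and \<epsilon>: "0 < \<epsilon>" "\<epsilon> \<le> 1" and X: "A \<bullet> X \<le> 0"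
  shows "trace X \<le> sqrt (1 - \<epsilon>) * norm X"
proof -
  let ?d = "real CARD('n)"
  let ?I = "mat 1 :: real^'n^'n"
  define n t where "n = norm A" and "t = trace A"
  have d: "?d \<ge> 1" by (simp add: Suc_leI)
  \<comment> \<open>Positivity of the trace must come from ellipticity: with trace zero the quotient
    in \<open>cordes_class\<close> would be 0 by convention and the condition void.\<close>
  have "A $ i $ i \<ge> \<nu>\<^sub>l" for i
  proof -
    have "\<nu>\<^sub>l * (norm (axis i (1::real) :: real^'n))\<^sup>2 \<le> axis i 1 \<bullet> (A *v axis i 1)"
      using A unfolding cordes_class_def by blast
    then show ?thesis by (simp add: matrix_vector_mult_basis column_def inner_axis')
  qed
  then have "0 < A $ i $ i" for i using \<nu> by (meson less_le_trans)
  then have t: "t > 0" unfolding t_def trace_def by (intro sum_pos) auto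
  then have "A \<noteq> 0" by (auto simp: t_def trace_def)
  then have n: "n > 0" by (simp add: n_def)
  define s where "s = sqrt (?d - 1 + \<epsilon>)"
  have "?d - 1 + \<epsilon> > 0" using d \<epsilon> by linarith
  then have s: "s > 0" "s\<^sup>2 = ?d - 1 + \<epsilon>" by (simp_all add: s_def)
  have "n / t \<le> 1 / s" using A by (simp add: cordes_class_def n_def t_def s_def)
  then have "n * s \<le> t" using t s by (simp add: field_simps)
  then have "(n * s)\<^sup>2 \<le> t\<^sup>2" using n s by (intro power_mono) auto
  then have "?d - 1 + \<epsilon> \<le> t\<^sup>2 / n\<^sup>2" using n s(2) by (simp add: power_mult_distrib pos_le_divide_eq mult.commute)
  have inner_I: "Y \<bullet> ?I = trace Y" for Y :: "real^'n^'n"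
    by (simp add: inner_matrix_eq mat_def trace_def if_distrib[where f="\<lambda>a. _ * a"] cong: if_cong)
  define B where "B = (t / n\<^sup>2) *\<^sub>R A - ?I"
  have "(norm B)\<^sup>2 = (t / n\<^sup>2)\<^sup>2 * (A \<bullet> A) - 2 * (t / n\<^sup>2) * (A \<bullet> ?I) + ?I \<bullet> ?I"
    unfolding power2_norm_eq_inner B_def
    by (simp add: inner_diff_left inner_diff_right inner_commute power2_eq_square algebra_simps)
  also have "\<dots> = (t / n\<^sup>2)\<^sup>2 * n\<^sup>2 - 2 * (t / n\<^sup>2) * t + ?d"
    by (simp only: inner_I trace_mat_1 t_def n_def power2_norm_eq_inner)
  also have "\<dots> = ?d - t\<^sup>2 / n\<^sup>2"
    using n by (simp add: power2_eq_square field_simps)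
  also have "\<dots> \<le> 1 - \<epsilon>" using \<open>?d - 1 + \<epsilon> \<le> t\<^sup>2 / n\<^sup>2\<close> by linarith
  finally have B: "norm B \<le> sqrt (1 - \<epsilon>)" by (simp add: real_le_rsqrt)
  have "trace X = (t / n\<^sup>2) * (A \<bullet> X) - B \<bullet> X"
    unfolding B_def inner_diff_left inner_scaleR_left inner_commute[of ?I] inner_I by simp
  also have "\<dots> \<le> 0 + norm B * norm X"
  proof -
    have "(t / n\<^sup>2) * (A \<bullet> X) \<le> 0" using t n X by (intro mult_nonneg_nonpos) auto
    moreover have "\<bar>B \<bullet> X\<bar> \<le> norm B * norm X" by (rule Cauchy_Schwarz_ineq2)
    ultimately show ?thesis by linarith
  qed
  also have "\<dots> \<le> sqrt (1 - \<epsilon>) * norm X" using B by (simp add: mult_right_mono)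
  finally show ?thesis .
qed

section \<open>Mollified Hessians as tested quadratic forms\<close>

lemma reflect_has_derivative:
  fixes \<psi> :: "real^'n \<Rightarrow> real"
  assumes "smooth \<psi>"
  shows "((\<lambda>y. \<psi> (c - y)) has_derivative (\<lambda>h. \<Sum>i\<in>UNIV. - partial i \<psi> (c - y) * h $ i)) (at y)"
proof -
  have "((\<lambda>y. c - y) has_derivative (\<lambda>h. - h)) (at y)" by (auto intro!: derivative_eq_intros)
  from has_derivative_compose[OF this smooth_has_derivative[OF assms]] show ?thesis by simp
qed

lemma smooth_reflect:
  assumes "smooth \<psi>" shows "smooth (\<lambda>y. \<psi> (c - y))"
proof (rule smooth_coinduct[where X="\<lambda>f. \<exists>\<psi>. smooth \<psi> \<and> f = (\<lambda>y. \<psi> (c - y))"])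
  fix f :: "real^'a \<Rightarrow> real" assume "\<exists>\<psi>. smooth \<psi> \<and> f = (\<lambda>y. \<psi> (c - y))"
  then obtain \<psi> where \<psi>: "smooth \<psi>" "f = (\<lambda>y. \<psi> (c - y))" by blast
  have "smooth (\<lambda>z. - partial i \<psi> z)" for i
    using smooth_mult[OF smooth_const[of "-1"] smooth_partial[OF \<psi>(1), of i]] by simp
  then show "\<exists>g. (\<forall>x. (f has_derivative (\<lambda>h. \<Sum>i\<in>UNIV. g i x * h $ i)) (at x)) \<and>
      (\<forall>i. \<exists>\<psi>. smooth \<psi> \<and> g i = (\<lambda>y. \<psi> (c - y)))"
    using reflect_has_derivative[OF \<psi>(1)] \<psi>(2)
    by (intro exI[of _ "\<lambda>i y. - partial i \<psi> (c - y)"]) blast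
qed (use assms in blast)

lemma partial_reflect:
  "smooth \<psi> \<Longrightarrow> partial i (\<lambda>y. \<psi> (c - y)) = (\<lambda>y. - partial i \<psi> (c - y))"
  by (rule ext, rule partial_eqI, rule reflect_has_derivative)

lemma partial_partial_reflect:
  assumes "smooth \<psi>"
  shows "partial i (partial j (\<lambda>y. \<psi> (c - y))) = (\<lambda>y. partial i (partial j \<psi>) (c - y))"
proof -
  have "partial i (\<lambda>y. (-1) * partial j \<psi> (c - y)) = (\<lambda>y. (-1) * (- partial i (partial j \<psi>) (c - y)))"
    using assms by (simp only: partial_cmult[OF smooth_reflect[OF smooth_partial]] partial_reflect[OF smooth_partial])
  then show ?thesis using assms by (simp add: partial_reflect)
qed

lemma csmooth_reflect:
  assumes "csmooth \<psi>" shows "csmooth (\<lambda>y. \<psi> (c - y))"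
proof -
  obtain r where r: "\<And>x. r < norm x \<Longrightarrow> \<psi> x = 0" using assms by (auto simp: csmooth_def)
  have "\<psi> (c - y) = 0" if "norm c + r < norm y" for y
    using that norm_triangle_ineq2[of y c] by (intro r) (simp add: norm_minus_commute)
  then show ?thesis
    using smooth_reflect[OF csmooth_imp_smooth[OF assms]] by (auto simp: csmooth_def)
qed

text \<open>Rewrites the mollified Hessian as the right-hand side of \<open>kato_inequality\<close>
  with test function \<psi> (x - y) in the variable y. Two reflections of sign cancel in the second
  derivatives.\<close>

lemma quadratic_conv_hess:
  fixes U :: "real^'n \<Rightarrow> real"
  assumes "csmooth \<psi>" "integrable lborel U"
  shows "\<xi> \<bullet> (hess (conv \<psi> U) x *v \<xi>) =
    (LBINT y. U y * (\<Sum>i\<in>UNIV. \<Sum>j\<in>UNIV. \<xi> $ i * \<xi> $ j * partial i (partial j (\<lambda>y. \<psi> (x - y))) y))"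
proof -
  have c: "csmooth (partial i (partial j \<psi>))" for i j by (intro csmooth_partial assms)
  have "\<xi> \<bullet> (hess (conv \<psi> U) x *v \<xi>) =
      (\<Sum>i\<in>UNIV. \<Sum>j\<in>UNIV. LBINT y. \<xi> $ i * \<xi> $ j * (partial i (partial j \<psi>) (x - y) * U y))"
    unfolding inner_matrix_vector hess_nth integral_mult_right_zero
    using assms by (simp add: partial_conv csmooth_partial mult_ac) (simp add: conv_def mult_ac)
  also have "\<dots> = (LBINT y. (\<Sum>i\<in>UNIV. \<Sum>j\<in>UNIV. \<xi> $ i * \<xi> $ j * (partial i (partial j \<psi>) (x - y) * U y)))"
    by (rule integral_sum_sum[symmetric]) (intro integrable_mult_right integrable_conv c assms)
  finally show ?thesis
    unfolding partial_partial_reflect[OF csmooth_imp_smooth[OF assms(1)]] sum_distrib_left by (simp only: mult_ac)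
qed

lemma quadratic_conv_matrix:
  fixes S :: "real^'n \<Rightarrow> real^'n^'n"
  assumes "csmooth \<psi>" "\<And>i j. integrable lborel (\<lambda>y. S y $ i $ j)"
  shows "\<xi> \<bullet> ((\<chi> i j. conv \<psi> (\<lambda>y. S y $ i $ j) x) *v \<xi>) = (LBINT y. \<psi> (x - y) * (\<xi> \<bullet> (S y *v \<xi>)))"
proof -
  have "\<xi> \<bullet> ((\<chi> i j. conv \<psi> (\<lambda>y. S y $ i $ j) x) *v \<xi>) =
      (\<Sum>i\<in>UNIV. \<Sum>j\<in>UNIV. LBINT y. \<xi> $ i * \<xi> $ j * (\<psi> (x - y) * S y $ i $ j))"
    unfolding inner_matrix_vector integral_mult_right_zero by (simp add: conv_def mult_ac)
  also have "\<dots> = (LBINT y. (\<Sum>i\<in>UNIV. \<Sum>j\<in>UNIV. \<xi> $ i * \<xi> $ j * (\<psi> (x - y) * S y $ i $ j)))"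
    by (rule integral_sum_sum[symmetric]) (intro integrable_mult_right integrable_conv assms)
  finally show ?thesis unfolding inner_matrix_vector sum_distrib_left by (simp only: mult_ac)
qed

theorem theorem5p3:
  fixes \<Omega> :: "(real^'n) set"
    and \<nu>\<^sub>l \<nu>\<^sub>u \<epsilon> :: real
    and a :: "real^'n \<Rightarrow> real^'n^'n"
    and g v :: "real^'n \<Rightarrow> real"
  assumes "open \<Omega>" and "bounded \<Omega>" and "convex \<Omega>"
    and "0 < \<nu>\<^sub>l" and "\<nu>\<^sub>l \<le> \<nu>\<^sub>u" and "0 < \<epsilon>" and "\<epsilon> \<le> 1"
    and "a \<in> Linf_space \<Omega> sym_psd_matrices"
    and "AE x in lebesgue_on \<Omega>. a x \<in> cordes_class \<nu>\<^sub>l \<nu>\<^sub>u \<epsilon>"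
    and "g \<in> L2_space \<Omega>"
    and "strong_solution \<Omega> a g v"
    and "AE x in lebesgue_on \<Omega>. 0 \<le> g x"
  shows "AE x in lebesgue_on \<Omega>. 0 \<le> v x"
proof -
  define \<kappa> where "\<kappa> = sqrt (1 - \<epsilon>)"
  have \<kappa>: "0 \<le> \<kappa>" "\<kappa> < 1" using assms(6,7) by (auto simp: \<kappa>_def)
  have v: "v \<in> H2_space \<Omega>" "v \<in> H10_space \<Omega>"
    and eq: "AE x in lebesgue_on \<Omega>. - (a x \<bullet> weak_hessian \<Omega> v x) = g x"
    using assms(11) by (auto simp: strong_solution_def)
  obtain u w h \<phi> where u: "L12 u" "\<forall>x. x \<notin> \<Omega> \<longrightarrow> u x = 0" "AE x in lebesgue_on \<Omega>. v x = u x"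
    and w: "\<forall>i. L12 (w i)"
    and hh: "\<forall>i j. L12 (h i j) \<and> (\<forall>x. x \<notin> \<Omega> \<longrightarrow> h i j x = 0) \<and> (AE x in lebesgue_on \<Omega>. weak_hessian \<Omega> v x $ i $ j = h i j x) \<and>
      (\<forall>\<psi>\<in>test_functions \<Omega>. (LBINT x. w i x * partial j \<psi> x) = - (LBINT x. h i j x * \<psi> x))"
    and \<phi>: "\<forall>k. \<phi> k \<in> test_functions \<Omega>" "(\<lambda>k. l2 (\<lambda>x. \<phi> k x - u x)) \<longlonglongrightarrow> 0"
      "\<forall>i. (\<lambda>k. l2 (\<lambda>x. partial i (\<phi> k) x - w i x)) \<longlonglongrightarrow> 0"
    using sobolev_representatives[OF assms(1,2) v] by (elim exE conjE) (rule that)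
  have h: "L12 (h i j)" "x \<notin> \<Omega> \<Longrightarrow> h i j x = 0" "AE x in lebesgue_on \<Omega>. weak_hessian \<Omega> v x $ i $ j = h i j x" for i j x
    using hh by blast+
  have weak: "(LBINT x. w i x * partial j \<psi> x) = - (LBINT x. h i j x * \<psi> x)"
    if "\<psi> \<in> test_functions \<Omega>" for i j \<psi>
    using hh that by blast
  obtain R where R: "\<And>x. x \<in> \<Omega> \<Longrightarrow> norm x \<le> R" using assms(2) bounded_iff by blast
  \<comment> \<open>The maximum keeps the radius positive even for an empty domain.\<close>
  define R0 where "R0 = max R 1"
  have R0: "R0 > 0" by (simp add: R0_def)
  have out: "x \<notin> \<Omega>" if "R0 < norm x" for x using R[of x] that by (auto simp: R0_def)
  obtain C where C: "\<And>t. \<bar>flat [:1,1:] t\<bar> \<le> C" using flat_bounded by metis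
  define c where "c x = flat [:1,1:] (- u x)" for x
  have c: "c x \<ge> 0" for x unfolding c_def by (rule flat_nonneg) simp
  have mflat: "flat p \<in> borel_measurable borel" for p
    by (intro borel_measurable_continuous_onI smooth1_continuous smooth1_flat)
  have mc: "c \<in> borel_measurable borel"
    unfolding c_def[abs_def] using mflat L12_measurable[OF u(1)] by measurable
  \<comment> \<open>\<open>- c x\<close> is \<beta>'(u). The symmetric part of the Hessian is taken
    so that \<open>S0\<close> is symmetric by construction; quadratic forms and the pairing with a
    symmetric \<open>a x\<close> do not see the antisymmetric part.\<close>
  define S0 where "S0 x = (\<chi> i j. (- c x) * (1 / 2 * (h i j x + h j i x)))" for x
  have LS0: "L12 (\<lambda>x. S0 x $ i $ j)" for i j
    unfolding S0_def vec_lambda_beta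
  proof (rule L12_bounded_mult(1)[OF L12_cmult[OF L12_add[OF h(1) h(1)]]])
    show "(\<lambda>x. - c x) \<in> borel_measurable borel" using mc by measurable
    show "\<bar>- c x\<bar> \<le> C" for x using C by (simp add: c_def)
  qed
  have S0_out: "S0 x = 0" if "x \<notin> \<Omega>" for x using h(2)[OF that] by (simp add: S0_def vec_eq_iff)
  have S0_quad: "\<xi> \<bullet> (S0 x *v \<xi>) = (- c x) * (\<Sum>i\<in>UNIV. \<Sum>j\<in>UNIV. \<xi> $ i * \<xi> $ j * h i j x)" for \<xi> x
  proof -
    have "(\<Sum>i\<in>UNIV. \<Sum>j\<in>UNIV. \<xi> $ i * \<xi> $ j * h j i x) = (\<Sum>i\<in>UNIV. \<Sum>j\<in>UNIV. \<xi> $ i * \<xi> $ j * h i j x)"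
      by (subst sum.swap) (simp only: mult_ac)
    then have "(\<Sum>i\<in>UNIV. \<Sum>j\<in>UNIV. \<xi> $ i * \<xi> $ j * (1 / 2 * (h i j x + h j i x))) = (\<Sum>i\<in>UNIV. \<Sum>j\<in>UNIV. \<xi> $ i * \<xi> $ j * h i j x)"
      by (simp add: distrib_left sum.distrib sum_divide_distrib[symmetric])
    moreover have "\<xi> \<bullet> (S0 x *v \<xi>) = (- c x) * (\<Sum>i\<in>UNIV. \<Sum>j\<in>UNIV. \<xi> $ i * \<xi> $ j * (1 / 2 * (h i j x + h j i x)))"
      unfolding inner_matrix_vector S0_def vec_lambda_beta sum_distrib_left by (simp only: mult_ac)
    ultimately show ?thesis by simp
  qed
  \<comment> \<open>The sign condition holds only almost everywhere, while
    \<open>psd_hessian_imp_zero\<close> asks for it at every point; \<open>S\<close> is therefore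
    set to zero outside \<open>G\<close>.\<close>
  define G where "G = {x. 0 \<le> trace (S0 x) + \<kappa> * norm (S0 x)}"
  have mS0: "(\<lambda>x. S0 x $ i $ j) \<in> borel_measurable borel" for i j by (rule L12_measurable[OF LS0])
  have mG: "G \<in> sets borel"
    unfolding G_def trace_def norm_matrix_eq using mS0 by measurable
  have "AE x in lebesgue_on \<Omega>. \<forall>i j. weak_hessian \<Omega> v x $ i $ j = h i j x"
    by (subst AE_all_countable, intro allI, subst AE_all_countable, intro allI h(3))
  \<comment> \<open>The only place where the coefficient occurs: a : X = - g \<le> 0 and the Cordes
    condition are traded for an inequality in \<kappa>, and multiplication by \<open>- c x\<close>,
    which is nonpositive, reverses it.\<close>
  with eq assms(9,12) have "AE x in lebesgue_on \<Omega>. x \<in> G"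
  proof eventually_elim
    case (elim x)
    let ?W = "weak_hessian \<Omega> v x"
    let ?X = "\<chi> i j. 1 / 2 * (h i j x + h j i x)"
    have X: "?X = (1 / 2) *\<^sub>R (?W + transpose ?W)" using elim(4) by (simp add: vec_eq_iff transpose_def)
    have "transpose (a x) = a x" using elim(2) by (auto simp: cordes_class_def sym_psd_matrices_def)
    then have sym: "a x $ i $ j = a x $ j $ i" for i j by (metis transpose_def vec_lambda_beta)
    have "a x \<bullet> transpose ?W = a x \<bullet> ?W"
      unfolding inner_matrix_eq transpose_def vec_lambda_beta
      by (subst sum.swap) (simp only: sym)
    then have "a x \<bullet> ?X = a x \<bullet> ?W" unfolding X inner_scaleR_right inner_add_right by simp
    then have "a x \<bullet> ?X \<le> 0" using elim(1,3) by linarith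
    from trace_le_of_cordes[OF elim(2) assms(4,6,7) this]
    have "trace ?X \<le> \<kappa> * norm ?X" unfolding \<kappa>_def .
    then have "0 \<le> c x * (\<kappa> * norm ?X - trace ?X)" using c by (intro mult_nonneg_nonneg) auto
    moreover have "S0 x = (- c x) *\<^sub>R ?X" by (simp add: S0_def vec_eq_iff)
    then have "trace (S0 x) = - c x * trace ?X" "norm (S0 x) = c x * norm ?X"
      using c[of x] by (simp_all only: trace_scaleR norm_scaleR abs_minus_cancel abs_of_nonneg)
    ultimately show ?case by (simp add: G_def algebra_simps)
  qed
  then have "AE x in lebesgue. x \<in> \<Omega> \<longrightarrow> x \<in> G" using assms(1) by (simp add: AE_restrict_space_iff)
  moreover have "x \<in> G" if "x \<notin> \<Omega>" for x using S0_out[OF that] \<kappa> by (simp add: G_def trace_def)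
  ultimately have "AE x in lebesgue. x \<in> G" by (auto elim: eventually_mono)
  then have aeG: "AE x in lborel. x \<in> G"
    by (simp add: AE_completion_iff)
  define S where "S x = indicator G x *\<^sub>R S0 x" for x
  have LS: "L12 (\<lambda>x. S x $ i $ j)" for i j
    unfolding S_def using L12_indicator[OF LS0 mG] by simp
  define U where "U x = ramp (- u x)" for x
  have mramp: "(\<lambda>t. ramp (- t)) \<in> borel_measurable borel"
    using borel_measurable_continuous_onI[OF smooth1_continuous[OF smooth1_ramp]] by measurable
  have lip: "\<bar>ramp (- s) - ramp (- t)\<bar> \<le> C * \<bar>s - t\<bar>" for s t
    using lipschitz_of_deriv_bounded[OF ramp_has_derivative C, of "- s" "- t"] by (simp add: abs_minus_commute)
  have LU: "L12 U"
    unfolding U_def[abs_def] by (rule L12_lipschitz[OF u(1) _ lip mramp]) (simp add: ramp_def)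
  have "(LBINT x. U x) \<le> 0"
  proof (rule psd_hessian_imp_zero[OF \<kappa> R0 LU])
    show "U x = 0" if "R0 < norm x" for x using u(2) out[OF that] by (simp add: U_def ramp_def)
    show "L12 (\<lambda>x. S x $ i $ j)" for i j by (rule LS)
    show "S x = 0" if "R0 < norm x" for x using S0_out[OF out[OF that]] by (simp add: S_def)
    show "transpose (S x) = S x" for x
      by (simp add: S_def S0_def transpose_def vec_eq_iff add.commute)
    show "0 \<le> trace (S x) + \<kappa> * norm (S x)" for x
      by (cases "x \<in> G") (simp_all add: S_def G_def trace_def)
    fix \<delta> :: real and x \<xi> :: "real^'n"
    assume \<delta>: "\<delta> > 0"
    note cs = csmooth_moll[OF \<delta>, where 'a='n]
    have "\<xi> \<bullet> ((\<chi> i j. conv (moll \<delta>) (\<lambda>y. S y $ i $ j) x) *v \<xi>) = (LBINT y. moll \<delta> (x - y) * (\<xi> \<bullet> (S y *v \<xi>)))"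
      by (rule quadratic_conv_matrix[OF cs L12_integrable[OF LS]])
    also have "\<dots> = (LBINT y. (- flat [:1,1:] (- u y)) * ((\<Sum>i\<in>UNIV. \<Sum>j\<in>UNIV. \<xi> $ i * \<xi> $ j * h i j y) * moll \<delta> (x - y)))"
    proof (rule integral_cong_AE)
      have m: "(\<lambda>y. moll \<delta> (x - y)) \<in> borel_measurable borel"
        by (intro borel_measurable_csmooth csmooth_reflect cs)
      show "(\<lambda>y. moll \<delta> (x - y) * (\<xi> \<bullet> (S y *v \<xi>))) \<in> borel_measurable lborel"
        unfolding inner_matrix_vector using m L12_measurable[OF LS] by measurable
      show "(\<lambda>y. (- flat [:1,1:] (- u y)) * ((\<Sum>i\<in>UNIV. \<Sum>j\<in>UNIV. \<xi> $ i * \<xi> $ j * h i j y) * moll \<delta> (x - y))) \<in> borel_measurable lborel"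
        using m mc[unfolded c_def[abs_def]] L12_measurable[OF h(1)] by measurable
      show "AE y in lborel. moll \<delta> (x - y) * (\<xi> \<bullet> (S y *v \<xi>)) =
          (- flat [:1,1:] (- u y)) * ((\<Sum>i\<in>UNIV. \<Sum>j\<in>UNIV. \<xi> $ i * \<xi> $ j * h i j y) * moll \<delta> (x - y))"
        using aeG
      proof eventually_elim
        case (elim y)
        then have "S y = S0 y" by (simp add: S_def)
        then show ?case unfolding S0_quad[of \<xi> y] c_def by (simp only: S0_quad c_def mult_ac)
      qed
    qed
    also have "\<dots> \<le> (LBINT y. ramp (- u y) * (\<Sum>i\<in>UNIV. \<Sum>j\<in>UNIV. \<xi> $ i * \<xi> $ j * partial i (partial j (\<lambda>y. moll \<delta> (x - y))) y))"
      by (rule kato_inequality[where \<Omega>=\<Omega> and w=w and \<phi>=\<phi>, OF u(1) w[rule_format] h(1) weak \<phi>(1)[rule_format] \<phi>(2) \<phi>(3)[rule_format]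
            csmooth_reflect[OF cs] moll_nonneg[OF \<delta>]])
    also have "\<dots> = \<xi> \<bullet> (hess (conv (moll \<delta>) U) x *v \<xi>)"
      unfolding quadratic_conv_hess[OF cs L12_integrable[OF LU]] U_def ..
    finally show "\<xi> \<bullet> ((\<chi> i j. conv (moll \<delta>) (\<lambda>y. S y $ i $ j) x) *v \<xi>) \<le> \<xi> \<bullet> (hess (conv (moll \<delta>) U) x *v \<xi>)" .
  qed
  moreover have U0: "U x \<ge> 0" for x unfolding U_def by (rule ramp_nonneg)
  then have "(LBINT x. U x) \<ge> 0" by (intro Bochner_Integration.integral_nonneg)
  ultimately have "(LBINT x. U x) = 0" by linarith
  then have "AE x in lborel. U x = 0"
    using integral_nonneg_eq_0_iff_AE[OF L12_integrable[OF LU] AE_I2[OF U0]] by blast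
  then have "AE x in lebesgue. U x = 0" by (rule AE_completion)
  then have "AE x in lebesgue_on \<Omega>. U x = 0"
    using assms(1) by (auto simp: AE_restrict_space_iff elim: eventually_mono)
  with u(3) show ?thesis
  proof eventually_elim
    case (elim x)
    then show ?case by (simp add: U_def ramp_eq_0_iff)
  qed
qed

end
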